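(* Consider the Gaussian/Poisson product mixture model described in the context, with bounded $\Theta$, and suppose that $g_0\in\mathcal G$ is finitely discrete. Then $$\mathcal W_1(\hat g,g_0)=O_{\mathbb P}\Big(\frac{|\mathrm{supp}(\hat g)|}{n^{1/4}}\Big),$$ where $|\mathrm{supp}(\hat g)|$ denotes the number of support points of $\hat g$. Moreover, when $d=1$ the factor $|\mathrm{supp}(\hat g)|$ can be removed, i.e. $\mathcal W_1(\hat g,g_0)=O_{\mathbb P}(n^{-1/4})$.
   Context: Model: let $\mathbb N=\{0,1,2,\dots\}$, $d\ge 1$, fix $b\in\{0,1,\dots,d\}$, and let $\Theta\subseteq\mathbb R^b\times(0,\infty)^{d-b}$ be bounded. For $\theta\in\Theta$ let $p_\theta(x)=\prod_{l=1}^d p_{\theta_l}(x_l)$ for $x\in\mathbb R^b\times\mathbb N^{d-b}$, where $p_{\theta_l}(x_l)=\phi(x_l-\theta_l)$ with $\phi(t)=\frac{1}{\sqrt{2\pi}}e^{-t^2/2}$ for $1\le l\le b$, and $p_{\theta_l}(x_l)=\frac{\theta_l^{x_l}}{x_l!}e^{-\theta_l}$ for $b+1\le l\le d$. The base measure $\mu$ is the product of Lebesgue measure on $\mathbb R^b$ and counting measure on $\mathbb N^{d-b}$. $\mathcal G$ is the set of all probability measures supported on $\Theta$, and $f_g(x)=\int_\Theta p_\theta(x)\,dg(\theta)$ for $g\in\mathcal G$. One observes i.i.d. $X_1,\dots,X_n$ with density $f_{g_0}$ with respect to $\mu$, where $g_0\in\mathcal G$ is fixed. With $\ell_n(f)=\sum_{i=1}^n\log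 f(X_i)$, the NPMLE $\hat g$ is any maximizer of $g\mapsto\ell_n(f_g)$ over $\mathcal G$. "Finitely discrete" means discrete and supported on finitely many points. The Wasserstein distance is $\mathcal W_1(g_1,g_2)=\inf_{(U,V)\in\Pi(g_1,g_2)}\mathbb E\|U-V\|$, where $\Pi(g_1,g_2)$ is the set of couplings of $g_1$ and $g_2$ and $\|\cdot\|$ is the Euclidean norm. *)

theory Defs
  imports "HOL-Probability.Probability"
begin

text \<open>
  The set \<open>B\<close> collects the Gaussian coordinates of \<^typ>\<open>real ^ 'd\<close>, the remaining ones are
  Poisson; \<open>b = card B\<close> ranges over \<open>0, \<dots>, d\<close>, and the usual convention that the Gaussian
  coordinates come first is only a labelling of the index type. Observations also live in
  \<^typ>\<open>real ^ 'd\<close>, with the counts embedded into the reals.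
\<close>

definition parameter_domain :: "'d::finite set \<Rightarrow> (real ^ 'd) set" where
  "parameter_domain B = {\<theta>. \<forall>l. l \<notin> B \<longrightarrow> 0 < \<theta> $ l}"

definition poisson_density :: "real \<Rightarrow> real \<Rightarrow> real" where
  "poisson_density t x =
     (if x \<in> \<nat> then t ^ nat \<lfloor>x\<rfloor> / fact (nat \<lfloor>x\<rfloor>) * exp (- t) else 0)"

definition product_density :: "'d::finite set \<Rightarrow> real ^ 'd \<Rightarrow> real ^ 'd \<Rightarrow> real" where
  "product_density B \<theta> x =
     (\<Prod>l\<in>UNIV. if l \<in> B then std_normal_density (x $ l - \<theta> $ l)
               else poisson_density (\<theta> $ l) (x $ l))"

text \<open>Lebesgue measure on the Gaussian coordinates, counting measure on the embedded naturals
  on the Poisson coordinates.\<close>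

definition base_measure :: "'d::finite set \<Rightarrow> (real ^ 'd) measure" where
  "base_measure B =
     distr (Pi\<^sub>M UNIV (\<lambda>l. if l \<in> B then lborel
                           else distr (count_space (UNIV :: nat set)) borel real))
           borel vec_lambda"

text \<open>Probability measures supported on \<open>\<Theta>\<close>, as Borel measures on the whole space. The
  almost-everywhere formulation does not require \<open>\<Theta>\<close> to be a Borel set.\<close>

definition mixing_measures :: "(real ^ 'd::finite) set \<Rightarrow> (real ^ 'd) measure set" where
  "mixing_measures \<Theta> = {g. prob_space g \<and> sets g = sets borel \<and> (AE \<theta> in g. \<theta> \<in> \<Theta>)}"

definition mixture_density :: "'d::finite set \<Rightarrow> (real ^ 'd) measure \<Rightarrow> real ^ 'd \<Rightarrow> real" where
  "mixture_density B g x = (\<integral>\<theta>. product_density B \<theta> x \<partial>g)"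

definition log_likelihood ::
    "'d::finite set \<Rightarrow> nat \<Rightarrow> (nat \<Rightarrow> real ^ 'd) \<Rightarrow> (real ^ 'd) measure \<Rightarrow> real" where
  "log_likelihood B n x g = (\<Sum>i<n. ln (mixture_density B g (x i)))"

definition NPMLE ::
    "'d::finite set \<Rightarrow> (real ^ 'd) set \<Rightarrow> nat \<Rightarrow> (nat \<Rightarrow> real ^ 'd) \<Rightarrow> (real ^ 'd) measure set" where
  "NPMLE B \<Theta> n x =
     {g \<in> mixing_measures \<Theta>.
        \<forall>h \<in> mixing_measures \<Theta>. log_likelihood B n x h \<le> log_likelihood B n x g}"

definition finitely_discrete :: "'a measure \<Rightarrow> bool" where
  "finitely_discrete g \<longleftrightarrow> (\<exists>S. finite S \<and> (AE \<theta> in g. \<theta> \<in> S))"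

definition support :: "'a::topological_space measure \<Rightarrow> 'a set" where
  "support g = {\<theta>. \<forall>U. open U \<longrightarrow> \<theta> \<in> U \<longrightarrow> emeasure g U > 0}"

text \<open>Equal to infinity if the support is infinite.\<close>

definition support_size :: "'a::topological_space measure \<Rightarrow> ennreal" where
  "support_size g = emeasure (count_space UNIV) (support g)"

definition couplings ::
    "'a::topological_space measure \<Rightarrow> 'a measure \<Rightarrow> ('a \<times> 'a) measure set" where
  "couplings g h =
     {\<pi>. sets \<pi> = sets (borel \<Otimes>\<^sub>M borel) \<and> distr \<pi> borel fst = g \<and> distr \<pi> borel snd = h}"

definition wasserstein1 ::
    "'a::real_normed_vector measure \<Rightarrow> 'a measure \<Rightarrow> ennreal" where
  "wasserstein1 g h =
     (INF \<pi> \<in> couplings g h. \<integral>\<^sup>+ z. ennreal (norm (fst z - snd z)) \<partial>\<pi>)"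

text \<open>
  \<open>bigO_P M A Y r\<close> is \<open>Y n = O\<^sub>P(r n)\<close> with random rates, for quantities defined on the
  events \<open>A n\<close> only (\<open>A n = space M\<close> gives the usual notion). The exceptional event \<open>E\<close> covers
  the possibly non-measurable set where the bound fails, i.e. outer probability is used.
\<close>

definition bigO_P ::
    "'w measure \<Rightarrow> (nat \<Rightarrow> 'w set) \<Rightarrow> (nat \<Rightarrow> 'w \<Rightarrow> ennreal) \<Rightarrow> (nat \<Rightarrow> 'w \<Rightarrow> ennreal) \<Rightarrow> bool" where
  "bigO_P M A Y r \<longleftrightarrow>
     (\<forall>\<epsilon>>0. \<exists>C::real. 0 < C \<and> (\<forall>\<^sub>F n in sequentially.
        \<exists>E \<in> sets M. measure M E \<le> \<epsilon> \<and> {\<omega> \<in> A n. \<not> Y n \<omega> \<le> ennreal C * r n \<omega>} \<subseteq> E))"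

text \<open>If \<open>\<Theta>\<close> is not closed, a maximizer need not exist for every sample; statements about
  the NPMLE are then understood on this set.\<close>

definition NPMLE_exists ::
    "'w measure \<Rightarrow> 'd::finite set \<Rightarrow> (real ^ 'd) set \<Rightarrow> (nat \<Rightarrow> 'w \<Rightarrow> real ^ 'd) \<Rightarrow> nat \<Rightarrow> 'w set" where
  "NPMLE_exists M B \<Theta> X n = {\<omega> \<in> space M. NPMLE B \<Theta> n (\<lambda>i. X i \<omega>) \<noteq> {}}"

end

theory Submission
  imports Defs
begin

text \<open>
  Let \<open>S\<close> be the set of atoms of \<open>g\<^sub>0\<close>, \<open>f\<^sub>0\<close> the density of the observations, \<open>P\<close> their law and
  \<open>P\<^sub>n\<close> the empirical mean, and put \<open>s = f\<^sub>g / f\<^sub>0 - 1\<close> for a mixing measure \<open>g\<close>. The rate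
  \<open>n powr (-1/4)\<close> is proved in every dimension; it gives the first assertion because a support has
  at least one point.

  \<^bold>\<open>Reduction to finitely many moments.\<close> Use the coordinates \<open>y\<^sub>l = exp \<theta>\<^sub>l\<close>. A function \<open>u\<close> of \<open>\<theta>\<close>
  that is affine in \<open>y\<close> near every atom, up to a quadratic error, differs from its Hermite
  interpolant at \<open>S\<close> by at most a multiple of \<open>m = \<Prod>\<^sub>b |y - y\<^sub>b|\<^sup>2\<close>. Since \<open>m\<close> is nonnegative and
  vanishes on \<open>S\<close>, the integral of the error against \<open>g\<close> is a multiple of \<open>\<integral> m d(g - g\<^sub>0)\<close>. So
  \<open>|\<integral> u d(g - g\<^sub>0)|\<close> is controlled by the discrepancy \<open>\<Delta>(g)\<close>, the sum of \<open>|\<integral> Q d(g - g\<^sub>0)|\<close> over a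
  finite set of polynomials \<open>Q\<close> in \<open>y\<close> (\<open>jet_bounded_integral_diff\<close>). The squared distance to the
  nearest atom and the indicators of the cells around the atoms are such functions \<open>u\<close>, which yields
  \<open>W\<^sub>1(g, g\<^sub>0) \<le> C (sqrt \<Delta> + \<Delta>)\<close> (\<open>wasserstein1_le_discrepancy\<close>). It remains to show that
  \<open>\<Delta>\<close> is of order \<open>n powr (-1/2)\<close> at the maximum likelihood estimator.

  \<^bold>\<open>Fluctuations.\<close> Every polynomial \<open>Q\<close> in \<open>y\<close> has an unbiased estimator \<open>q\<close>, that is,
  \<open>\<integral> Q d(g - g\<^sub>0) = P[q s]\<close>. The fluctuation \<open>(P\<^sub>n - P)[q s]\<close> is the integral against
  \<open>g - g\<^sub>0\<close> of \<open>D(\<theta>) = (P\<^sub>n - P)[q p\<^sub>\<theta> / f\<^sub>0]\<close>. Both densities are exponential families, so \<open>D\<close> is a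
  power series in \<open>\<theta>\<close>, up to a smooth factor, with centred averages as coefficients. These have mean
  size \<open>n powr (-1/2)\<close> times a factor that decreases faster than any geometric sequence, whereas the
  jets of the monomials grow at most geometrically. Markov's inequality alone therefore bounds the
  jets of \<open>D\<close> by some \<open>w\<close> of order \<open>n powr (-1/2)\<close> (\<open>empirical_process_jet_bounded\<close>), and the first
  part gives \<open>|(P\<^sub>n - P)[q s]| \<le> C w \<Delta>(g)\<close> for all \<open>g\<close> at once. The factor \<open>\<Delta>(g)\<close> is the point:
  it saves the logarithms that a bound by entropy integrals would cost.

  \<^bold>\<open>Likelihood.\<close> At a maximizer, \<open>0 \<le> P\<^sub>n[ln (1 + s)] \<le> P\<^sub>n[s] - P\<^sub>n[s\<^sup>2 / (2 (2 + s))]\<close>. As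
  \<open>P[s] = 0\<close>, the mean \<open>P\<^sub>n[s]\<close> is a fluctuation, at most \<open>C w \<Delta>\<close>. By the Cauchy--Schwarz inequality
  \<open>(P\<^sub>n[q s])\<^sup>2 \<le> P\<^sub>n[s\<^sup>2 / (2 + s)] P\<^sub>n[q\<^sup>2 (2 + s)]\<close>, which is of order \<open>w \<Delta>\<close>. Together,
  \<open>\<Delta> \<le> C sqrt (w \<Delta>) + C w \<Delta>\<close>, hence \<open>\<Delta>\<close> is of order \<open>w\<close> (\<open>npmle_discrepancy_bound\<close>).
\<close>

section \<open>Jets at finitely many nodes and Hermite interpolation\<close>

lemma finite_uniform_bound:
  fixes P :: "'a \<Rightarrow> real \<Rightarrow> bool"
  assumes "finite A" and "\<And>a. a \<in> A \<Longrightarrow> \<exists>C. P a C"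
    and "\<And>a C C'. P a C \<Longrightarrow> C \<le> C' \<Longrightarrow> P a C'"
  shows "\<exists>C\<ge>0. \<forall>a\<in>A. P a C"
  using assms(1,2)
proof (induction A rule: finite_induct)
  case empty
  show ?case by auto
next
  case (insert x F)
  then obtain C C' where "C \<ge> 0" "\<forall>a\<in>F. P a C" "P x C'" by (meson insert_iff)
  then show ?case
    by (intro exI[of _ "max C C'"]) (auto intro: assms(3) simp: max_def)
qed

text \<open>
  The nodes will be the atoms of a finitely discrete measure. The map \<open>c\<close> supplies coordinates in which
  smoothness is measured and in which the interpolating functions are polynomials.
\<close>

locale interpolation_nodes =
  fixes c :: "'a::topological_space \<Rightarrow> 'b::euclidean_space"
    and \<Theta> S :: "'a set" and D :: real
  assumes c_measurable: "c \<in> borel_measurable borel"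
    and diam: "\<And>\<theta> a. \<theta> \<in> \<Theta> \<Longrightarrow> a \<in> S \<Longrightarrow> norm (c \<theta> - c a) \<le> D"
    and nodes_sub: "S \<subseteq> \<Theta>"
    and finite_nodes: "finite S"
    and nodes_nonempty: "S \<noteq> {}"
    and c_inj: "inj_on c S"
begin

abbreviation sq_dist :: "'a \<Rightarrow> 'a \<Rightarrow> real" where
  "sq_dist \<theta> a \<equiv> (norm (c \<theta> - c a))\<^sup>2"

text \<open>
  The vector \<open>v\<close> plays the role of the gradient of \<open>u\<close> with respect to \<open>c\<close> at the node \<open>a\<close>; any
  function with a quadratic contact to an affine function of \<open>c\<close> at the nodes qualifies, such as the
  indicator of a neighbourhood of a node. One constant bounds the values, the gradients and the remainders, so that
  bounds of this kind can be multiplied and summed.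
\<close>

definition jet_bounded :: "real \<Rightarrow> ('a \<Rightarrow> real) \<Rightarrow> bool" where
  "jet_bounded U u \<longleftrightarrow>
     u \<in> borel_measurable borel \<and> (\<forall>\<theta>\<in>\<Theta>. \<bar>u \<theta>\<bar> \<le> U) \<and>
     (\<forall>a\<in>S. \<exists>v. norm v \<le> U \<and>
        (\<forall>\<theta>\<in>\<Theta>. \<bar>u \<theta> - u a - v \<bullet> (c \<theta> - c a)\<bar> \<le> U * sq_dist \<theta> a))"

lemma D_nonneg: "0 \<le> D"
  using diam nodes_sub nodes_nonempty by (meson equals0I norm_ge_zero order_trans subsetD)

lemma jet_boundedD:
  assumes "jet_bounded U u"
  shows "u \<in> borel_measurable borel" "\<theta> \<in> \<Theta> \<Longrightarrow> \<bar>u \<theta>\<bar> \<le> U"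
  using assms unfolding jet_bounded_def by auto

lemma jet_bounded_nonneg: "jet_bounded U u \<Longrightarrow> 0 \<le> U"
  using nodes_sub nodes_nonempty unfolding jet_bounded_def
  by (meson equals0I norm_ge_zero order_trans)

lemma jet_bounded_mono: "jet_bounded U u \<Longrightarrow> U \<le> V \<Longrightarrow> jet_bounded V u"
  unfolding jet_bounded_def
  by (meson mult_right_mono order_trans zero_le_power2)

lemma jet_bounded_const: "\<bar>r\<bar> \<le> U \<Longrightarrow> jet_bounded U (\<lambda>_. r)"
  unfolding jet_bounded_def by (auto intro!: exI[of _ 0])

lemma jet_bounded_coord:
  assumes "e \<in> Basis" "\<And>\<theta>. \<theta> \<in> \<Theta> \<Longrightarrow> norm (c \<theta>) \<le> U" "1 \<le> U"
  shows "jet_bounded U (\<lambda>\<theta>. c \<theta> \<bullet> e)"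
  unfolding jet_bounded_def
proof (intro conjI ballI)
  show "(\<lambda>\<theta>. c \<theta> \<bullet> e) \<in> borel_measurable borel"
    using c_measurable by measurable
  show "\<bar>c \<theta> \<bullet> e\<bar> \<le> U" if "\<theta> \<in> \<Theta>" for \<theta>
    using Basis_le_norm[OF assms(1), of "c \<theta>"] assms(2)[OF that] by simp
  fix a assume "a \<in> S"
  show "\<exists>v. norm v \<le> U \<and>
        (\<forall>\<theta>\<in>\<Theta>. \<bar>c \<theta> \<bullet> e - c a \<bullet> e - v \<bullet> (c \<theta> - c a)\<bar> \<le> U * sq_dist \<theta> a)"
    using assms by (intro exI[of _ e]) (auto simp: inner_diff_right inner_commute)
qed

lemma jet_bounded_add:
  assumes "jet_bounded U u" "jet_bounded W w"
  shows "jet_bounded (U + W) (\<lambda>\<theta>. u \<theta> + w \<theta>)"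
  unfolding jet_bounded_def
proof (intro conjI ballI)
  show "(\<lambda>\<theta>. u \<theta> + w \<theta>) \<in> borel_measurable borel"
    using assms[THEN jet_boundedD(1)] by measurable
  show "\<bar>u \<theta> + w \<theta>\<bar> \<le> U + W" if "\<theta> \<in> \<Theta>" for \<theta>
    using assms[THEN jet_boundedD(2), OF that] by linarith
  fix a assume a: "a \<in> S"
  obtain v where v: "norm v \<le> U"
    "\<And>\<theta>. \<theta> \<in> \<Theta> \<Longrightarrow> \<bar>u \<theta> - u a - v \<bullet> (c \<theta> - c a)\<bar> \<le> U * sq_dist \<theta> a"
    using assms(1) a unfolding jet_bounded_def by blast
  obtain v' where v': "norm v' \<le> W"
    "\<And>\<theta>. \<theta> \<in> \<Theta> \<Longrightarrow> \<bar>w \<theta> - w a - v' \<bullet> (c \<theta> - c a)\<bar> \<le> W * sq_dist \<theta> a"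
    using assms(2) a unfolding jet_bounded_def by blast
  show "\<exists>v. norm v \<le> U + W \<and> (\<forall>\<theta>\<in>\<Theta>. \<bar>u \<theta> + w \<theta> - (u a + w a) - v \<bullet> (c \<theta> - c a)\<bar>
          \<le> (U + W) * sq_dist \<theta> a)"
  proof (intro exI[of _ "v + v'"] conjI ballI)
    show "norm (v + v') \<le> U + W" using v v' norm_triangle_ineq[of v v'] by linarith
    fix \<theta> assume "\<theta> \<in> \<Theta>"
    from v(2)[OF this] v'(2)[OF this]
    show "\<bar>u \<theta> + w \<theta> - (u a + w a) - (v + v') \<bullet> (c \<theta> - c a)\<bar>
          \<le> (U + W) * sq_dist \<theta> a"
      unfolding distrib_right inner_add_left by linarith
  qed
qed

lemma jet_bounded_lipschitz:
  assumes u: "jet_bounded U u" and a: "a \<in> S" and \<theta>: "\<theta> \<in> \<Theta>"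
  shows "\<bar>u \<theta> - u a\<bar> \<le> (1 + D) * U * norm (c \<theta> - c a)"
proof -
  obtain v where v: "norm v \<le> U"
      "\<bar>u \<theta> - u a - v \<bullet> (c \<theta> - c a)\<bar> \<le> U * sq_dist \<theta> a"
    using u a \<theta> unfolding jet_bounded_def by blast
  have vd: "\<bar>v \<bullet> (c \<theta> - c a)\<bar> \<le> U * norm (c \<theta> - c a)"
    using Cauchy_Schwarz_ineq2 v(1) by (meson mult_right_mono norm_ge_zero order_trans)
  have "U * sq_dist \<theta> a \<le> U * (D * norm (c \<theta> - c a))"
    using jet_bounded_nonneg[OF u] diam[OF \<theta> a]
    by (auto simp: power2_eq_square intro!: mult_left_mono mult_right_mono)
  then show ?thesis using v vd by (simp add: algebra_simps)
qed

text \<open>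
  A product keeps a jet bound that is the product of the jet bounds up to a factor depending on
  the diameter only. Monomials of degree \<open>k\<close> therefore have jets growing at most geometrically
  in \<open>k\<close>, and this crude rate is all that power series need.
\<close>

lemma jet_bounded_mult:
  assumes "jet_bounded U u" "jet_bounded W w"
  shows "jet_bounded ((3 + D) * (U * W)) (\<lambda>\<theta>. u \<theta> * w \<theta>)"
  unfolding jet_bounded_def
proof (intro conjI ballI)
  have UW: "0 \<le> U" "0 \<le> W" "0 \<le> U * W"
    using assms[THEN jet_bounded_nonneg] by auto
  have big: "k * (U * W) \<le> (3 + D) * (U * W)" if "k \<le> 3" for k
    using UW D_nonneg that by (intro mult_right_mono) auto
  show "(\<lambda>\<theta>. u \<theta> * w \<theta>) \<in> borel_measurable borel"
    using assms[THEN jet_boundedD(1)] by measurable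
  show "\<bar>u \<theta> * w \<theta>\<bar> \<le> (3 + D) * (U * W)" if "\<theta> \<in> \<Theta>" for \<theta>
  proof -
    have "\<bar>u \<theta> * w \<theta>\<bar> \<le> U * W"
      unfolding abs_mult using assms[THEN jet_boundedD(2), OF that] UW by (intro mult_mono) auto
    then show ?thesis using big[of 1] by simp
  qed
  fix a assume a: "a \<in> S"
  with nodes_sub have a': "a \<in> \<Theta>" by auto
  obtain v where v: "norm v \<le> U"
    "\<And>\<theta>. \<theta> \<in> \<Theta> \<Longrightarrow> \<bar>u \<theta> - u a - v \<bullet> (c \<theta> - c a)\<bar> \<le> U * sq_dist \<theta> a"
    using assms(1) a unfolding jet_bounded_def by blast
  obtain v' where v': "norm v' \<le> W"
    "\<And>\<theta>. \<theta> \<in> \<Theta> \<Longrightarrow> \<bar>w \<theta> - w a - v' \<bullet> (c \<theta> - c a)\<bar> \<le> W * sq_dist \<theta> a"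
    using assms(2) a unfolding jet_bounded_def by blast
  show "\<exists>v. norm v \<le> (3 + D) * (U * W) \<and>
        (\<forall>\<theta>\<in>\<Theta>. \<bar>u \<theta> * w \<theta> - u a * w a - v \<bullet> (c \<theta> - c a)\<bar>
          \<le> (3 + D) * (U * W) * sq_dist \<theta> a)"
  proof (intro exI[of _ "u a *\<^sub>R v' + w a *\<^sub>R v"] conjI ballI)
    have "norm (u a *\<^sub>R v' + w a *\<^sub>R v) \<le> \<bar>u a\<bar> * norm v' + \<bar>w a\<bar> * norm v"
      using norm_triangle_ineq[of "u a *\<^sub>R v'" "w a *\<^sub>R v"] by simp
    also have "\<dots> \<le> U * W + W * U"
      using assms[THEN jet_boundedD(2), OF a'] v v' UW by (intro add_mono mult_mono) auto
    finally show "norm (u a *\<^sub>R v' + w a *\<^sub>R v) \<le> (3 + D) * (U * W)"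
      using big[of 2] by (simp add: mult.commute)
  next
    fix \<theta> assume \<theta>: "\<theta> \<in> \<Theta>"
    define \<delta> where "\<delta> = c \<theta> - c a"
    define r where "r = u \<theta> - u a - v \<bullet> \<delta>"
    define r' where "r' = w \<theta> - w a - v' \<bullet> \<delta>"
    have r: "\<bar>r\<bar> \<le> U * (norm \<delta>)\<^sup>2" "\<bar>r'\<bar> \<le> W * (norm \<delta>)\<^sup>2"
      using v(2)[OF \<theta>] v'(2)[OF \<theta>] by (auto simp: r_def r'_def \<delta>_def)
    have vd: "\<bar>v' \<bullet> \<delta>\<bar> \<le> W * norm \<delta>"
      using Cauchy_Schwarz_ineq2 v'(1) by (meson mult_right_mono norm_ge_zero order_trans)
    have du: "\<bar>u \<theta> - u a\<bar> \<le> (1 + D) * U * norm \<delta>"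
      unfolding \<delta>_def by (rule jet_bounded_lipschitz[OF assms(1) a \<theta>])
    have "u \<theta> * w \<theta> - u a * w a - (u a *\<^sub>R v' + w a *\<^sub>R v) \<bullet> \<delta>
        = u \<theta> * r' + w a * r + (u \<theta> - u a) * (v' \<bullet> \<delta>)"
      by (simp add: r_def r'_def inner_add_left algebra_simps)
    also have "\<bar>\<dots>\<bar> \<le> \<bar>u \<theta>\<bar> * \<bar>r'\<bar> + \<bar>w a\<bar> * \<bar>r\<bar> + \<bar>u \<theta> - u a\<bar> * \<bar>v' \<bullet> \<delta>\<bar>"
      by (simp add: abs_mult[symmetric])
    also have "\<dots> \<le> U * (W * (norm \<delta>)\<^sup>2) + W * (U * (norm \<delta>)\<^sup>2)
                   + ((1 + D) * U * norm \<delta>) * (W * norm \<delta>)"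
      using r vd du UW D_nonneg jet_boundedD(2)[OF assms(1) \<theta>] jet_boundedD(2)[OF assms(2) a']
      by (intro add_mono mult_mono) auto
    also have "\<dots> = (3 + D) * (U * W) * (norm \<delta>)\<^sup>2"
      by (simp add: algebra_simps power2_eq_square)
    finally show "\<bar>u \<theta> * w \<theta> - u a * w a - (u a *\<^sub>R v' + w a *\<^sub>R v) \<bullet> (c \<theta> - c a)\<bar>
          \<le> (3 + D) * (U * W) * sq_dist \<theta> a"
      by (simp add: \<delta>_def)
  qed
qed

text \<open>
  Here the constant may depend on everything in an uncontrolled way; compositions are used for
  finitely many functions only.
\<close>

lemma jet_bounded_compose:
  assumes u: "jet_bounded U u" and f: "f \<in> borel_measurable borel"
    and T: "\<And>\<theta>. \<theta> \<in> \<Theta> \<Longrightarrow> u \<theta> \<in> T"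
    and fK: "\<And>s. s \<in> T \<Longrightarrow> \<bar>f s\<bar> \<le> K" "\<And>s. s \<in> T \<Longrightarrow> \<bar>f' s\<bar> \<le> K"
    and taylor: "\<And>s t. s \<in> T \<Longrightarrow> t \<in> T \<Longrightarrow> \<bar>f s - f t - f' t * (s - t)\<bar> \<le> K * (s - t)\<^sup>2"
  shows "\<exists>V. jet_bounded V (\<lambda>\<theta>. f (u \<theta>))"
proof -
  have U: "0 \<le> U" using u by (rule jet_bounded_nonneg)
  obtain a0 where "a0 \<in> \<Theta>" using nodes_sub nodes_nonempty by auto
  then have K: "0 \<le> K" using fK(1)[OF T] by (meson abs_ge_zero order_trans)
  define V where "V = K + K * U + K * ((1 + D) * U)\<^sup>2"
  have KV: "K \<le> V" "K * U \<le> V" "K * U + K * ((1 + D) * U)\<^sup>2 \<le> V"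
    using K U unfolding V_def by auto
  have "jet_bounded V (\<lambda>\<theta>. f (u \<theta>))"
    unfolding jet_bounded_def
  proof (intro conjI ballI)
    show "(\<lambda>\<theta>. f (u \<theta>)) \<in> borel_measurable borel"
      using f jet_boundedD(1)[OF u] by measurable
    show "\<bar>f (u \<theta>)\<bar> \<le> V" if "\<theta> \<in> \<Theta>" for \<theta>
      using fK(1)[OF T[OF that]] KV by linarith
    fix a assume a: "a \<in> S"
    with nodes_sub have a': "a \<in> \<Theta>" by auto
    obtain v where v: "norm v \<le> U"
      "\<And>\<theta>. \<theta> \<in> \<Theta> \<Longrightarrow> \<bar>u \<theta> - u a - v \<bullet> (c \<theta> - c a)\<bar> \<le> U * sq_dist \<theta> a"
      using u a unfolding jet_bounded_def by blast
    show "\<exists>v. norm v \<le> V \<and> (\<forall>\<theta>\<in>\<Theta>. \<bar>f (u \<theta>) - f (u a) - v \<bullet> (c \<theta> - c a)\<bar>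
            \<le> V * sq_dist \<theta> a)"
    proof (intro exI[of _ "f' (u a) *\<^sub>R v"] conjI ballI)
      have "norm (f' (u a) *\<^sub>R v) \<le> K * U"
        using fK(2)[OF T[OF a']] v(1) K by (simp add: mult_mono)
      then show "norm (f' (u a) *\<^sub>R v) \<le> V" using KV by linarith
    next
      fix \<theta> assume \<theta>: "\<theta> \<in> \<Theta>"
      define \<delta> where "\<delta> = c \<theta> - c a"
      have r: "\<bar>u \<theta> - u a - v \<bullet> \<delta>\<bar> \<le> U * (norm \<delta>)\<^sup>2" using v(2)[OF \<theta>] by (simp add: \<delta>_def)
        have du: "\<bar>u \<theta> - u a\<bar> \<le> (1 + D) * U * norm \<delta>"
        unfolding \<delta>_def by (rule jet_bounded_lipschitz[OF u a \<theta>])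
      have "\<bar>f (u \<theta>) - f (u a) - f' (u a) * (u \<theta> - u a)\<bar> \<le> K * (u \<theta> - u a)\<^sup>2"
        using taylor[OF T[OF \<theta>] T[OF a']] .
      also have "\<dots> \<le> K * ((1 + D) * U * norm \<delta>)\<^sup>2"
        using du K by (intro mult_left_mono) (auto simp: abs_le_square_iff[symmetric])
      finally have 1: "\<bar>f (u \<theta>) - f (u a) - f' (u a) * (u \<theta> - u a)\<bar> \<le> K * ((1 + D) * U * norm \<delta>)\<^sup>2" .
      have "\<bar>f' (u a) * (u \<theta> - u a - v \<bullet> \<delta>)\<bar> \<le> K * (U * (norm \<delta>)\<^sup>2)"
        unfolding abs_mult using r fK(2)[OF T[OF a']] K by (intro mult_mono) auto
      with 1 have "\<bar>f (u \<theta>) - f (u a) - f' (u a) * (v \<bullet> \<delta>)\<bar>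
         \<le> K * (U * (norm \<delta>)\<^sup>2) + K * ((1 + D) * U * norm \<delta>)\<^sup>2"
        unfolding right_diff_distrib by linarith
      also have "\<dots> = (K * U + K * ((1 + D) * U)\<^sup>2) * (norm \<delta>)\<^sup>2"
        unfolding power_mult_distrib distrib_right[of "K * U"] by (simp only: mult.assoc)
      also have "\<dots> \<le> V * (norm \<delta>)\<^sup>2" using KV by (intro mult_right_mono) auto
      finally show "\<bar>f (u \<theta>) - f (u a) - (f' (u a) *\<^sub>R v) \<bullet> (c \<theta> - c a)\<bar>
            \<le> V * sq_dist \<theta> a"
        by (simp add: \<delta>_def)
    qed
  qed
  then show ?thesis ..
qed

lemma jet_bounded_power:
  assumes "jet_bounded U u"
  shows "jet_bounded (((3 + D) * U) ^ k) (\<lambda>\<theta>. u \<theta> ^ k)"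
proof (induction k)
  case 0
  show ?case by (simp add: jet_bounded_const)
next
  case (Suc k)
  from jet_bounded_mult[OF assms Suc] show ?case by (simp add: mult.assoc)
qed

lemma jet_bounded_prod:
  assumes "finite F" "\<And>i. i \<in> F \<Longrightarrow> jet_bounded (U i) (u i)"
  shows "jet_bounded (\<Prod>i\<in>F. (3 + D) * U i) (\<lambda>\<theta>. \<Prod>i\<in>F. u i \<theta>)"
  using assms
proof (induction F rule: finite_induct)
  case empty
  show ?case by (simp add: jet_bounded_const)
next
  case (insert x F)
  then have "jet_bounded ((3 + D) * (U x * (\<Prod>i\<in>F. (3 + D) * U i))) (\<lambda>\<theta>. u x \<theta> * (\<Prod>i\<in>F. u i \<theta>))"
    by (intro jet_bounded_mult) auto
  with insert.hyps show ?case by (simp add: mult.assoc)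
qed

inductive_set polynomials :: "('a \<Rightarrow> real) set" where
  const: "(\<lambda>_. r) \<in> polynomials"
| coord: "e \<in> Basis \<Longrightarrow> (\<lambda>\<theta>. c \<theta> \<bullet> e) \<in> polynomials"
| add: "u \<in> polynomials \<Longrightarrow> w \<in> polynomials \<Longrightarrow> (\<lambda>\<theta>. u \<theta> + w \<theta>) \<in> polynomials"
| mult: "u \<in> polynomials \<Longrightarrow> w \<in> polynomials \<Longrightarrow> (\<lambda>\<theta>. u \<theta> * w \<theta>) \<in> polynomials"

lemma polynomials_diff:
  "u \<in> polynomials \<Longrightarrow> w \<in> polynomials \<Longrightarrow> (\<lambda>\<theta>. u \<theta> - w \<theta>) \<in> polynomials"
  using polynomials.add[of u "\<lambda>\<theta>. -1 * w \<theta>"] polynomials.mult[OF polynomials.const[of "-1"], of w]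
  by simp

lemma polynomials_sum:
  "finite F \<Longrightarrow> (\<And>i. i \<in> F \<Longrightarrow> u i \<in> polynomials) \<Longrightarrow> (\<lambda>\<theta>. \<Sum>i\<in>F. u i \<theta>) \<in> polynomials"
  by (induction F rule: finite_induct) (auto intro: polynomials.intros)

lemma polynomials_prod:
  "finite F \<Longrightarrow> (\<And>i. i \<in> F \<Longrightarrow> u i \<in> polynomials) \<Longrightarrow> (\<lambda>\<theta>. \<Prod>i\<in>F. u i \<theta>) \<in> polynomials"
  by (induction F rule: finite_induct) (auto intro: polynomials.intros)

lemma polynomials_dist_sq: "(\<lambda>\<theta>. (norm (c \<theta> - y))\<^sup>2) \<in> polynomials"
proof -
  have "(\<lambda>\<theta>. (norm (c \<theta> - y))\<^sup>2) = (\<lambda>\<theta>. \<Sum>e\<in>Basis. (c \<theta> \<bullet> e - y \<bullet> e) * (c \<theta> \<bullet> e - y \<bullet> e))"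
    by (rule ext, subst power2_norm_eq_inner, subst euclidean_inner)
       (simp add: inner_diff_left power2_eq_square)
  also have "\<dots> \<in> polynomials"
    by (intro polynomials_sum polynomials.mult polynomials_diff polynomials.coord
        polynomials.const finite_Basis)
  finally show ?thesis .
qed

lemma norm_c_bounded: "\<exists>U\<ge>1. \<forall>\<theta>\<in>\<Theta>. norm (c \<theta>) \<le> U"
proof -
  obtain a where a: "a \<in> S" using nodes_nonempty by auto
  have "norm (c \<theta>) \<le> max 1 (D + norm (c a))" if "\<theta> \<in> \<Theta>" for \<theta>
    using diam[OF that a] norm_triangle_sub[of "c \<theta>" "c a"] by simp
  then show ?thesis by (meson max.cobounded1)
qed

lemma polynomials_jet_bounded: "u \<in> polynomials \<Longrightarrow> \<exists>U. jet_bounded U u"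
proof (induction rule: polynomials.induct)
  case (const r)
  show ?case by (intro exI[of _ "\<bar>r\<bar>"] jet_bounded_const) simp
next
  case (coord e)
  then show ?case using norm_c_bounded jet_bounded_coord by meson
qed (use jet_bounded_add jet_bounded_mult in blast)+

text \<open>
  Since \<open>hat a\<close> has double zeros at the other nodes and the value 1 at \<open>a\<close>, the function
  \<open>bump a = 1 - (1 - hat a)\<^sup>2\<close> keeps these double zeros and takes the value 1 at \<open>a\<close> to second order.
  The sums of \<open>bump a\<close> times affine functions are thus a Hermite interpolation of values and
  gradients at all nodes.
\<close>

definition hat :: "'a \<Rightarrow> 'a \<Rightarrow> real" where
  "hat a \<theta> = (\<Prod>b\<in>S - {a}. sq_dist \<theta> b / sq_dist a b)"

definition bump :: "'a \<Rightarrow> 'a \<Rightarrow> real" where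
  "bump a \<theta> = hat a \<theta> * (2 - hat a \<theta>)"

definition vanishing :: "'a \<Rightarrow> real" where
  "vanishing \<theta> = (\<Prod>b\<in>S. sq_dist \<theta> b)"

lemma hat_poly: "hat a \<in> polynomials"
proof -
  have "hat a = (\<lambda>\<theta>. \<Prod>b\<in>S - {a}. (1 / sq_dist a b) * sq_dist \<theta> b)"
    by (auto simp: hat_def fun_eq_iff)
  also have "\<dots> \<in> polynomials"
    using finite_nodes
    by (intro polynomials_prod polynomials.mult polynomials_dist_sq polynomials.const) auto
  finally show ?thesis .
qed

lemma bump_poly: "bump a \<in> polynomials"
  unfolding bump_def[abs_def]
  by (intro polynomials.mult polynomials_diff hat_poly polynomials.const)

lemma vanishing_poly: "vanishing \<in> polynomials"
  unfolding vanishing_def[abs_def] using finite_nodes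
  by (intro polynomials_prod polynomials_dist_sq)

lemma hat_self: "a \<in> S \<Longrightarrow> hat a a = 1"
  unfolding hat_def using c_inj by (intro prod.neutral) (auto simp: inj_on_def)

lemma vanishing_node: "a \<in> S \<Longrightarrow> vanishing a = 0"
  unfolding vanishing_def using finite_nodes by (intro prod_zero) auto

lemma hat_jet_bounded: "\<exists>H\<ge>0. \<forall>a\<in>S. jet_bounded H (hat a)"
  by (rule finite_uniform_bound[OF finite_nodes])
     (auto intro: polynomials_jet_bounded[OF hat_poly] jet_bounded_mono)

lemma bump_near_own_node: "\<exists>C\<ge>0. \<forall>a\<in>S. \<forall>\<theta>\<in>\<Theta>. \<bar>1 - bump a \<theta>\<bar> \<le> C * sq_dist \<theta> a"
proof -
  obtain H where H: "H \<ge> 0" "\<And>a. a \<in> S \<Longrightarrow> jet_bounded H (hat a)" using hat_jet_bounded by auto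
  have "\<bar>1 - bump a \<theta>\<bar> \<le> ((1 + D) * H)\<^sup>2 * sq_dist \<theta> a" if "a \<in> S" "\<theta> \<in> \<Theta>" for a \<theta>
  proof -
    have "\<bar>hat a \<theta> - 1\<bar> \<le> (1 + D) * H * norm (c \<theta> - c a)"
      using jet_bounded_lipschitz[OF H(2) that(1) that(2), OF that(1)] hat_self[OF that(1)] by simp
    then have "(hat a \<theta> - 1)\<^sup>2 \<le> ((1 + D) * H * norm (c \<theta> - c a))\<^sup>2"
      by (auto simp: abs_le_square_iff[symmetric])
    moreover have "1 - bump a \<theta> = (hat a \<theta> - 1)\<^sup>2"
      by (simp add: bump_def power2_eq_square algebra_simps)
    ultimately show ?thesis by (simp add: power_mult_distrib)
  qed
  then show ?thesis by (intro exI[of _ "((1 + D) * H)\<^sup>2"]) auto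
qed

lemma bump_near_other_node:
  "\<exists>C\<ge>0. \<forall>a\<in>S. \<forall>b\<in>S. a \<noteq> b \<longrightarrow> (\<forall>\<theta>\<in>\<Theta>. \<bar>bump b \<theta>\<bar> \<le> C * sq_dist \<theta> a)"
proof -
  have "\<exists>C. \<forall>\<theta>\<in>\<Theta>. \<bar>bump b \<theta>\<bar> \<le> C * sq_dist \<theta> a" if ab: "a \<in> S" "b \<in> S" "a \<noteq> b" for a b
  proof -
    define rest where "rest \<theta> = (\<Prod>s\<in>S - {b} - {a}. (1 / sq_dist b s) * sq_dist \<theta> s)
        * (2 - hat b \<theta>) * (1 / sq_dist b a)" for \<theta>
    have "rest \<in> polynomials"
      unfolding rest_def[abs_def] using finite_nodes
      by (intro polynomials.mult polynomials_prod polynomials_diff polynomials.const hat_poly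
          polynomials_dist_sq) auto
    then obtain U where U: "jet_bounded U rest" using polynomials_jet_bounded by blast
    have eq: "bump b \<theta> = rest \<theta> * sq_dist \<theta> a" for \<theta>
    proof -
      have "hat b \<theta> = sq_dist \<theta> a / sq_dist b a
           * (\<Prod>s\<in>S - {b} - {a}. sq_dist \<theta> s / sq_dist b s)"
        unfolding hat_def using ab finite_nodes by (intro prod.remove) auto
      then show ?thesis
        unfolding bump_def[of b \<theta>] rest_def by (simp add: mult_ac)
    qed
    show ?thesis
      using jet_boundedD(2)[OF U] by (intro exI[of _ U]) (auto simp: eq abs_mult intro!: mult_right_mono)
  qed
  then have *: "\<exists>C. a \<noteq> b \<longrightarrow> (\<forall>\<theta>\<in>\<Theta>. \<bar>bump b \<theta>\<bar> \<le> C * sq_dist \<theta> a)" if "a \<in> S" "b \<in> S" for a b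
    using that by blast
  have "\<exists>C\<ge>0. \<forall>p\<in>S \<times> S. fst p \<noteq> snd p \<longrightarrow>
     (\<forall>\<theta>\<in>\<Theta>. \<bar>bump (snd p) \<theta>\<bar> \<le> C * (norm (c \<theta> - c (fst p)))\<^sup>2)"
  proof (rule finite_uniform_bound)
    show "finite (S \<times> S)" using finite_nodes by auto
    show "\<exists>C. fst p \<noteq> snd p \<longrightarrow>
     (\<forall>\<theta>\<in>\<Theta>. \<bar>bump (snd p) \<theta>\<bar> \<le> C * (norm (c \<theta> - c (fst p)))\<^sup>2)" if "p \<in> S \<times> S" for p
      using that by (intro *) auto
  qed (meson mult_right_mono order_trans zero_le_power2)
  then show ?thesis by auto
qed

text \<open>
  The node \<open>a\<close> is the one nearest to \<open>\<theta>\<close>: all other factors of \<open>vanishing \<theta>\<close> are then bounded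
  below by the squares of half the distances between nodes.
\<close>

lemma vanishing_lower_bound:
  "\<exists>\<kappa>>0. \<forall>\<theta>. \<exists>a\<in>S. \<kappa> * sq_dist \<theta> a \<le> vanishing \<theta>"
proof -
  define k where "k a = (\<Prod>b\<in>S - {a}. (norm (c a - c b) / 2)\<^sup>2)" for a
  have kpos: "0 < k a" if "a \<in> S" for a
    unfolding k_def using c_inj that by (intro prod_pos) (auto simp: inj_on_def)
  define \<kappa> where "\<kappa> = Min (k ` S)"
  have "\<kappa> > 0" unfolding \<kappa>_def using finite_nodes nodes_nonempty kpos by auto
  moreover have "\<exists>a\<in>S. \<kappa> * sq_dist \<theta> a \<le> vanishing \<theta>" for \<theta>
  proof -
    obtain a where a: "a \<in> S" "\<And>b. b \<in> S \<Longrightarrow> norm (c \<theta> - c a) \<le> norm (c \<theta> - c b)"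
      using finite_nodes nodes_nonempty
        ex_is_arg_min_if_finite[of S "\<lambda>a. norm (c \<theta> - c a)"]
      by (auto simp: is_arg_min_linorder)
    have "k a \<le> (\<Prod>b\<in>S - {a}. sq_dist \<theta> b)"
      unfolding k_def
    proof (intro prod_mono conjI)
      fix b assume b: "b \<in> S - {a}"
      have "norm (c a - c b) \<le> norm (c \<theta> - c b) + norm (c \<theta> - c a)"
        using norm_triangle_ineq4[of "c \<theta> - c b" "c \<theta> - c a"] by simp
      then have "norm (c a - c b) / 2 \<le> norm (c \<theta> - c b)" using a(2)[of b] b by auto
      then show "(norm (c a - c b) / 2)\<^sup>2 \<le> sq_dist \<theta> b" by (intro power_mono) auto
    qed auto
    moreover have "\<kappa> \<le> k a" unfolding \<kappa>_def using finite_nodes a by auto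
    moreover have "vanishing \<theta> = sq_dist \<theta> a * (\<Prod>b\<in>S - {a}. sq_dist \<theta> b)"
      unfolding vanishing_def using finite_nodes a by (intro prod.remove) auto
    ultimately have "\<kappa> * sq_dist \<theta> a \<le> vanishing \<theta>"
      by (simp add: mult.commute[of \<kappa>] mult_left_mono)
    with a show ?thesis by auto
  qed
  ultimately show ?thesis by auto
qed

text \<open>
  The functions whose integrals make up the integral of an interpolant, together with the weight function
  of the remainder.
\<close>

definition node_functions :: "('a \<Rightarrow> real) set" where
  "node_functions = insert vanishing ((\<lambda>a. bump a) ` S \<union>
     (\<lambda>(a, e) \<theta>. bump a \<theta> * ((c \<theta> - c a) \<bullet> e)) ` (S \<times> Basis))"

lemma finite_node_functions: "finite node_functions"
  unfolding node_functions_def using finite_nodes by auto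

lemma node_functions_poly: "node_functions \<subseteq> polynomials"
  unfolding node_functions_def
  by (auto simp: inner_diff_left intro!: vanishing_poly bump_poly polynomials.mult polynomials_diff
      polynomials.coord polynomials.const)

text \<open>
  At the node of the preceding lemma each term of the remainder is a multiple of the squared distance
  to that node: the own bump reproduces the affine part, the other bumps are of second order.
\<close>

lemma hermite_remainder:
  "\<exists>C\<ge>0. \<forall>U u v. jet_bounded U u \<longrightarrow>
     (\<forall>a\<in>S. norm (v a) \<le> U \<and>
        (\<forall>\<theta>\<in>\<Theta>. \<bar>u \<theta> - u a - v a \<bullet> (c \<theta> - c a)\<bar> \<le> U * sq_dist \<theta> a)) \<longrightarrow>
     (\<forall>\<theta>\<in>\<Theta>. \<bar>u \<theta> - (\<Sum>a\<in>S. bump a \<theta> * (u a + v a \<bullet> (c \<theta> - c a)))\<bar> \<le> C * U * vanishing \<theta>)"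
proof -
  obtain C1 where C1: "C1 \<ge> 0"
    "\<And>a \<theta>. a \<in> S \<Longrightarrow> \<theta> \<in> \<Theta> \<Longrightarrow> \<bar>1 - bump a \<theta>\<bar> \<le> C1 * sq_dist \<theta> a"
    using bump_near_own_node by auto
  obtain C2 where C2: "C2 \<ge> 0" "\<And>a b \<theta>. a \<in> S \<Longrightarrow> b \<in> S \<Longrightarrow> a \<noteq> b \<Longrightarrow> \<theta> \<in> \<Theta> \<Longrightarrow>
      \<bar>bump b \<theta>\<bar> \<le> C2 * sq_dist \<theta> a"
    using bump_near_other_node by auto
  obtain \<kappa> where \<kappa>: "\<kappa> > 0" "\<And>\<theta>. \<exists>a\<in>S. \<kappa> * sq_dist \<theta> a \<le> vanishing \<theta>"
    using vanishing_lower_bound by auto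
  define C where "C = (1 + (C1 + C2 * card S) * (1 + D)) / \<kappa>"
  have C0: "C \<ge> 0" unfolding C_def using C1 C2 D_nonneg \<kappa> by auto
  have "\<bar>u \<theta> - (\<Sum>a\<in>S. bump a \<theta> * (u a + v a \<bullet> (c \<theta> - c a)))\<bar> \<le> C * U * vanishing \<theta>"
    if u: "jet_bounded U u" and \<theta>: "\<theta> \<in> \<Theta>" and v: "\<And>a. a \<in> S \<Longrightarrow> norm (v a) \<le> U"
      and rem: "\<And>a. a \<in> S \<Longrightarrow> \<bar>u \<theta> - u a - v a \<bullet> (c \<theta> - c a)\<bar> \<le> U * sq_dist \<theta> a"
    for U u v \<theta>
  proof -
    have U: "0 \<le> U" using u by (rule jet_bounded_nonneg)
    obtain a where a: "a \<in> S" "\<kappa> * sq_dist \<theta> a \<le> vanishing \<theta>" using \<kappa> by blast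
    define \<delta> where "\<delta> = sq_dist \<theta> a"
    have \<delta>: "0 \<le> \<delta>" "\<delta> \<le> vanishing \<theta> / \<kappa>"
      using a(2) \<kappa>(1) by (auto simp: \<delta>_def field_simps)
    define l where "l b = u b + v b \<bullet> (c \<theta> - c b)" for b
    have l: "\<bar>l b\<bar> \<le> U * (1 + D)" if "b \<in> S" for b
    proof -
      have "\<bar>v b \<bullet> (c \<theta> - c b)\<bar> \<le> norm (v b) * norm (c \<theta> - c b)" by (rule Cauchy_Schwarz_ineq2)
      also have "\<dots> \<le> U * D" using v[OF that] diam[OF \<theta> that] U by (intro mult_mono) auto
      finally show ?thesis
        using jet_boundedD(2)[OF u, of b] nodes_sub that unfolding l_def
        by (auto simp: algebra_simps)
    qed
    have "u \<theta> - (\<Sum>b\<in>S. bump b \<theta> * l b)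
        = (u \<theta> - l a) + (1 - bump a \<theta>) * l a - (\<Sum>b\<in>S - {a}. bump b \<theta> * l b)"
      using sum.remove[OF finite_nodes a(1), of "\<lambda>b. bump b \<theta> * l b"] by (simp add: algebra_simps)
    also have "\<bar>\<dots>\<bar> \<le> \<bar>u \<theta> - l a\<bar> + \<bar>1 - bump a \<theta>\<bar> * \<bar>l a\<bar> + (\<Sum>b\<in>S - {a}. \<bar>bump b \<theta>\<bar> * \<bar>l b\<bar>)"
      using sum_abs[of "\<lambda>b. bump b \<theta> * l b" "S - {a}"] unfolding abs_mult[symmetric]
      by linarith
    also have "\<dots> \<le> U * \<delta> + (C1 * \<delta>) * (U * (1 + D)) + (\<Sum>b\<in>S. (C2 * \<delta>) * (U * (1 + D)))"
    proof (intro add_mono)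
      show "\<bar>u \<theta> - l a\<bar> \<le> U * \<delta>" using rem[OF a(1)] by (simp add: l_def \<delta>_def algebra_simps)
      show "\<bar>1 - bump a \<theta>\<bar> * \<bar>l a\<bar> \<le> (C1 * \<delta>) * (U * (1 + D))"
        using C1(2)[OF a(1) \<theta>] l[OF a(1)] \<delta> C1(1) by (intro mult_mono) (auto simp: \<delta>_def)
      have "(\<Sum>b\<in>S - {a}. \<bar>bump b \<theta>\<bar> * \<bar>l b\<bar>) \<le> (\<Sum>b\<in>S - {a}. (C2 * \<delta>) * (U * (1 + D)))"
        using C2(2)[OF a(1) _ _ \<theta>] l \<delta> C2(1) by (intro sum_mono mult_mono) (auto simp: \<delta>_def)
      also have "\<dots> \<le> (\<Sum>b\<in>S. (C2 * \<delta>) * (U * (1 + D)))"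
        using C2(1) \<delta> U D_nonneg finite_nodes by (intro sum_mono2) auto
      finally show "(\<Sum>b\<in>S - {a}. \<bar>bump b \<theta>\<bar> * \<bar>l b\<bar>) \<le> (\<Sum>b\<in>S. (C2 * \<delta>) * (U * (1 + D)))" .
    qed
    also have "\<dots> = (1 + (C1 + C2 * card S) * (1 + D)) * U * \<delta>"
      by (simp add: algebra_simps)
    also have "\<dots> \<le> (1 + (C1 + C2 * card S) * (1 + D)) * U * (vanishing \<theta> / \<kappa>)"
      using \<delta> C1 C2 D_nonneg U by (intro mult_left_mono) auto
    also have "\<dots> = C * U * vanishing \<theta>" by (simp add: C_def)
    finally show ?thesis by (simp add: l_def)
  qed
  with C0 show ?thesis by (intro exI[of _ C]) blast
qed

lemma integrable_jet_bounded:
  assumes "jet_bounded U u" "prob_space g" "sets g = sets borel" "AE \<theta> in g. \<theta> \<in> \<Theta>"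
  shows "integrable g u"
proof -
  interpret prob_space g by fact
  have "u \<in> borel_measurable g"
    using jet_boundedD(1)[OF assms(1)] measurable_cong_sets[OF assms(3) refl] by blast
  moreover have "AE \<theta> in g. norm (u \<theta>) \<le> U"
    using assms(4) jet_boundedD(2)[OF assms(1)] by (auto elim!: eventually_mono)
  ultimately show ?thesis by (rule integrable_const_bound[rotated])
qed

definition discrepancy :: "'a measure \<Rightarrow> 'a measure \<Rightarrow> real" where
  "discrepancy g h = (\<Sum>Q\<in>node_functions. \<bar>(\<integral>\<theta>. Q \<theta> \<partial>g) - (\<integral>\<theta>. Q \<theta> \<partial>h)\<bar>)"

lemma discrepancy_nonneg: "0 \<le> discrepancy g h"
  unfolding discrepancy_def by (intro sum_nonneg) auto

text \<open>
  The interpolant is a combination of node functions with coefficients bounded by \<open>U\<close>. The error of the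
  interpolation vanishes \<open>h\<close>-almost everywhere, and its \<open>g\<close>-integral is at most a multiple of that of
  \<open>vanishing\<close> in absolute value; \<open>vanishing\<close> is itself a node function with \<open>h\<close>-integral zero.
\<close>

theorem jet_bounded_integral_diff:
  "\<exists>C\<ge>0. \<forall>U u g h. jet_bounded U u \<longrightarrow>
     prob_space g \<longrightarrow> sets g = sets borel \<longrightarrow> (AE \<theta> in g. \<theta> \<in> \<Theta>) \<longrightarrow>
     prob_space h \<longrightarrow> sets h = sets borel \<longrightarrow> (AE \<theta> in h. \<theta> \<in> S) \<longrightarrow>
     \<bar>(\<integral>\<theta>. u \<theta> \<partial>g) - (\<integral>\<theta>. u \<theta> \<partial>h)\<bar> \<le> C * U * discrepancy g h"
proof -
  obtain C where C: "C \<ge> 0" "\<And>U u v \<theta>. jet_bounded U u \<Longrightarrow> 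
     (\<forall>a\<in>S. norm (v a) \<le> U \<and>
        (\<forall>\<theta>\<in>\<Theta>. \<bar>u \<theta> - u a - v a \<bullet> (c \<theta> - c a)\<bar> \<le> U * sq_dist \<theta> a)) \<Longrightarrow> \<theta> \<in> \<Theta> \<Longrightarrow>
      \<bar>u \<theta> - (\<Sum>a\<in>S. bump a \<theta> * (u a + v a \<bullet> (c \<theta> - c a)))\<bar> \<le> C * U * vanishing \<theta>"
    using hermite_remainder by blast
  define C' where "C' = card S * (1 + card (Basis :: 'b set)) + C"
  have "\<bar>(\<integral>\<theta>. u \<theta> \<partial>g) - (\<integral>\<theta>. u \<theta> \<partial>h)\<bar> \<le> C' * U * discrepancy g h"
    if u: "jet_bounded U u" and g: "prob_space g" "sets g = sets borel" "AE \<theta> in g. \<theta> \<in> \<Theta>"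
      and h: "prob_space h" "sets h = sets borel" and hS: "AE \<theta> in h. \<theta> \<in> S" for U u g h
  proof -
    have U: "0 \<le> U" using u by (rule jet_bounded_nonneg)
    have hT: "AE \<theta> in h. \<theta> \<in> \<Theta>" using hS nodes_sub by (auto elim!: eventually_mono)
    have ints: "integrable g Q" "integrable h Q" if "Q \<in> polynomials" for Q
      using polynomials_jet_bounded[OF that] integrable_jet_bounded g h hT by blast+
    have intu: "integrable g u" "integrable h u" using integrable_jet_bounded[OF u] g h hT by blast+
    have "\<forall>a. \<exists>v. a \<in> S \<longrightarrow> norm v \<le> U \<and>
        (\<forall>\<theta>\<in>\<Theta>. \<bar>u \<theta> - u a - v \<bullet> (c \<theta> - c a)\<bar> \<le> U * sq_dist \<theta> a)"
      using u unfolding jet_bounded_def by blast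
    then obtain v where v: "\<And>a. a \<in> S \<Longrightarrow> norm (v a) \<le> U \<and>
        (\<forall>\<theta>\<in>\<Theta>. \<bar>u \<theta> - u a - v a \<bullet> (c \<theta> - c a)\<bar> \<le> U * sq_dist \<theta> a)"
      by metis
    define L where "L Q = (\<integral>\<theta>. Q \<theta> \<partial>g) - (\<integral>\<theta>. Q \<theta> \<partial>h)" for Q :: "'a \<Rightarrow> real"
    have disc: "\<bar>L Q\<bar> \<le> discrepancy g h" if "Q \<in> node_functions" for Q
      unfolding discrepancy_def L_def using finite_node_functions that
      by (intro member_le_sum[of _ _ "\<lambda>Q. \<bar>(\<integral>\<theta>. Q \<theta> \<partial>g) - (\<integral>\<theta>. Q \<theta> \<partial>h)\<bar>"]) auto
    define be where "be a e \<theta> = bump a \<theta> * ((c \<theta> - c a) \<bullet> e)" for a e \<theta>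
    have be_poly: "be a e \<in> polynomials" if "e \<in> Basis" for a e
      unfolding be_def[abs_def] using that
      by (auto simp: inner_diff_left intro!: bump_poly polynomials.mult polynomials_diff
          polynomials.coord polynomials.const)
    have be_node: "be a e \<in> node_functions" if "a \<in> S" "e \<in> Basis" for a e
      using that unfolding node_functions_def be_def[abs_def] by (auto intro!: rev_image_eqI[of "(a, e)"])
    define I where "I \<theta> = (\<Sum>a\<in>S. u a * bump a \<theta> + (\<Sum>e\<in>Basis. (v a \<bullet> e) * be a e \<theta>))" for \<theta>
    have I: "I \<theta> = (\<Sum>a\<in>S. bump a \<theta> * (u a + v a \<bullet> (c \<theta> - c a)))" for \<theta>
      unfolding I_def
    proof (intro sum.cong refl)
      fix a
      show "u a * bump a \<theta> + (\<Sum>e\<in>Basis. (v a \<bullet> e) * be a e \<theta>)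
          = bump a \<theta> * (u a + v a \<bullet> (c \<theta> - c a))"
        by (subst (2) euclidean_inner) (simp add: be_def algebra_simps sum_distrib_left)
    qed
    have I_poly: "I \<in> polynomials"
      unfolding I_def[abs_def] using finite_nodes
      by (intro polynomials_sum polynomials.add polynomials.mult polynomials.const bump_poly be_poly)
         auto
    have rem: "\<bar>u \<theta> - I \<theta>\<bar> \<le> C * U * vanishing \<theta>" if "\<theta> \<in> \<Theta>" for \<theta>
      unfolding I using v that by (intro C(2)[OF u]) auto
    have "\<bar>\<integral>\<theta>. u \<theta> - I \<theta> \<partial>g\<bar> \<le> (\<integral>\<theta>. \<bar>u \<theta> - I \<theta>\<bar> \<partial>g)" by (rule integral_abs_bound)
    also have "\<dots> \<le> (\<integral>\<theta>. C * U * vanishing \<theta> \<partial>g)"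
      using g(3) rem intu ints[OF I_poly] ints[OF vanishing_poly]
      by (intro integral_mono_AE) (auto elim!: eventually_mono)
    also have "\<dots> = C * U * L vanishing"
    proof -
      have "(\<integral>\<theta>. vanishing \<theta> \<partial>h) = (\<integral>\<theta>. 0 \<partial>h)"
        using hS vanishing_node ints(2)[OF vanishing_poly]
        by (intro integral_cong_AE) (auto elim!: eventually_mono)
      then show ?thesis by (simp add: L_def)
    qed
    also have "\<dots> \<le> C * U * discrepancy g h"
      using disc[of vanishing] C(1) U by (intro mult_left_mono) (auto simp: node_functions_def)
    finally have 1: "\<bar>\<integral>\<theta>. u \<theta> - I \<theta> \<partial>g\<bar> \<le> C * U * discrepancy g h" .
    have 2: "(\<integral>\<theta>. u \<theta> - I \<theta> \<partial>h) = 0"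
    proof -
      have "AE \<theta> in h. u \<theta> - I \<theta> = 0"
        using hS
      proof eventually_elim
        case (elim \<theta>)
        then show ?case using rem[of \<theta>] vanishing_node[OF elim] nodes_sub by auto
      qed
      then show ?thesis by (rule integral_eq_zero_AE)
    qed
    have LI: "L I = (\<Sum>a\<in>S. u a * L (bump a) + (\<Sum>e\<in>Basis. (v a \<bullet> e) * L (be a e)))"
      unfolding L_def I_def
      using ints[OF bump_poly] ints[OF be_poly]
      by (simp add: sum.distrib sum_subtractf right_diff_distrib)
    have "\<bar>L I\<bar> \<le> (\<Sum>a\<in>S. U * discrepancy g h + (\<Sum>e\<in>(Basis::'b set). U * discrepancy g h))"
      unfolding LI
    proof (rule order_trans[OF sum_abs], rule sum_mono)
      fix a assume a: "a \<in> S"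
      have ua: "\<bar>u a\<bar> \<le> U" using jet_boundedD(2)[OF u] nodes_sub a by auto
      have "\<bar>u a * L (bump a)\<bar> \<le> U * discrepancy g h"
        unfolding abs_mult using ua disc[of "bump a"] U a
        by (intro mult_mono) (auto simp: node_functions_def)
      moreover have "\<bar>\<Sum>e\<in>Basis. (v a \<bullet> e) * L (be a e)\<bar> \<le> (\<Sum>e\<in>(Basis::'b set). U * discrepancy g h)"
      proof (rule order_trans[OF sum_abs], rule sum_mono)
        fix e :: 'b assume e: "e \<in> Basis"
        have "\<bar>v a \<bullet> e\<bar> \<le> U" using Basis_le_norm[OF e, of "v a"] v[OF a] by auto
        then show "\<bar>v a \<bullet> e * L (be a e)\<bar> \<le> U * discrepancy g h"
          unfolding abs_mult using disc[OF be_node[OF a e]] U by (intro mult_mono) auto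
      qed
      ultimately show "\<bar>u a * L (bump a) + (\<Sum>e\<in>Basis. v a \<bullet> e * L (be a e))\<bar>
          \<le> U * discrepancy g h + (\<Sum>e\<in>(Basis::'b set). U * discrepancy g h)" by linarith
    qed
    also have "\<dots> = card S * (1 + card (Basis :: 'b set)) * U * discrepancy g h"
      by (simp add: algebra_simps)
    finally have 3: "\<bar>L I\<bar> \<le> card S * (1 + card (Basis :: 'b set)) * U * discrepancy g h" .
    have "(\<integral>\<theta>. u \<theta> \<partial>g) - (\<integral>\<theta>. u \<theta> \<partial>h) = (\<integral>\<theta>. u \<theta> - I \<theta> \<partial>g) - (\<integral>\<theta>. u \<theta> - I \<theta> \<partial>h) + L I"
      using intu ints[OF I_poly] by (simp add: L_def)
    then show ?thesis using 1 2 3 unfolding C'_def distrib_right by linarith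
  qed
  moreover have "C' \<ge> 0" unfolding C'_def using C by auto
  ultimately show ?thesis by blast
qed

end

section \<open>Wasserstein distance to a finitely discrete measure\<close>

lemma nn_integral_finite_support:
  assumes S: "finite S" "AE x in h. x \<in> S" and meas: "f \<in> borel_measurable h"
    and sets: "\<And>a. a \<in> S \<Longrightarrow> {a} \<in> sets h"
  shows "(\<integral>\<^sup>+x. f x \<partial>h) = (\<Sum>a\<in>S. f a * emeasure h {a})"
proof -
  have "(\<integral>\<^sup>+x. f x \<partial>h) = (\<integral>\<^sup>+x. (\<Sum>a\<in>S. f a * indicator {a} x) \<partial>h)"
    using S(2)
  proof (intro nn_integral_cong_AE, eventually_elim)
    case (elim x)
    have "(\<Sum>a\<in>S. f a * indicator {a} x) = (\<Sum>a\<in>S. if a = x then f a else 0)"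
      by (intro sum.cong) (auto simp: indicator_def)
    then show ?case using S(1) elim by simp
  qed
  also have "\<dots> = (\<Sum>a\<in>S. f a * emeasure h {a})"
    using sets by (subst nn_integral_sum) (auto simp: nn_integral_cmult_indicator)
  finally show ?thesis .
qed

lemma prob_space_integral_square_le:
  fixes f :: "'a \<Rightarrow> real"
  assumes "prob_space g" "integrable g f" "integrable g (\<lambda>x. (f x)\<^sup>2)"
  shows "(\<integral>x. f x \<partial>g)\<^sup>2 \<le> (\<integral>x. (f x)\<^sup>2 \<partial>g)"
  using prob_space.variance_eq[OF assms] prob_space.variance_positive[OF assms(1), of f] by simp

text \<open>
  A fraction \<open>lam\<close> of the mass moves from \<open>\<theta>\<close> to its node \<open>T \<theta>\<close>, and the rest is spread so that
  the second marginal comes out as \<open>h\<close>. Since the rest need not be sampled conditionally on any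
  event, the coupling has an explicit density with respect to the product measure.
\<close>

lemma wasserstein1_le_of_assignment:
  fixes g h :: "'a::euclidean_space measure" and T :: "'a \<Rightarrow> 'a"
  assumes g: "prob_space g" "sets g = sets borel" and h: "prob_space h" "sets h = sets borel"
    and S: "finite S" "AE x in h. x \<in> S" "\<And>a. a \<in> S \<Longrightarrow> 0 < measure h {a}"
    and T: "T \<in> borel_measurable borel" "\<And>x. T x \<in> S"
    and R: "0 \<le> R" "AE x in g. \<forall>a\<in>S. norm (x - a) \<le> R"
    and lam: "0 \<le> lam" "lam \<le> 1"
      "\<And>a. a \<in> S \<Longrightarrow> lam * measure g {x. T x = a} \<le> measure h {a}"
    and int: "integrable g (\<lambda>x. norm (x - T x))"
  shows "wasserstein1 g h \<le> ennreal ((1 - lam) * R + (\<integral>x. norm (x - T x) \<partial>g))"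
proof -
  interpret g: prob_space g by fact
  interpret h: prob_space h by fact
  interpret gh: pair_prob_space g h ..
  note [measurable_cong] = g(2) h(2)
  note [measurable] = T(1)
  have space: "space g = UNIV" "space h = UNIV"
    using sets_eq_imp_space_eq[OF g(2)] sets_eq_imp_space_eq[OF h(2)] by auto
  define w where "w a = measure h {a}" for a
  define v where "v a = measure g {x. T x = a}" for a
  have wpos: "0 < w a" if "a \<in> S" for a using S(3)[OF that] by (simp add: w_def)
  have w_em: "emeasure h {a} = ennreal (w a)" for a by (simp add: w_def h.emeasure_eq_measure)
  have T_sets[measurable]: "{x. T x = a} \<in> sets borel" for a by measurable
  \<comment> \<open>Where \<open>w\<close> vanishes, division by zero makes \<open>k\<close> equal to 1; this concerns an \<open>h\<close>-null set.\<close>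
  define k where "k x y = 1 + (\<Sum>b\<in>S. (lam * (indicator {x. T x = b} x - v b) / w b) * indicator {b} y)"
    for x y
  have k_meas[measurable]: "(\<lambda>z. k (fst z) (snd z)) \<in> borel_measurable (g \<Otimes>\<^sub>M h)"
    unfolding k_def by measurable
  have k_meas1[measurable]: "(\<lambda>x. k x y) \<in> borel_measurable g" for y
    unfolding k_def by measurable
  have k_meas2[measurable]: "(\<lambda>y. k x y) \<in> borel_measurable h" for x
    unfolding k_def by measurable
  have k_eq: "k x a = 1 + lam * (indicator {x. T x = a} x - v a) / w a" if "a \<in> S" for x a
  proof -
    have "(\<Sum>b\<in>S. (lam * (indicator {x. T x = b} x - v b) / w b) * indicator {b} a)
        = (\<Sum>b\<in>S. if b = a then lam * (indicator {x. T x = b} x - v b) / w b else 0)"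
      by (intro sum.cong) auto
    then show ?thesis using that S(1) by (simp add: k_def)
  qed
  have wk: "w a * k x a = w a - lam * v a + lam * indicator {x. T x = a} x" if "a \<in> S" for x a
    using wpos[OF that] by (simp add: k_eq[OF that] field_simps)
  have slack: "0 \<le> w a - lam * v a" if "a \<in> S" for a
    using lam(3)[OF that] by (simp add: w_def v_def)
  have k_nonneg: "0 \<le> k x a" if "a \<in> S" for x a
  proof -
    have "0 \<le> w a * k x a" unfolding wk[OF that] using slack[OF that] lam(1) by simp
    with wpos[OF that] show ?thesis by (simp add: zero_le_mult_iff)
  qed
  have sum_w: "(\<Sum>a\<in>S. w a) = 1"
  proof -
    have "1 = (\<integral>\<^sup>+x. 1 \<partial>h)" using h.emeasure_space_1 by simp
    also have "\<dots> = (\<Sum>a\<in>S. ennreal (w a))"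
      by (subst nn_integral_finite_support[OF S(1,2)]) (auto simp: w_em h(2))
    also have "\<dots> = ennreal (\<Sum>a\<in>S. w a)" using wpos by (simp add: less_imp_le)
    finally have "ennreal (\<Sum>a\<in>S. w a) = 1" by simp
    then show ?thesis by simp
  qed
  have sum_ind: "(\<Sum>a\<in>S. indicator {x. T x = a} x) = (1::real)" for x
  proof -
    have "(\<Sum>a\<in>S. indicator {x. T x = a} x) = (\<Sum>a\<in>S. if T x = a then 1 else (0::real))"
      by (intro sum.cong) (auto simp: indicator_def)
    then show ?thesis using S(1) T(2) by simp
  qed
  have int_ind: "integrable g (indicator {x. T x = a} :: _ \<Rightarrow> real)" for a
    by (simp add: integrable_indicator_iff space g.emeasure_eq_measure)
  have v_int: "v a = (\<integral>x. indicator {x. T x = a} x \<partial>g)" for a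
    by (simp add: v_def space)
  have sum_v: "(\<Sum>a\<in>S. v a) = 1"
  proof -
    have "(\<Sum>a\<in>S. v a) = (\<integral>x. (\<Sum>a\<in>S. indicator {x. T x = a} x) \<partial>g)"
      unfolding v_int using int_ind by (subst Bochner_Integration.integral_sum) auto
    then show ?thesis unfolding sum_ind by (simp add: g.prob_space)
  qed
  define \<pi> where "\<pi> = density (g \<Otimes>\<^sub>M h) (\<lambda>z. ennreal (k (fst z) (snd z)))"
  have sets_\<pi>: "sets \<pi> = sets (borel \<Otimes>\<^sub>M borel)"
    unfolding \<pi>_def by (simp add: sets_pair_measure_cong[OF g(2) h(2)])
  have nn_\<pi>: "(\<integral>\<^sup>+z. f z \<partial>\<pi>) = (\<integral>\<^sup>+x. (\<Sum>a\<in>S. ennreal (w a * k x a) * f (x, a)) \<partial>g)"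
    if [measurable]: "f \<in> borel_measurable (borel \<Otimes>\<^sub>M borel)" for f :: "'a \<times> 'a \<Rightarrow> ennreal"
  proof -
    have [measurable]: "f \<in> borel_measurable (g \<Otimes>\<^sub>M h)" by measurable
    have "(\<integral>\<^sup>+z. f z \<partial>\<pi>) = (\<integral>\<^sup>+z. ennreal (k (fst z) (snd z)) * f z \<partial>(g \<Otimes>\<^sub>M h))"
      unfolding \<pi>_def by (subst nn_integral_density) auto
    also have "\<dots> = (\<integral>\<^sup>+x. (\<integral>\<^sup>+y. ennreal (k x y) * f (x, y) \<partial>h) \<partial>g)"
      by (subst h.nn_integral_fst[symmetric]) auto
    also have "\<dots> = (\<integral>\<^sup>+x. (\<Sum>a\<in>S. ennreal (w a * k x a) * f (x, a)) \<partial>g)"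
    proof (intro nn_integral_cong)
      fix x
      have "(\<integral>\<^sup>+y. ennreal (k x y) * f (x, y) \<partial>h) = (\<Sum>a\<in>S. ennreal (k x a) * f (x, a) * ennreal (w a))"
        by (subst nn_integral_finite_support[OF S(1,2)]) (auto simp: w_em h(2))
      also have "\<dots> = (\<Sum>a\<in>S. ennreal (w a * k x a) * f (x, a))"
        using wpos k_nonneg by (intro sum.cong) (auto simp: ennreal_mult less_imp_le mult_ac)
      finally show "(\<integral>\<^sup>+y. ennreal (k x y) * f (x, y) \<partial>h) = \<dots>" .
    qed
    finally show ?thesis .
  qed
  have marg1: "distr \<pi> borel fst = g"
  proof (rule measure_eqI)
    show "sets (distr \<pi> borel fst) = sets g" by (simp add: g(2))
    fix A assume "A \<in> sets (distr \<pi> borel fst)"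
    then have A[measurable]: "A \<in> sets borel" by simp
    have fst_m: "fst \<in> measurable \<pi> borel" using measurable_cong_sets[OF sets_\<pi> refl] by auto
    have "emeasure (distr \<pi> borel fst) A = (\<integral>\<^sup>+z. indicator A (fst z) \<partial>\<pi>)"
      using fst_m A by (subst nn_integral_indicator[symmetric], simp)
        (subst nn_integral_distr, auto)
    also have "\<dots> = (\<integral>\<^sup>+x. (\<Sum>a\<in>S. ennreal (w a * k x a)) * indicator A x \<partial>g)"
      by (subst nn_\<pi>) (auto simp: sum_distrib_right)
    also have "\<dots> = (\<integral>\<^sup>+x. indicator A x \<partial>g)"
    proof (intro nn_integral_cong)
      fix x
      have "(\<Sum>a\<in>S. ennreal (w a * k x a)) = ennreal (\<Sum>a\<in>S. w a * k x a)"
        using wpos k_nonneg by (intro sum_ennreal) (auto simp: less_imp_le)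
      also have "(\<Sum>a\<in>S. w a * k x a) = (\<Sum>a\<in>S. w a - lam * v a + lam * indicator {x. T x = a} x)"
        by (intro sum.cong wk) auto
      also have "\<dots> = 1"
        by (simp add: sum.distrib sum_subtractf sum_w sum_v sum_ind flip: sum_distrib_left)
      finally show "(\<Sum>a\<in>S. ennreal (w a * k x a)) * indicator A x = indicator A x" by simp
    qed
    also have "\<dots> = emeasure g A" using A by (simp add: g(2))
    finally show "emeasure (distr \<pi> borel fst) A = emeasure g A" .
  qed
  have marg2: "distr \<pi> borel snd = h"
  proof (rule measure_eqI)
    show "sets (distr \<pi> borel snd) = sets h" by (simp add: h(2))
    fix A assume "A \<in> sets (distr \<pi> borel snd)"
    then have A[measurable]: "A \<in> sets borel" by simp
    have snd_m: "snd \<in> measurable \<pi> borel" using measurable_cong_sets[OF sets_\<pi> refl] by auto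
    have "emeasure (distr \<pi> borel snd) A = (\<integral>\<^sup>+z. indicator A (snd z) \<partial>\<pi>)"
      using snd_m A by (subst nn_integral_indicator[symmetric], simp)
        (subst nn_integral_distr, auto)
    also have "\<dots> = (\<integral>\<^sup>+x. (\<Sum>a\<in>S. ennreal (w a * k x a) * indicator A a) \<partial>g)"
      by (subst nn_\<pi>) auto
    also have "\<dots> = (\<Sum>a\<in>S. (\<integral>\<^sup>+x. ennreal (w a * k x a) \<partial>g) * indicator A a)"
      by (subst nn_integral_sum) (auto simp: nn_integral_multc)
    also have "\<dots> = (\<Sum>a\<in>S. indicator A a * emeasure h {a})"
    proof (intro sum.cong refl)
      fix a assume a: "a \<in> S"
      have "(\<integral>\<^sup>+x. ennreal (w a * k x a) \<partial>g) = ennreal (\<integral>x. w a * k x a \<partial>g)"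
        using slack[OF a] lam(1) int_ind
        by (intro nn_integral_eq_integral) (auto simp: wk[OF a])
      also have "(\<integral>x. w a * k x a \<partial>g) = w a"
        using int_ind g.prob_space by (simp add: wk[OF a] v_def space)
      finally show "(\<integral>\<^sup>+x. ennreal (w a * k x a) \<partial>g) * indicator A a = indicator A a * emeasure h {a}"
        by (simp add: w_em mult.commute)
    qed
    also have "\<dots> = (\<integral>\<^sup>+x. indicator A x \<partial>h)"
      by (subst nn_integral_finite_support[OF S(1,2)]) (auto simp: h(2))
    also have "\<dots> = emeasure h A" using A by (simp add: h(2))
    finally show "emeasure (distr \<pi> borel snd) A = emeasure h A" .
  qed
  have "(\<integral>\<^sup>+z. ennreal (norm (fst z - snd z)) \<partial>\<pi>)
      = (\<integral>\<^sup>+x. ennreal (\<Sum>a\<in>S. w a * k x a * norm (x - a)) \<partial>g)"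
  proof (subst nn_\<pi>)
    show "(\<lambda>z. ennreal (norm (fst z - snd z :: 'a))) \<in> borel_measurable (borel \<Otimes>\<^sub>M borel)" by measurable
    show "(\<integral>\<^sup>+x. (\<Sum>a\<in>S. ennreal (w a * k x a) * ennreal (norm (fst (x, a) - snd (x, a)))) \<partial>g)
      = (\<integral>\<^sup>+x. ennreal (\<Sum>a\<in>S. w a * k x a * norm (x - a)) \<partial>g)"
      using wpos k_nonneg
      by (intro nn_integral_cong)
         (subst sum_ennreal[symmetric], auto intro!: sum.cong simp: less_imp_le ennreal_mult)
  qed
  also have "\<dots> \<le> (\<integral>\<^sup>+x. ennreal ((1 - lam) * R + norm (x - T x)) \<partial>g)"
    using R(2)
  proof (intro nn_integral_mono_AE, eventually_elim)
    case (elim x)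
    have "(\<Sum>a\<in>S. w a * k x a * norm (x - a))
        = (\<Sum>a\<in>S. (w a - lam * v a) * norm (x - a)) + lam * (\<Sum>a\<in>S. indicator {x. T x = a} x * norm (x - a))"
      by (simp add: wk distrib_right sum.distrib sum_distrib_left mult.assoc)
    also have "(\<Sum>a\<in>S. indicator {x. T x = a} x * norm (x - a)) = norm (x - T x)"
    proof -
      have "(\<Sum>a\<in>S. indicator {x. T x = a} x * norm (x - a)) = (\<Sum>a\<in>S. if T x = a then norm (x - a) else 0)"
        by (intro sum.cong) (auto simp: indicator_def)
      then show ?thesis using S(1) T(2) by simp
    qed
    also have "(\<Sum>a\<in>S. (w a - lam * v a) * norm (x - a)) \<le> (\<Sum>a\<in>S. (w a - lam * v a) * R)"
      using slack elim by (intro sum_mono mult_left_mono) auto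
    also have "(\<Sum>a\<in>S. (w a - lam * v a) * R) = (1 - lam) * R"
      by (simp add: sum_subtractf sum_w sum_v flip: sum_distrib_left sum_distrib_right)
    also have "lam * norm (x - T x) \<le> 1 * norm (x - T x)" using lam by (intro mult_right_mono) auto
    finally show ?case by (simp add: ennreal_leI)
  qed
  also have "\<dots> = ennreal (\<integral>x. (1 - lam) * R + norm (x - T x) \<partial>g)"
    using int lam R(1) by (intro nn_integral_eq_integral) auto
  also have "(\<integral>x. (1 - lam) * R + norm (x - T x) \<partial>g) = (1 - lam) * R + (\<integral>x. norm (x - T x) \<partial>g)"
    using int by (simp add: g.prob_space)
  finally have "(\<integral>\<^sup>+z. ennreal (norm (fst z - snd z)) \<partial>\<pi>) \<le> ennreal ((1 - lam) * R + (\<integral>x. norm (x - T x) \<partial>g))" .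
  moreover have "\<pi> \<in> couplings g h"
    unfolding couplings_def using sets_\<pi> marg1 marg2 by auto
  ultimately show ?thesis unfolding wasserstein1_def by (meson INF_lower order_trans)
qed

locale embedded_nodes = interpolation_nodes c \<Theta> S D
  for c :: "'a::euclidean_space \<Rightarrow> 'b::euclidean_space" and \<Theta> S D +
  fixes L :: real
  assumes inverse_lipschitz: "\<And>\<theta> a. \<theta> \<in> \<Theta> \<Longrightarrow> a \<in> S \<Longrightarrow> norm (\<theta> - a) \<le> L * norm (c \<theta> - c a)"
begin

text \<open>
  Functions that are constant to second order at the nodes, measured in the ambient norm: the gradient
  can be taken to be zero.
\<close>

lemma jet_bounded_flat:
  assumes "u \<in> borel_measurable borel" "0 \<le> U" "\<And>\<theta>. \<theta> \<in> \<Theta> \<Longrightarrow> \<bar>u \<theta>\<bar> \<le> U"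
    and "\<And>\<theta> a. \<theta> \<in> \<Theta> \<Longrightarrow> a \<in> S \<Longrightarrow> \<bar>u \<theta> - u a\<bar> \<le> K * (norm (\<theta> - a))\<^sup>2" "0 \<le> K"
  shows "jet_bounded (U + K * L\<^sup>2) u"
  unfolding jet_bounded_def
proof (intro conjI ballI)
  show "u \<in> borel_measurable borel" by fact
  show "\<bar>u \<theta>\<bar> \<le> U + K * L\<^sup>2" if "\<theta> \<in> \<Theta>" for \<theta>
    using assms(3)[OF that] assms(5) by (simp add: add_increasing2)
  fix a assume a: "a \<in> S"
  show "\<exists>v. norm v \<le> U + K * L\<^sup>2 \<and>
    (\<forall>\<theta>\<in>\<Theta>. \<bar>u \<theta> - u a - v \<bullet> (c \<theta> - c a)\<bar> \<le> (U + K * L\<^sup>2) * sq_dist \<theta> a)"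
  proof (intro exI[of _ 0] conjI ballI)
    show "norm (0::'b) \<le> U + K * L\<^sup>2" using assms by auto
    fix \<theta> assume \<theta>: "\<theta> \<in> \<Theta>"
    have "\<bar>u \<theta> - u a\<bar> \<le> K * (norm (\<theta> - a))\<^sup>2" using assms(4)[OF \<theta> a] .
    also have "\<dots> \<le> K * (L * norm (c \<theta> - c a))\<^sup>2"
      using inverse_lipschitz[OF \<theta> a] assms(5) by (intro mult_left_mono power_mono) auto
    also have "\<dots> \<le> (U + K * L\<^sup>2) * sq_dist \<theta> a"
      using assms(2) by (simp add: power_mult_distrib distrib_right)
    finally show "\<bar>u \<theta> - u a - 0 \<bullet> (c \<theta> - c a)\<bar> \<le> (U + K * L\<^sup>2) * sq_dist \<theta> a" by simp
  qed
qed

lemma nodes_separated: "\<exists>\<rho>>0. \<forall>a\<in>S. \<forall>b\<in>S. a \<noteq> b \<longrightarrow> 2 * \<rho> \<le> norm (a - b)"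
proof -
  have sep: "\<exists>C>0. \<forall>p\<in>P. C \<le> norm (fst p - snd p)"
    if "finite P" "\<And>p. p \<in> P \<Longrightarrow> fst p \<noteq> snd p" for P :: "('a \<times> 'a) set"
    using that
  proof (induction P rule: finite_induct)
    case empty
    show ?case by (auto intro: exI[of _ 1])
  next
    case (insert p P)
    then obtain C where "C > 0" "\<forall>p\<in>P. C \<le> norm (fst p - snd p)" by auto
    then show ?case using insert.prems[of p]
      by (intro exI[of _ "min C (norm (fst p - snd p))"]) auto
  qed
  have "finite {p \<in> S \<times> S. fst p \<noteq> snd p}" using finite_nodes by simp
  then obtain C where C: "C > 0" "\<forall>p\<in>{p \<in> S \<times> S. fst p \<noteq> snd p}. C \<le> norm (fst p - snd p)"
    using sep[of "{p \<in> S \<times> S. fst p \<noteq> snd p}"] by blast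
  show ?thesis using C by (intro exI[of _ "C / 2"]) auto
qed

text \<open>
  Both the indicator of a cell around a node and the squared distance to the node of the cell are flat at
  the nodes. Their integrals bound the difference of the weights by a multiple of \<open>discrepancy g h\<close>,
  and the mean distance to the nodes by the square root of such a multiple.
\<close>

theorem wasserstein1_le_discrepancy:
  assumes h: "prob_space h" "sets h = sets borel" "AE \<theta> in h. \<theta> \<in> S"
    and hpos: "\<And>a. a \<in> S \<Longrightarrow> 0 < measure h {a}"
  shows "\<exists>C\<ge>0. \<forall>g. prob_space g \<longrightarrow> sets g = sets borel \<longrightarrow> (AE \<theta> in g. \<theta> \<in> \<Theta>) \<longrightarrow>
    wasserstein1 g h \<le> ennreal (C * (sqrt (discrepancy g h) + discrepancy g h))"
proof -
  obtain \<rho> where \<rho>: "\<rho> > 0" "\<And>a b. a \<in> S \<Longrightarrow> b \<in> S \<Longrightarrow> a \<noteq> b \<Longrightarrow> 2 * \<rho> \<le> norm (a - b)"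
    using nodes_separated by blast
  obtain a0 where a0: "a0 \<in> S" using nodes_nonempty by auto
  \<comment> \<open>The cells are disjoint balls around the nodes. Points outside all balls go to an arbitrary node; they
    are at distance at least \<open>\<rho>\<close> from every node, so this costs a constant factor only.\<close>
  define T where "T \<theta> = (\<Sum>a\<in>S. indicator (ball a \<rho>) \<theta> *\<^sub>R a) + indicator (- (\<Union>a\<in>S. ball a \<rho>)) \<theta> *\<^sub>R a0"
    for \<theta>
  have T_ball: "T \<theta> = a" if "a \<in> S" "norm (\<theta> - a) < \<rho>" for \<theta> a
  proof -
    have "(indicator (ball b \<rho>) \<theta> :: real) = (if b = a then 1 else 0)" if "b \<in> S" for b
      using \<rho>(2)[OF that \<open>a \<in> S\<close>] \<open>norm (\<theta> - a) < \<rho>\<close> norm_triangle_ineq4[of "\<theta> - a" "\<theta> - b"]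
      by (auto simp: indicator_def dist_norm norm_minus_commute)
    then have "(\<Sum>b\<in>S. indicator (ball b \<rho>) \<theta> *\<^sub>R b) = (\<Sum>b\<in>S. if b = a then b else 0)"
      by (intro sum.cong) auto
    moreover have "\<theta> \<in> (\<Union>a\<in>S. ball a \<rho>)" using that by (auto simp: dist_norm norm_minus_commute)
    ultimately show ?thesis using that finite_nodes by (simp add: T_def)
  qed
  have T_S: "T \<theta> \<in> S" for \<theta>
  proof (cases "\<theta> \<in> (\<Union>a\<in>S. ball a \<rho>)")
    case True
    then show ?thesis using T_ball by (auto simp: dist_norm norm_minus_commute)
  next
    case False
    then have "(\<Sum>b\<in>S. indicator (ball b \<rho>) \<theta> *\<^sub>R b) = 0" by (intro sum.neutral) auto
    then show ?thesis using False a0 by (simp add: T_def)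
  qed
  have T_meas[measurable]: "T \<in> borel_measurable borel"
  proof -
    have [measurable]: "- (\<Union>a\<in>S. ball a \<rho>) \<in> sets borel" "ball a \<rho> \<in> sets borel" for a
      by (intro borel_comp borel_open open_UN ballI open_ball)+
    show ?thesis unfolding T_def by measurable
  qed
  define R where "R = \<bar>L\<bar> * D"
  have R: "0 \<le> R" "norm (\<theta> - a) \<le> R" if "\<theta> \<in> \<Theta>" "a \<in> S" for \<theta> a
  proof -
    show "0 \<le> R" using D_nonneg by (simp add: R_def)
    have "norm (\<theta> - a) \<le> L * norm (c \<theta> - c a)" using inverse_lipschitz that .
    also have "\<dots> \<le> \<bar>L\<bar> * D" using diam[OF that] D_nonneg by (intro mult_mono) auto
    finally show "norm (\<theta> - a) \<le> R" by (simp add: R_def)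
  qed
  have R0: "0 \<le> R" using D_nonneg by (simp add: R_def)
  define ind :: "'a \<Rightarrow> 'a \<Rightarrow> real" where "ind a = indicator {\<theta>. T \<theta> = a}" for a
  define sq where "sq \<theta> = (norm (\<theta> - T \<theta>))\<^sup>2" for \<theta>
  define U where "U = max (1 + 1 / \<rho>\<^sup>2 * L\<^sup>2) (R\<^sup>2 + (1 + R\<^sup>2 / \<rho>\<^sup>2) * L\<^sup>2)"
  have far: "1 \<le> 1 / \<rho>\<^sup>2 * (norm (\<theta> - a))\<^sup>2" if "\<not> norm (\<theta> - a) < \<rho>" for \<theta> a
    using that \<rho>(1) by (simp add: power_mono not_less)
  have jb_ind: "jet_bounded U (ind a)" for a
  proof (rule jet_bounded_mono[OF jet_bounded_flat[of _ 1 "1 / \<rho>\<^sup>2"]])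
    show "ind a \<in> borel_measurable borel" unfolding ind_def by measurable
    show "\<bar>ind a \<theta> - ind a b\<bar> \<le> 1 / \<rho>\<^sup>2 * (norm (\<theta> - b))\<^sup>2" if "b \<in> S" for \<theta> b
    proof (cases "norm (\<theta> - b) < \<rho>")
      case True
      then show ?thesis using T_ball[OF that, of \<theta>] T_ball[OF that, of b] \<rho>(1)
        by (simp add: ind_def indicator_def)
    next
      case False
      from far[OF this] show ?thesis by (auto simp: ind_def indicator_def intro: order_trans[rotated])
    qed
  qed (auto simp: U_def ind_def indicator_def)
  have jb_sq: "jet_bounded U sq"
  proof (rule jet_bounded_mono[OF jet_bounded_flat[of _ "R\<^sup>2" "1 + R\<^sup>2 / \<rho>\<^sup>2"]])
    show "sq \<in> borel_measurable borel" unfolding sq_def by measurable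
    have sqR: "sq \<theta> \<le> R\<^sup>2" if "\<theta> \<in> \<Theta>" for \<theta>
      unfolding sq_def using R[OF that T_S[of \<theta>]] by (intro power_mono) auto
    then show "\<bar>sq \<theta>\<bar> \<le> R\<^sup>2" if "\<theta> \<in> \<Theta>" for \<theta> using that by (simp add: sq_def)
    show "\<bar>sq \<theta> - sq b\<bar> \<le> (1 + R\<^sup>2 / \<rho>\<^sup>2) * (norm (\<theta> - b))\<^sup>2" if "\<theta> \<in> \<Theta>" "b \<in> S" for \<theta> b
    proof -
      have b: "sq b = 0" using T_ball[OF that(2), of b] \<rho>(1) by (simp add: sq_def)
      have 0: "0 \<le> R\<^sup>2 / \<rho>\<^sup>2 * (norm (\<theta> - b))\<^sup>2" by simp
      show ?thesis
      proof (cases "norm (\<theta> - b) < \<rho>")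
        case True
        then show ?thesis using T_ball[OF that(2), of \<theta>] 0 unfolding b distrib_right
          by (simp add: sq_def)
      next
        case False
        have "R\<^sup>2 * 1 \<le> R\<^sup>2 * (1 / \<rho>\<^sup>2 * (norm (\<theta> - b))\<^sup>2)" by (intro mult_left_mono far[OF False]) auto
        moreover have "\<bar>sq \<theta>\<bar> = sq \<theta>" by (simp add: sq_def)
        ultimately show ?thesis using sqR[OF that(1)] unfolding b distrib_right
          by (simp add: add_increasing)
      qed
    qed
  qed (auto simp: U_def)
  obtain C where C: "C \<ge> 0" "\<And>u g. jet_bounded U u \<Longrightarrow> prob_space g \<Longrightarrow> sets g = sets borel \<Longrightarrow>
      (AE \<theta> in g. \<theta> \<in> \<Theta>) \<Longrightarrow> \<bar>(\<integral>\<theta>. u \<theta> \<partial>g) - (\<integral>\<theta>. u \<theta> \<partial>h)\<bar> \<le> C * U * discrepancy g h"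
    using jet_bounded_integral_diff h by meson
  have U0: "0 \<le> U" using jb_sq by (rule jet_bounded_nonneg)
  define wm where "wm = Min ((\<lambda>a. measure h {a}) ` S)"
  have wm: "0 < wm" "\<And>a. a \<in> S \<Longrightarrow> wm \<le> measure h {a}"
    unfolding wm_def using finite_nodes nodes_nonempty hpos by auto
  have "wasserstein1 g h \<le> ennreal ((C * U / wm * R + sqrt (C * U)) * (sqrt (discrepancy g h) + discrepancy g h))"
    if g: "prob_space g" "sets g = sets borel" "AE \<theta> in g. \<theta> \<in> \<Theta>" for g
  proof -
    interpret g: prob_space g by fact
    interpret h: prob_space h by fact
    have [measurable_cong]: "sets g = sets borel" "sets h = sets borel" by fact+
    have space: "space g = UNIV" "space h = UNIV"
      using sets_eq_imp_space_eq[OF g(2)] sets_eq_imp_space_eq[OF h(2)] by auto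
    define \<Delta> where "\<Delta> = discrepancy g h"
    have \<Delta>: "0 \<le> \<Delta>" unfolding \<Delta>_def by (rule discrepancy_nonneg)
    define \<eta> where "\<eta> = C * U * \<Delta>"
    have \<eta>: "0 \<le> \<eta>" using C U0 \<Delta> by (simp add: \<eta>_def)
    \<comment> \<open>Every cell has \<open>g\<close>-mass at most \<open>measure h {a} + \<eta>\<close>, so scaling by \<open>1 - \<eta> / wm\<close> brings it below
      \<open>measure h {a}\<close>.\<close>
    define lam where "lam = max 0 (1 - \<eta> / wm)"
    have lam: "0 \<le> lam" "lam \<le> 1" "1 - lam \<le> \<eta> / wm" using \<eta> wm(1) by (auto simp: lam_def)
    have mass: "lam * measure g {x. T x = a} \<le> measure h {a}" if a: "a \<in> S" for a
    proof -
      have gT: "measure g {x. T x = a} = (\<integral>x. ind a x \<partial>g)" by (simp add: ind_def space)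
      have "(\<integral>x. ind a x \<partial>h) = (\<integral>x. indicator {a} x \<partial>h)"
      proof (intro integral_cong_AE)
        show "AE x in h. ind a x = indicator {a} x"
          using h(3)
        proof eventually_elim
          case (elim x)
          then show ?case using T_ball[OF elim, of x] \<rho>(1) by (simp add: ind_def indicator_def)
        qed
      qed (auto simp: ind_def)
      then have "\<bar>measure g {x. T x = a} - measure h {a}\<bar> \<le> \<eta>"
        using C(2)[OF jb_ind g, of a] by (simp add: gT \<eta>_def \<Delta>_def space)
      then have upper: "measure g {x. T x = a} \<le> measure h {a} + \<eta>" by linarith
      show ?thesis
      proof (cases "measure g {x. T x = a} \<le> measure h {a}")
        case True
        have "lam * measure g {x. T x = a} \<le> 1 * measure g {x. T x = a}"
          using lam by (intro mult_right_mono) auto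
        then show ?thesis using True by simp
      next
        case False
        then have "wm \<le> measure g {x. T x = a}" using wm(2)[OF a] by simp
        then have "\<eta> / wm * wm \<le> \<eta> / wm * measure g {x. T x = a}"
          using \<eta> wm(1) by (intro mult_left_mono) auto
        then have "\<eta> \<le> \<eta> / wm * measure g {x. T x = a}" using wm(1) by simp
        then have "(1 - \<eta> / wm) * measure g {x. T x = a} \<le> measure h {a}"
          using upper unfolding left_diff_distrib by linarith
        then show ?thesis by (auto simp: lam_def max_def)
      qed
    qed
    have int_sq: "integrable g sq" by (rule integrable_jet_bounded[OF jb_sq g])
    have int_norm: "integrable g (\<lambda>x. norm (x - T x))"
    proof (rule g.integrable_const_bound[of _ R])
      show "AE x in g. norm (norm (x - T x)) \<le> R"
        using g(3) R(2) T_S by (auto elim!: eventually_mono)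
    qed measurable
    have "(\<integral>x. sq x \<partial>h) = 0"
    proof (rule integral_eq_zero_AE)
      show "AE x in h. sq x = 0" using h(3)
      proof eventually_elim
        case (elim x)
        then show ?case using T_ball[OF elim, of x] \<rho>(1) by (simp add: sq_def)
      qed
    qed
    then have "(\<integral>x. sq x \<partial>g) \<le> C * U * \<Delta>" using C(2)[OF jb_sq g] by (simp add: \<Delta>_def)
    moreover have "(\<integral>x. norm (x - T x) \<partial>g)\<^sup>2 \<le> (\<integral>x. sq x \<partial>g)"
      unfolding sq_def using g(1) int_norm int_sq
      by (intro prob_space_integral_square_le) (auto simp: sq_def[abs_def])
    ultimately have "(\<integral>x. norm (x - T x) \<partial>g)\<^sup>2 \<le> C * U * \<Delta>" by linarith
    then have dist: "(\<integral>x. norm (x - T x) \<partial>g) \<le> sqrt (C * U * \<Delta>)"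
      by (rule real_le_rsqrt)
    have "wasserstein1 g h \<le> ennreal ((1 - lam) * R + (\<integral>x. norm (x - T x) \<partial>g))"
    proof (rule wasserstein1_le_of_assignment[where S = S])
      show "AE x in g. \<forall>a\<in>S. norm (x - a) \<le> R"
        using g(3) R(2) by (auto elim!: eventually_mono)
    qed (use g h hpos T_meas T_S R0 lam mass int_norm finite_nodes in auto)
    also have "\<dots> \<le> ennreal ((C * U / wm * R + sqrt (C * U)) * (sqrt \<Delta> + \<Delta>))"
    proof (rule ennreal_leI)
      have "(1 - lam) * R \<le> \<eta> / wm * R" using lam(3) R0 by (rule mult_right_mono)
      then have "(1 - lam) * R \<le> C * U / wm * R * \<Delta>" by (simp add: \<eta>_def mult_ac)
      moreover have "sqrt (C * U * \<Delta>) = sqrt (C * U) * sqrt \<Delta>" by (rule real_sqrt_mult)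
      moreover have "0 \<le> C * U / wm * R * sqrt \<Delta>" "0 \<le> sqrt (C * U) * \<Delta>"
        using C U0 wm R0 \<Delta> by auto
      ultimately show "(1 - lam) * R + (\<integral>x. norm (x - T x) \<partial>g)
          \<le> (C * U / wm * R + sqrt (C * U)) * (sqrt \<Delta> + \<Delta>)"
        using dist unfolding distrib_left distrib_right by linarith
    qed
    finally show ?thesis by (simp add: \<Delta>_def)
  qed
  moreover have "0 \<le> C * U / wm * R + sqrt (C * U)" using C U0 wm R0 by auto
  ultimately show ?thesis by blast
qed

end

section \<open>The base measure, exponential moments and unbiased estimators\<close>

definition coord_measure :: "'d set \<Rightarrow> 'd \<Rightarrow> real measure" where
  "coord_measure B l = (if l \<in> B then lborel else distr (count_space (UNIV :: nat set)) borel real)"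

definition coord_density :: "'d set \<Rightarrow> 'd \<Rightarrow> real \<Rightarrow> real \<Rightarrow> real" where
  "coord_density B l t x = (if l \<in> B then std_normal_density (x - t) else poisson_density t x)"

lemma sets_coord_measure [simp, measurable_cong]: "sets (coord_measure B l) = sets borel"
  by (simp add: coord_measure_def)

lemma space_coord_measure [simp]: "space (coord_measure B l) = UNIV"
  by (simp add: coord_measure_def)

lemma product_density_eq: "product_density B \<theta> x = (\<Prod>l\<in>UNIV. coord_density B l (\<theta> $ l) (x $ l))"
  by (simp add: product_density_def coord_density_def)

lemma sigma_finite_coord_measure: "sigma_finite_measure (coord_measure B l)"
proof (cases "l \<in> B")
  case True
  then show ?thesis by (simp add: coord_measure_def sigma_finite_lborel)
next
  case False
  let ?M = "distr (count_space (UNIV :: nat set)) borel real"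
  have "sigma_finite_measure ?M"
  proof
    let ?A = "insert (UNIV - range real) (range (\<lambda>k. {real k}))"
    have range: "range real \<in> sets borel" by (rule sets.countable) auto
    have "UNIV - range real \<in> sets borel" using sets.Diff[OF sets.top range] by simp
    then have A_sets: "?A \<subseteq> sets borel" by (simp add: image_subset_iff)
    have A_union: "\<Union> ?A = UNIV" by blast
    have A_countable: "countable ?A" by simp
    have em: "emeasure ?M a \<noteq> \<infinity>" if "a \<in> ?A" for a
    proof -
      have "finite (real -` a)"
      proof (cases "a = UNIV - range real")
        case True
        then have "real -` a = {}" by auto
        then show ?thesis by simp
      next
        case False
        with that have "a \<in> range (\<lambda>k. {real k})" by blast
        then obtain k where "a = {real k}" by (elim rangeE)
        then have "real -` a = {k}" by auto
        then show ?thesis by simp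
      qed
      moreover have "a \<in> sets borel" using A_sets that by blast
      ultimately show ?thesis by (simp add: emeasure_distr emeasure_count_space_finite)
    qed
    show "\<exists>A. countable A \<and> A \<subseteq> sets ?M \<and> \<Union> A = space ?M \<and> (\<forall>a\<in>A. emeasure ?M a \<noteq> \<infinity>)"
      using A_sets A_union A_countable by (intro exI[of _ ?A] conjI ballI em) (simp_all only: sets_distr space_distr space_borel)
  qed
  with False show ?thesis by (simp add: coord_measure_def)
qed

lemma base_measure_eq:
  "base_measure B = distr (Pi\<^sub>M UNIV (coord_measure B)) borel vec_lambda"
  unfolding base_measure_def coord_measure_def ..

lemma sets_base_measure [simp, measurable_cong]: "sets (base_measure B) = sets borel"
  by (simp add: base_measure_def)

lemma space_base_measure [simp]: "space (base_measure B) = UNIV"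
  by (simp add: base_measure_def)

lemma measurable_vec_lambda [measurable]:
  "vec_lambda \<in> Pi\<^sub>M UNIV (coord_measure (B :: 'd::finite set)) \<rightarrow>\<^sub>M (borel :: (real ^ 'd) measure)"
proof (subst borel_measurable_euclidean_space, intro ballI)
  fix e :: "real ^ 'd" assume "e \<in> Basis"
  then obtain i where e: "e = axis i 1" by (auto simp: Basis_vec_def)
  have "(\<lambda>f. f i) \<in> borel_measurable (Pi\<^sub>M UNIV (coord_measure B))"
    using measurable_component_singleton[of i UNIV "coord_measure B"] by simp
  then show "(\<lambda>f. vec_lambda f \<bullet> e) \<in> borel_measurable (Pi\<^sub>M UNIV (coord_measure B))"
    by (simp add: e inner_axis)
qed

lemma borel_measurable_vec_nth [measurable]:
  "(\<lambda>x :: real ^ 'd::finite. x $ l) \<in> borel_measurable borel"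
  by (intro borel_measurable_continuous_onI continuous_intros)

lemma base_measure_integral_prod:
  fixes f :: "'d::finite \<Rightarrow> real \<Rightarrow> real"
  assumes "\<And>l. integrable (coord_measure B l) (f l)"
  shows "integrable (base_measure B) (\<lambda>x. \<Prod>l\<in>UNIV. f l (x $ l))"
    and "(\<integral>x. (\<Prod>l\<in>UNIV. f l (x $ l)) \<partial>base_measure B) = (\<Prod>l\<in>UNIV. \<integral>x. f l x \<partial>coord_measure B l)"
proof -
  interpret product_sigma_finite "coord_measure B"
    by (intro product_sigma_finite.intro sigma_finite_coord_measure)
  have [measurable]: "f l \<in> borel_measurable borel" for l
    using borel_measurable_integrable[OF assms[of l]] by simp
  have meas: "(\<lambda>x. \<Prod>l\<in>UNIV. f l (x $ l)) \<in> borel_measurable borel"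
    by measurable
  show "integrable (base_measure B) (\<lambda>x. \<Prod>l\<in>UNIV. f l (x $ l))"
    unfolding base_measure_eq
    using product_integrable_prod[of UNIV f, OF finite_class.finite_UNIV assms]
    by (subst integrable_distr_eq[OF measurable_vec_lambda meas]) (simp only: vec_lambda_beta)
  show "(\<integral>x. (\<Prod>l\<in>UNIV. f l (x $ l)) \<partial>base_measure B) = (\<Prod>l\<in>UNIV. \<integral>x. f l x \<partial>coord_measure B l)"
    unfolding base_measure_eq
    using product_integral_prod[of UNIV f, OF finite_class.finite_UNIV assms]
    by (subst integral_distr[OF measurable_vec_lambda meas]) (simp only: vec_lambda_beta)
qed

lemma borel_measurable_poisson_density [measurable]: "poisson_density t \<in> borel_measurable borel"
proof -
  have [measurable]: "(\<nat> :: real set) \<in> sets borel"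
    unfolding Nats_def by (rule sets.countable) auto
  show ?thesis unfolding poisson_density_def[abs_def] by measurable
qed

lemma borel_measurable_coord_density [measurable]: "coord_density B l t \<in> borel_measurable borel"
  unfolding coord_density_def[abs_def] by measurable

lemma borel_measurable_product_density [measurable]:
  "product_density B \<theta> \<in> borel_measurable borel"
  unfolding product_density_eq[abs_def] by measurable

lemma coord_density_nonneg: "l \<in> B \<or> 0 \<le> t \<Longrightarrow> 0 \<le> coord_density B l t x"
  by (auto simp: coord_density_def poisson_density_def)

text \<open>
  Completing the square: an exponential tilt shifts the mean.
\<close>

lemma gaussian_tilt:
  "exp (s * x) * std_normal_density (x - t) = exp (s * t + s\<^sup>2 / 2) * normal_density (t + s) 1 x"
proof -
  have "s * x + - (x - t)\<^sup>2 / 2 = (s * t + s\<^sup>2 / 2) + - (x - (t + s))\<^sup>2 / 2"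
    by (simp add: power2_eq_square field_simps)
  then show ?thesis
    by (simp add: std_normal_density_def normal_density_def exp_add[symmetric])
qed

lemma gaussian_exponential_moment:
  shows "integrable lborel (\<lambda>x. exp (s * x) * std_normal_density (x - t))"
    and "(\<integral>x. exp (s * x) * std_normal_density (x - t) \<partial>lborel) = exp (s * t + s\<^sup>2 / 2)"
  unfolding gaussian_tilt by simp_all

lemma poisson_generating_function:
  fixes z t :: real
  defines "M \<equiv> distr (count_space (UNIV :: nat set)) borel real"
  assumes "0 \<le> t" "0 \<le> z"
  shows "integrable M (\<lambda>x. z ^ nat \<lfloor>x\<rfloor> * poisson_density t x)"
    and "(\<integral>x. z ^ nat \<lfloor>x\<rfloor> * poisson_density t x \<partial>M) = exp ((z - 1) * t)"
proof -
  have eq: "z ^ nat \<lfloor>real k\<rfloor> * poisson_density t (real k) = (z * t) ^ k /\<^sub>R fact k * exp (- t)" for k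
    by (simp add: poisson_density_def power_mult_distrib divide_inverse)
  have sums: "(\<lambda>k. (z * t) ^ k /\<^sub>R fact k * exp (- t)) sums (exp (z * t) * exp (- t))"
    by (intro sums_mult2 exp_converges)
  have int: "integrable (count_space UNIV) (\<lambda>k. (z * t) ^ k /\<^sub>R fact k * exp (- t))"
    using sums assms by (subst integrable_count_space_nat_iff) (auto simp: sums_iff)
  have meas: "(\<lambda>x. z ^ nat \<lfloor>x\<rfloor> * poisson_density t x) \<in> borel_measurable borel" by measurable
  show "integrable M (\<lambda>x. z ^ nat \<lfloor>x\<rfloor> * poisson_density t x)"
    unfolding M_def using int meas by (subst integrable_distr_eq) (simp_all only: eq, simp)
  have "(\<integral>x. z ^ nat \<lfloor>x\<rfloor> * poisson_density t x \<partial>M)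
      = (\<integral>k. z ^ nat \<lfloor>real k\<rfloor> * poisson_density t (real k) \<partial>count_space UNIV)"
    unfolding M_def by (intro integral_distr meas) simp
  also have "\<dots> = exp (z * t) * exp (- t)"
    unfolding eq using integral_count_space_nat[OF int] sums by (simp add: sums_iff)
  also have "\<dots> = exp ((z - 1) * t)" by (simp add: exp_add[symmetric] algebra_simps)
  finally show "(\<integral>x. z ^ nat \<lfloor>x\<rfloor> * poisson_density t x \<partial>M) = exp ((z - 1) * t)" .
qed

lemma coord_exponential_moment:
  assumes "l \<in> B \<or> 0 \<le> t"
  shows "integrable (coord_measure B l) (\<lambda>x. exp (\<kappa> * \<bar>x\<bar>) * coord_density B l t x)"
proof (cases "l \<in> B")
  case True
  have "integrable lborel (\<lambda>x. exp (\<kappa> * \<bar>x\<bar>) * std_normal_density (x - t))"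
  proof (rule Bochner_Integration.integrable_bound)
    show "integrable lborel (\<lambda>x. exp (\<kappa> * x) * std_normal_density (x - t)
        + exp (- \<kappa> * x) * std_normal_density (x - t))"
      by (intro Bochner_Integration.integrable_add gaussian_exponential_moment)
    show "AE x in lborel. norm (exp (\<kappa> * \<bar>x\<bar>) * std_normal_density (x - t))
       \<le> norm (exp (\<kappa> * x) * std_normal_density (x - t) + exp (- \<kappa> * x) * std_normal_density (x - t))"
    proof (intro always_eventually allI)
      fix x
      have p: "0 \<le> std_normal_density (x - t)" by simp
      have "exp (\<kappa> * \<bar>x\<bar>) \<le> exp (\<kappa> * x) + exp (- \<kappa> * x)" by (cases "0 \<le> x") auto
      from mult_right_mono[OF this p]
      have "exp (\<kappa> * \<bar>x\<bar>) * std_normal_density (x - t)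
         \<le> exp (\<kappa> * x) * std_normal_density (x - t) + exp (- \<kappa> * x) * std_normal_density (x - t)"
        by (simp only: distrib_right)
      then show "norm (exp (\<kappa> * \<bar>x\<bar>) * std_normal_density (x - t))
       \<le> norm (exp (\<kappa> * x) * std_normal_density (x - t) + exp (- \<kappa> * x) * std_normal_density (x - t))"
        using p by (simp only: real_norm_def abs_mult abs_exp_cancel abs_of_nonneg[OF p])
    qed
  qed measurable
  with True show ?thesis by (simp add: coord_measure_def coord_density_def)
next
  case False
  then have "0 \<le> t" using assms by auto
  have eq: "exp (\<kappa> * \<bar>x\<bar>) * poisson_density t x = exp \<kappa> ^ nat \<lfloor>x\<rfloor> * poisson_density t x" for x
    by (auto simp: poisson_density_def Nats_def exp_of_nat_mult[symmetric] mult.commute)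
  show ?thesis
    using poisson_generating_function(1)[OF \<open>0 \<le> t\<close>, of "exp \<kappa>"] False
    by (simp add: coord_measure_def coord_density_def eq)
qed

text \<open>
  All functions of the observations that occur grow at most exponentially, and both densities have all
  exponential moments. This single class therefore settles every question of integrability, including
  that of squares, since it is closed under products.
\<close>

definition exp_bounded :: "(real ^ 'd::finite \<Rightarrow> real) \<Rightarrow> bool" where
  "exp_bounded f \<longleftrightarrow> (\<exists>C\<ge>0. \<exists>\<kappa>\<ge>0. \<forall>x. \<bar>f x\<bar> \<le> C * exp (\<kappa> * (\<Sum>l\<in>UNIV. \<bar>x $ l\<bar>)))"

lemma exp_bounded_const: "exp_bounded (\<lambda>_. r)"
  unfolding exp_bounded_def by (intro exI[of _ "\<bar>r\<bar>"] conjI exI[of _ 0]) auto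

lemma exp_bounded_mono: "exp_bounded f \<Longrightarrow> (\<And>x. \<bar>g x\<bar> \<le> \<bar>f x\<bar>) \<Longrightarrow> exp_bounded g"
  unfolding exp_bounded_def by (meson order_trans)

lemma exp_bounded_add:
  fixes f g :: "real ^ 'd::finite \<Rightarrow> real"
  assumes "exp_bounded f" "exp_bounded g"
  shows "exp_bounded (\<lambda>x. f x + g x)"
proof -
  obtain C \<kappa> where f: "C \<ge> 0" "\<kappa> \<ge> 0" "\<And>x. \<bar>f x\<bar> \<le> C * exp (\<kappa> * (\<Sum>l\<in>UNIV. \<bar>x $ l\<bar>))"
    using assms(1) unfolding exp_bounded_def by blast
  obtain C' \<kappa>' where g: "C' \<ge> 0" "\<kappa>' \<ge> 0" "\<And>x. \<bar>g x\<bar> \<le> C' * exp (\<kappa>' * (\<Sum>l\<in>UNIV. \<bar>x $ l\<bar>))"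
    using assms(2) unfolding exp_bounded_def by blast
  have "\<bar>f x + g x\<bar> \<le> (C + C') * exp ((\<kappa> + \<kappa>') * (\<Sum>l\<in>UNIV. \<bar>x $ l\<bar>))" for x
  proof -
    let ?n = "\<Sum>l\<in>UNIV. \<bar>x $ l\<bar>"
    have "0 \<le> ?n" by (intro sum_nonneg) auto
    then have "exp (\<kappa> * ?n) \<le> exp ((\<kappa> + \<kappa>') * ?n)" "exp (\<kappa>' * ?n) \<le> exp ((\<kappa> + \<kappa>') * ?n)"
      using f g by (auto intro!: mult_right_mono)
    then have "C * exp (\<kappa> * ?n) \<le> C * exp ((\<kappa> + \<kappa>') * ?n)"
      "C' * exp (\<kappa>' * ?n) \<le> C' * exp ((\<kappa> + \<kappa>') * ?n)"
      using f g by (auto intro!: mult_left_mono)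
    then show ?thesis using f(3)[of x] g(3)[of x] unfolding distrib_right[of C C'] by linarith
  qed
  then show ?thesis unfolding exp_bounded_def
    using f g by (intro exI[of _ "C + C'"] conjI exI[of _ "\<kappa> + \<kappa>'"]) auto
qed

lemma exp_bounded_mult:
  fixes f g :: "real ^ 'd::finite \<Rightarrow> real"
  assumes "exp_bounded f" "exp_bounded g"
  shows "exp_bounded (\<lambda>x. f x * g x)"
proof -
  obtain C \<kappa> where f: "C \<ge> 0" "\<kappa> \<ge> 0" "\<And>x. \<bar>f x\<bar> \<le> C * exp (\<kappa> * (\<Sum>l\<in>UNIV. \<bar>x $ l\<bar>))"
    using assms(1) unfolding exp_bounded_def by blast
  obtain C' \<kappa>' where g: "C' \<ge> 0" "\<kappa>' \<ge> 0" "\<And>x. \<bar>g x\<bar> \<le> C' * exp (\<kappa>' * (\<Sum>l\<in>UNIV. \<bar>x $ l\<bar>))"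
    using assms(2) unfolding exp_bounded_def by blast
  have "\<bar>f x * g x\<bar> \<le> (C * C') * exp ((\<kappa> + \<kappa>') * (\<Sum>l\<in>UNIV. \<bar>x $ l\<bar>))" for x
  proof -
    let ?n = "\<Sum>l\<in>UNIV. \<bar>x $ l\<bar>"
    have "\<bar>f x * g x\<bar> \<le> (C * exp (\<kappa> * ?n)) * (C' * exp (\<kappa>' * ?n))"
      unfolding abs_mult using f g by (intro mult_mono) auto
    then show ?thesis by (simp add: distrib_right exp_add mult_ac)
  qed
  then show ?thesis unfolding exp_bounded_def
    using f g by (intro exI[of _ "C * C'"] conjI exI[of _ "\<kappa> + \<kappa>'"]) auto
qed

lemma exp_bounded_coord:
  assumes "\<And>x. \<bar>\<phi> x\<bar> \<le> C * exp (\<kappa> * \<bar>x\<bar>)" "0 \<le> \<kappa>"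
  shows "exp_bounded (\<lambda>x :: real ^ 'd::finite. \<phi> (x $ l))"
proof -
  have C: "0 \<le> C" using assms(1)[of 0] by simp
  have "\<bar>\<phi> (x $ l)\<bar> \<le> C * exp (\<kappa> * (\<Sum>l\<in>UNIV. \<bar>x $ l\<bar>))" for x :: "real ^ 'd"
  proof -
    have "\<bar>x $ l\<bar> \<le> (\<Sum>l\<in>UNIV. \<bar>x $ l\<bar>)" by (intro member_le_sum) auto
    then have "C * exp (\<kappa> * \<bar>x $ l\<bar>) \<le> C * exp (\<kappa> * (\<Sum>l\<in>UNIV. \<bar>x $ l\<bar>))"
      using assms(2) C by (intro mult_left_mono) (auto intro: mult_left_mono)
    then show ?thesis using assms(1)[of "x $ l"] by linarith
  qed
  then show ?thesis unfolding exp_bounded_def using C assms(2) by blast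
qed

lemma exp_bounded_prod:
  "finite F \<Longrightarrow> (\<And>i. i \<in> F \<Longrightarrow> exp_bounded (f i)) \<Longrightarrow> exp_bounded (\<lambda>x. \<Prod>i\<in>F. f i x)"
  by (induction F rule: finite_induct) (auto intro: exp_bounded_const exp_bounded_mult)

lemma exp_bounded_sum:
  "finite F \<Longrightarrow> (\<And>i. i \<in> F \<Longrightarrow> exp_bounded (f i)) \<Longrightarrow> exp_bounded (\<lambda>x. \<Sum>i\<in>F. f i x)"
  by (induction F rule: finite_induct) (auto intro: exp_bounded_const exp_bounded_add)

lemma product_density_nonneg:
  "\<theta> \<in> parameter_domain B \<Longrightarrow> 0 \<le> product_density B \<theta> x"
  unfolding product_density_eq
  by (intro prod_nonneg coord_density_nonneg) (auto simp: parameter_domain_def intro: less_imp_le)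

lemma exp_bounded_integrable:
  fixes f :: "real ^ 'd::finite \<Rightarrow> real"
  assumes "exp_bounded f" "f \<in> borel_measurable borel" "\<theta> \<in> parameter_domain B"
  shows "integrable (base_measure B) (\<lambda>x. f x * product_density B \<theta> x)"
proof -
  obtain C \<kappa> where f: "C \<ge> 0" "\<kappa> \<ge> 0" "\<And>x. \<bar>f x\<bar> \<le> C * exp (\<kappa> * (\<Sum>l\<in>UNIV. \<bar>x $ l\<bar>))"
    using assms(1) unfolding exp_bounded_def by blast
  have "integrable (base_measure B) (\<lambda>x. C * (\<Prod>l\<in>UNIV. exp (\<kappa> * \<bar>x $ l\<bar>) * coord_density B l (\<theta> $ l) (x $ l)))"
    using assms(3)
    by (intro integrable_mult_right base_measure_integral_prod(1)[of B "\<lambda>l x. exp (\<kappa> * \<bar>x\<bar>) * coord_density B l (\<theta> $ l) x"]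
        coord_exponential_moment)
       (auto simp: parameter_domain_def less_imp_le)
  then show ?thesis
  proof (rule Bochner_Integration.integrable_bound)
    show "AE x in base_measure B. norm (f x * product_density B \<theta> x)
      \<le> norm (C * (\<Prod>l\<in>UNIV. exp (\<kappa> * \<bar>x $ l\<bar>) * coord_density B l (\<theta> $ l) (x $ l)))"
    proof (intro always_eventually allI)
      fix x
      have p: "0 \<le> product_density B \<theta> x" using assms(3) by (rule product_density_nonneg)
      have eq: "C * (\<Prod>l\<in>UNIV. exp (\<kappa> * \<bar>x $ l\<bar>) * coord_density B l (\<theta> $ l) (x $ l))
          = C * exp (\<kappa> * (\<Sum>l\<in>UNIV. \<bar>x $ l\<bar>)) * product_density B \<theta> x"
        by (simp add: prod.distrib product_density_eq exp_sum sum_distrib_left)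
      show "norm (f x * product_density B \<theta> x)
        \<le> norm (C * (\<Prod>l\<in>UNIV. exp (\<kappa> * \<bar>x $ l\<bar>) * coord_density B l (\<theta> $ l) (x $ l)))"
        unfolding eq using f p by (simp add: abs_mult mult_right_mono)
    qed
  qed (use assms(2) in measurable)
qed

text \<open>
  The expectation is \<open>exp t ^ k\<close> in both models: for a Gaussian by its moment generating function, for
  a Poisson variable because its probability generating function at \<open>z\<close> is \<open>exp ((z - 1) t)\<close>.
\<close>

definition coord_estimator :: "'d set \<Rightarrow> 'd \<Rightarrow> nat \<Rightarrow> real \<Rightarrow> real" where
  "coord_estimator B l k x =
     (if l \<in> B then exp (real k * x - (real k)\<^sup>2 / 2) else (1 + real k) ^ nat \<lfloor>x\<rfloor>)"

lemma borel_measurable_coord_estimator [measurable]: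
  "coord_estimator B l k \<in> borel_measurable borel"
  unfolding coord_estimator_def[abs_def] by measurable

lemma coord_estimator_unbiased:
  assumes "l \<in> B \<or> 0 \<le> t"
  shows "integrable (coord_measure B l) (\<lambda>x. coord_estimator B l k x * coord_density B l t x)"
    and "(\<integral>x. coord_estimator B l k x * coord_density B l t x \<partial>coord_measure B l) = exp t ^ k"
proof -
  have eq: "exp (real k * x - (real k)\<^sup>2 / 2) * p = exp (- (real k)\<^sup>2 / 2) * (exp (real k * x) * p)" for x p :: real
    by (simp add: mult.assoc[symmetric] mult_exp_exp)
  have gauss: "exp (- (real k)\<^sup>2 / 2) * exp (real k * t + (real k)\<^sup>2 / 2) = exp t ^ k"
    by (simp add: mult_exp_exp exp_of_nat_mult)
  have "integrable (coord_measure B l) (\<lambda>x. coord_estimator B l k x * coord_density B l t x) \<and>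
    (\<integral>x. coord_estimator B l k x * coord_density B l t x \<partial>coord_measure B l) = exp t ^ k"
  proof (cases "l \<in> B")
    case True
    have "integrable lborel (\<lambda>x. exp (- (real k)\<^sup>2 / 2) * (exp (real k * x) * std_normal_density (x - t)))"
      by (intro integrable_mult_right gaussian_exponential_moment(1))
    moreover have "(\<integral>x. exp (- (real k)\<^sup>2 / 2) * (exp (real k * x) * std_normal_density (x - t)) \<partial>lborel) = exp t ^ k"
      by (subst integral_mult_right_zero, subst gaussian_exponential_moment(2)) (rule gauss)
    ultimately show ?thesis
      using True by (simp only: coord_measure_def coord_density_def coord_estimator_def eq if_True)
  next
    case False
    then have t: "0 \<le> t" using assms by simp
    have "exp (real k * t) = exp t ^ k" by (rule exp_of_nat_mult)
    then show ?thesis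
      using False poisson_generating_function[OF t, of "1 + real k"]
      by (simp add: coord_measure_def coord_density_def coord_estimator_def)
  qed
  then show "integrable (coord_measure B l) (\<lambda>x. coord_estimator B l k x * coord_density B l t x)"
    and "(\<integral>x. coord_estimator B l k x * coord_density B l t x \<partial>coord_measure B l) = exp t ^ k"
    by auto
qed

lemma nat_floor_le_abs: "real (nat \<lfloor>x\<rfloor>) \<le> \<bar>x\<bar>"
  by linarith

lemma power_nat_floor_le: "1 \<le> z \<Longrightarrow> z ^ nat \<lfloor>x\<rfloor> \<le> exp (ln z * \<bar>x\<bar>)" for z :: real
proof -
  assume z: "1 \<le> z"
  have "z ^ nat \<lfloor>x\<rfloor> = exp (ln z * real (nat \<lfloor>x\<rfloor>))"
    using z by (simp add: exp_of_nat2_mult)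
  then show ?thesis using z nat_floor_le_abs[of x] by (auto intro: mult_left_mono)
qed

lemma exp_bounded_coord_estimator: "exp_bounded (\<lambda>x :: real ^ 'd::finite. coord_estimator B l k (x $ l))"
proof (cases "l \<in> B")
  case True
  have "\<bar>coord_estimator B l k x\<bar> \<le> 1 * exp (real k * \<bar>x\<bar>)" for x
  proof -
    have "real k * x \<le> real k * \<bar>x\<bar>" by (intro mult_left_mono) auto
    moreover have "0 \<le> (real k)\<^sup>2 / 2" by simp
    ultimately have "real k * x - (real k)\<^sup>2 / 2 \<le> real k * \<bar>x\<bar>" by linarith
    then show ?thesis using True by (simp add: coord_estimator_def)
  qed
  then show ?thesis by (rule exp_bounded_coord) simp
next
  case False
  have "\<bar>coord_estimator B l k x\<bar> \<le> 1 * exp (ln (1 + real k) * \<bar>x\<bar>)" for x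
    using False power_nat_floor_le[of "1 + real k" x] by (simp add: coord_estimator_def)
  then show ?thesis by (rule exp_bounded_coord) simp
qed

text \<open>
  Linear combinations of monomials in \<open>exp \<theta>\<^sub>l\<close>: an estimator is found for a monomial by taking products
  over the coordinates, and for a sum by linearity. That products of such functions are again of this
  form makes all polynomials in \<open>exp \<theta>\<^sub>l\<close> accessible.
\<close>

inductive_set exponential_sums :: "(real ^ 'd::finite \<Rightarrow> real) set" where
  monomial: "(\<lambda>\<theta>. r * (\<Prod>l\<in>UNIV. exp (\<theta> $ l) ^ k l)) \<in> exponential_sums"
| add: "u \<in> exponential_sums \<Longrightarrow> w \<in> exponential_sums \<Longrightarrow> (\<lambda>\<theta>. u \<theta> + w \<theta>) \<in> exponential_sums"

lemma exponential_sums_mult: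
  assumes "u \<in> exponential_sums" "w \<in> exponential_sums"
  shows "(\<lambda>\<theta>. u \<theta> * w \<theta>) \<in> exponential_sums"
  using assms
proof (induction u rule: exponential_sums.induct)
  case (monomial r k)
  from \<open>w \<in> exponential_sums\<close> show ?case
  proof (induction w rule: exponential_sums.induct)
    case (monomial r' k')
    have "(\<lambda>\<theta>. r * (\<Prod>l\<in>UNIV. exp (\<theta> $ l) ^ k l) * (r' * (\<Prod>l\<in>UNIV. exp (\<theta> $ l) ^ k' l)))
        = (\<lambda>\<theta>. (r * r') * (\<Prod>l\<in>UNIV. exp (\<theta> $ l) ^ (k l + k' l)))"
      by (simp add: power_add prod.distrib mult_ac)
    then show ?case by (simp add: exponential_sums.monomial)
  next
    case (add u w)
    from exponential_sums.add[OF add.IH] show ?case by (simp add: distrib_left)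
  qed
next
  case (add u v)
  then have "(\<lambda>\<theta>. u \<theta> * w \<theta>) \<in> exponential_sums" "(\<lambda>\<theta>. v \<theta> * w \<theta>) \<in> exponential_sums" by auto
  from exponential_sums.add[OF this] show ?case by (simp add: distrib_right)
qed

lemma exponential_sums_const: "(\<lambda>_. r) \<in> exponential_sums"
  using exponential_sums.monomial[of r "\<lambda>_. 0"] by simp

lemma exponential_sums_coord: "(\<lambda>\<theta> :: real ^ 'd::finite. exp (\<theta> $ i)) \<in> exponential_sums"
proof -
  have "(\<lambda>\<theta> :: real ^ 'd. exp (\<theta> $ i)) = (\<lambda>\<theta>. 1 * (\<Prod>l\<in>UNIV. exp (\<theta> $ l) ^ (if l = i then 1 else 0)))"
    by (rule ext, subst prod.remove[of UNIV i]) auto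
  also have "\<dots> \<in> exponential_sums" by (rule exponential_sums.monomial)
  finally show ?thesis .
qed

lemma unbiased_estimator_exists:
  fixes Q :: "real ^ 'd::finite \<Rightarrow> real"
  assumes "Q \<in> exponential_sums"
  shows "\<exists>q. q \<in> borel_measurable borel \<and> exp_bounded q \<and>
    (\<forall>\<theta>\<in>parameter_domain B. (\<integral>x. q x * product_density B \<theta> x \<partial>base_measure B) = Q \<theta>)"
  using assms
proof (induction Q rule: exponential_sums.induct)
  case (monomial r k)
  define q :: "real ^ 'd \<Rightarrow> real" where "q x = r * (\<Prod>l\<in>UNIV. coord_estimator B l (k l) (x $ l))" for x
  have "q \<in> borel_measurable borel" unfolding q_def by measurable
  moreover have "exp_bounded q"
    unfolding q_def[abs_def]
    by (intro exp_bounded_mult exp_bounded_const exp_bounded_prod exp_bounded_coord_estimator) auto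
  moreover have "(\<integral>x. q x * product_density B \<theta> x \<partial>base_measure B) = r * (\<Prod>l\<in>UNIV. exp (\<theta> $ l) ^ k l)"
    if \<theta>: "\<theta> \<in> parameter_domain B" for \<theta>
  proof -
    have *: "l \<in> B \<or> 0 \<le> \<theta> $ l" for l using \<theta> by (auto simp: parameter_domain_def less_imp_le)
    have "(\<integral>x. q x * product_density B \<theta> x \<partial>base_measure B)
        = (\<integral>x. r * (\<Prod>l\<in>UNIV. coord_estimator B l (k l) (x $ l) * coord_density B l (\<theta> $ l) (x $ l)) \<partial>base_measure B)"
      by (simp add: q_def product_density_eq prod.distrib mult.assoc)
    also have "\<dots> = r * (\<Prod>l\<in>UNIV. exp (\<theta> $ l) ^ k l)"
      using base_measure_integral_prod(2)[of B "\<lambda>l x. coord_estimator B l (k l) x * coord_density B l (\<theta> $ l) x"]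
        coord_estimator_unbiased[OF *]
      by simp
    finally show ?thesis .
  qed
  ultimately show ?case by blast
next
  case (add u w)
  then obtain q q' where q: "q \<in> borel_measurable borel" "exp_bounded q"
    "\<And>\<theta>. \<theta>\<in>parameter_domain B \<Longrightarrow> (\<integral>x. q x * product_density B \<theta> x \<partial>base_measure B) = u \<theta>"
    and q': "q' \<in> borel_measurable borel" "exp_bounded q'"
    "\<And>\<theta>. \<theta>\<in>parameter_domain B \<Longrightarrow> (\<integral>x. q' x * product_density B \<theta> x \<partial>base_measure B) = w \<theta>"
    by blast
  show ?case
  proof (intro exI[of _ "\<lambda>x. q x + q' x"] conjI ballI)
    show "(\<lambda>x. q x + q' x) \<in> borel_measurable borel" using q q' by measurable
    show "exp_bounded (\<lambda>x. q x + q' x)" using q q' by (intro exp_bounded_add)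
    fix \<theta> assume \<theta>: "\<theta> \<in> parameter_domain B"
    show "(\<integral>x. (q x + q' x) * product_density B \<theta> x \<partial>base_measure B) = u \<theta> + w \<theta>"
      using exp_bounded_integrable[OF q(2,1) \<theta>] exp_bounded_integrable[OF q'(2,1) \<theta>] q(3)[OF \<theta>] q'(3)[OF \<theta>]
      by (simp add: distrib_right)
  qed
qed

section \<open>Power series of the densities in the parameter\<close>

abbreviation summable_family :: "('i \<Rightarrow> 'b::{banach, second_countable_topology}) \<Rightarrow> bool" where
  "summable_family f \<equiv> Infinite_Set_Sum.abs_summable_on f UNIV"

context interpolation_nodes
begin

text \<open>
  Jets may be summed term by term, because values, gradients and remainders all obey the same bound.
\<close>

lemma jet_bounded_infsetsum:
  fixes z :: "'i \<Rightarrow> real"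
  assumes u: "\<And>i. jet_bounded (U i) (u i)"
    and summable: "summable_family (\<lambda>i. \<bar>z i\<bar> * U i)"
    and total: "w \<in> borel_measurable borel" "\<And>\<theta>. \<theta> \<in> \<Theta> \<Longrightarrow> w \<theta> = (\<Sum>\<^sub>ai. z i * u i \<theta>)"
  shows "jet_bounded (\<Sum>\<^sub>ai. \<bar>z i\<bar> * U i) w"
  unfolding jet_bounded_def
proof (intro conjI ballI)
  have U: "0 \<le> U i" for i using u by (rule jet_bounded_nonneg)
  have sm: "summable_family (\<lambda>i. z i * u i \<theta>)" if "\<theta> \<in> \<Theta>" for \<theta>
    using summable by (rule abs_summable_on_comparison_test)
      (use jet_boundedD(2)[OF u that] U in \<open>auto simp: abs_mult intro!: mult_left_mono\<close>)
  show "w \<in> borel_measurable borel" by fact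
  show "\<bar>w \<theta>\<bar> \<le> (\<Sum>\<^sub>ai. \<bar>z i\<bar> * U i)" if \<theta>: "\<theta> \<in> \<Theta>" for \<theta>
  proof -
    have "\<bar>w \<theta>\<bar> \<le> (\<Sum>\<^sub>ai. \<bar>z i * u i \<theta>\<bar>)"
      using norm_infsetsum_bound[of "\<lambda>i. z i * u i \<theta>" UNIV] by (simp add: total(2)[OF \<theta>])
    also have "\<dots> \<le> (\<Sum>\<^sub>ai. \<bar>z i\<bar> * U i)"
      using abs_summable_on_normI[OF sm[OF \<theta>]] summable jet_boundedD(2)[OF u \<theta>]
      by (intro infsetsum_mono) (auto simp: abs_mult intro!: mult_left_mono)
    finally show ?thesis .
  qed
  fix a assume a: "a \<in> S"
  with nodes_sub have a': "a \<in> \<Theta>" by auto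
  have "\<forall>i. \<exists>v. norm v \<le> U i \<and>
    (\<forall>\<theta>\<in>\<Theta>. \<bar>u i \<theta> - u i a - v \<bullet> (c \<theta> - c a)\<bar> \<le> U i * sq_dist \<theta> a)"
    using u a unfolding jet_bounded_def by blast
  then obtain v where v: "\<And>i. norm (v i) \<le> U i"
    "\<And>i \<theta>. \<theta> \<in> \<Theta> \<Longrightarrow> \<bar>u i \<theta> - u i a - v i \<bullet> (c \<theta> - c a)\<bar> \<le> U i * sq_dist \<theta> a"
    by metis
  have sv: "summable_family (\<lambda>i. z i *\<^sub>R v i)"
    using summable by (rule abs_summable_on_comparison_test)
      (use v(1) U in \<open>auto simp: abs_mult intro!: mult_left_mono\<close>)
  define V where "V = (\<Sum>\<^sub>ai. z i *\<^sub>R v i)"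
  show "\<exists>v. norm v \<le> (\<Sum>\<^sub>ai. \<bar>z i\<bar> * U i) \<and>
     (\<forall>\<theta>\<in>\<Theta>. \<bar>w \<theta> - w a - v \<bullet> (c \<theta> - c a)\<bar> \<le> (\<Sum>\<^sub>ai. \<bar>z i\<bar> * U i) * sq_dist \<theta> a)"
  proof (intro exI[of _ V] conjI ballI)
    have "norm V \<le> (\<Sum>\<^sub>ai. norm (z i *\<^sub>R v i))" unfolding V_def by (rule norm_infsetsum_bound)
    also have "\<dots> \<le> (\<Sum>\<^sub>ai. \<bar>z i\<bar> * U i)"
      using abs_summable_on_normI[OF sv] summable v(1)
      by (intro infsetsum_mono) (auto intro!: mult_left_mono)
    finally show "norm V \<le> (\<Sum>\<^sub>ai. \<bar>z i\<bar> * U i)" .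
    fix \<theta> assume \<theta>: "\<theta> \<in> \<Theta>"
    define \<delta> where "\<delta> = c \<theta> - c a"
    have iV: "V \<bullet> \<delta> = (\<Sum>\<^sub>ai. (z i *\<^sub>R v i) \<bullet> \<delta>)"
      using sv unfolding V_def infsetsum_def abs_summable_on_def
      by (intro integral_inner_left[symmetric]) simp
    have svd: "summable_family (\<lambda>i. (z i *\<^sub>R v i) \<bullet> \<delta>)"
      using sv unfolding abs_summable_on_def by (intro integrable_inner_left)
    have "w \<theta> - w a - V \<bullet> \<delta> = (\<Sum>\<^sub>ai. z i * u i \<theta> - z i * u i a - (z i *\<^sub>R v i) \<bullet> \<delta>)"
      unfolding total(2)[OF \<theta>] total(2)[OF a'] iV
      by (simp only: infsetsum_diff[OF abs_summable_on_diff[OF sm[OF \<theta>] sm[OF a']] svd]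
          infsetsum_diff[OF sm[OF \<theta>] sm[OF a']])
    also have "\<dots> = (\<Sum>\<^sub>ai. z i * (u i \<theta> - u i a - v i \<bullet> \<delta>))"
      by (simp add: right_diff_distrib)
    finally have eq: "w \<theta> - w a - V \<bullet> \<delta> = \<dots>" .
    have le: "\<bar>z i * (u i \<theta> - u i a - v i \<bullet> \<delta>)\<bar> \<le> \<bar>z i\<bar> * U i * (norm \<delta>)\<^sup>2" for i
      using mult_left_mono[OF v(2)[OF \<theta>, of i], of "\<bar>z i\<bar>"] by (simp add: abs_mult \<delta>_def mult.assoc)
    have s2: "summable_family (\<lambda>i. \<bar>z i\<bar> * U i * (norm \<delta>)\<^sup>2)"
      using summable by (rule abs_summable_on_cmult_left)
    have "\<bar>w \<theta> - w a - V \<bullet> \<delta>\<bar> \<le> (\<Sum>\<^sub>ai. \<bar>z i * (u i \<theta> - u i a - v i \<bullet> \<delta>)\<bar>)"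
      unfolding eq using norm_infsetsum_bound[of "\<lambda>i. z i * (u i \<theta> - u i a - v i \<bullet> \<delta>)" UNIV] by simp
    also have "\<dots> \<le> (\<Sum>\<^sub>ai. \<bar>z i\<bar> * U i * (norm \<delta>)\<^sup>2)"
    proof (intro infsetsum_mono s2 le)
      show "summable_family (\<lambda>i. \<bar>z i * (u i \<theta> - u i a - v i \<bullet> \<delta>)\<bar>)"
        using s2 by (rule abs_summable_on_comparison_test) (use le U in auto)
    qed
    also have "\<dots> = (\<Sum>\<^sub>ai. \<bar>z i\<bar> * U i) * (norm \<delta>)\<^sup>2"
      using summable by (rule infsetsum_cmult_left)
    finally show "\<bar>w \<theta> - w a - V \<bullet> (c \<theta> - c a)\<bar> \<le> (\<Sum>\<^sub>ai. \<bar>z i\<bar> * U i) * sq_dist \<theta> a"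
      by (simp add: \<delta>_def)
  qed
qed

end

lemma exp_taylor2:
  fixes s t :: real
  assumes "\<bar>s\<bar> \<le> M" "\<bar>t\<bar> \<le> M"
  shows "\<bar>exp s - exp t - exp t * (s - t)\<bar> \<le> exp (3 * M) * (s - t)\<^sup>2"
proof -
  define x where "x = s - t"
  have x: "\<bar>x\<bar> \<le> 2 * M" using assms by (simp add: x_def)
  have lower: "0 \<le> exp x - 1 - x" using exp_ge_add_one_self[of x] by linarith
  have "exp x - 1 - x \<le> x * (exp x - 1)"
  proof -
    have "exp x * (1 - x) \<le> exp x * exp (- x)"
      using exp_ge_add_one_self[of "- x"] by (intro mult_left_mono) auto
    then show ?thesis by (simp add: algebra_simps exp_add[symmetric])
  qed
  also have "\<dots> \<le> x\<^sup>2 * exp (2 * M)"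
  proof (cases "0 \<le> x")
    case True
    have "exp x * (1 - x) \<le> exp x * exp (- x)"
      using exp_ge_add_one_self[of "- x"] by (intro mult_left_mono) auto
    then have "exp x - 1 \<le> x * exp x" by (simp add: algebra_simps exp_add[symmetric])
    also have "\<dots> \<le> x * exp (2 * M)" using True x by (intro mult_left_mono) auto
    finally have "x * (exp x - 1) \<le> x * (x * exp (2 * M))" using True by (intro mult_left_mono) auto
    then show ?thesis by (simp add: power2_eq_square mult.assoc)
  next
    case False
    have "x \<le> exp x - 1" using exp_ge_add_one_self[of x] by linarith
    moreover have "x \<le> 0" using False by simp
    ultimately have "x * (exp x - 1) \<le> x * x" by (rule mult_left_mono_neg)
    also have "\<dots> \<le> x\<^sup>2 * exp (2 * M)" using x by (simp add: power2_eq_square mult_le_cancel_left1)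
    finally show ?thesis .
  qed
  finally have upper: "exp x - 1 - x \<le> x\<^sup>2 * exp (2 * M)" .
  have "exp s - exp t - exp t * (s - t) = exp t * (exp x - 1 - x)"
    by (simp add: x_def algebra_simps exp_add[symmetric])
  then have "\<bar>exp s - exp t - exp t * (s - t)\<bar> = exp t * (exp x - 1 - x)" using lower by simp
  also have "\<dots> \<le> exp M * (x\<^sup>2 * exp (2 * M))"
    using assms upper lower by (intro mult_mono) auto
  also have "\<dots> = exp (3 * M) * x\<^sup>2" by (simp add: exp_add[symmetric] mult_ac)
  finally show ?thesis by (simp add: x_def)
qed

lemma ln_taylor2:
  fixes s t m :: real
  assumes "0 < m" "m \<le> s" "m \<le> t"
  shows "\<bar>ln s - ln t - inverse t * (s - t)\<bar> \<le> inverse (m\<^sup>2) * (s - t)\<^sup>2"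
proof -
  have st: "0 < s" "0 < t" using assms by auto
  have 1: "ln s - ln t \<le> (s - t) / t"
    using ln_le_minus_one[of "s / t"] st by (simp add: ln_div diff_divide_distrib)
  have 2: "(s - t) / s \<le> ln s - ln t"
    using ln_le_minus_one[of "t / s"] st by (simp add: ln_div diff_divide_distrib)
  have "\<bar>ln s - ln t - inverse t * (s - t)\<bar> \<le> (s - t) / t - (s - t) / s"
    using 1 2 by (simp add: divide_inverse mult.commute)
  also have "\<dots> = (s - t)\<^sup>2 / (s * t)" using st by (simp add: field_simps power2_eq_square)
  also have "\<dots> \<le> (s - t)\<^sup>2 / m\<^sup>2"
    using assms st by (intro divide_left_mono) (auto simp: power2_eq_square intro!: mult_mono)
  finally show ?thesis by (simp add: divide_inverse mult.commute)
qed

lemma exp_diff_lower: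
  fixes s t R :: real
  assumes "- R \<le> s" "- R \<le> t"
  shows "\<bar>s - t\<bar> \<le> exp R * \<bar>exp s - exp t\<bar>"
proof -
  have *: "x - y \<le> exp R * (exp x - exp y)" if "y \<le> x" "- R \<le> y" for x y :: real
  proof -
    have "exp x - exp y = exp y * (exp (x - y) - 1)" by (simp add: algebra_simps exp_diff)
    moreover have "x - y \<le> exp (x - y) - 1" using exp_ge_add_one_self[of "x - y"] by linarith
    then have "exp (- R) * (x - y) \<le> exp y * (exp (x - y) - 1)"
      by (rule mult_mono[rotated]) (use that in auto)
    ultimately have "exp R * (exp (- R) * (x - y)) \<le> exp R * (exp x - exp y)"
      by (intro mult_left_mono) auto
    then show ?thesis by (simp add: mult.assoc[symmetric] mult_exp_exp)
  qed
  show ?thesis using *[of t s] *[of s t] assms by (cases "t \<le> s") auto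
qed

text \<open>The coordinates in which polynomials have explicit unbiased estimators, in the Gaussian and in the
  Poisson model alike.\<close>

definition chart :: "real ^ 'd::finite \<Rightarrow> real ^ 'd" where
  "chart \<theta> = (\<chi> l. exp (\<theta> $ l))"

text \<open>
  The factor of the density that is free of the parameter, written as the density at the reference
  parameter 0 (Gaussian) or 1 (Poisson); the factor \<open>exp 1\<close> removes the normalization at 1.
\<close>

definition base_weight :: "'d::finite set \<Rightarrow> real ^ 'd \<Rightarrow> real" where
  "base_weight B x = (\<Prod>l\<in>UNIV. coord_density B l (if l \<in> B then 0 else 1) (x $ l) * (if l \<in> B then 1 else exp 1))"

definition tilt :: "'d::finite set \<Rightarrow> 'd \<Rightarrow> real \<Rightarrow> real \<Rightarrow> real" where
  "tilt B l t x = (if l \<in> B then exp (t * x) else t ^ nat \<lfloor>x\<rfloor>)"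

definition log_partition :: "'d::finite set \<Rightarrow> 'd \<Rightarrow> real \<Rightarrow> real" where
  "log_partition B l t = (if l \<in> B then t\<^sup>2 / 2 else t)"

definition tilt_coeff :: "'d::finite set \<Rightarrow> 'd \<Rightarrow> nat \<Rightarrow> real \<Rightarrow> real" where
  "tilt_coeff B l k x = (if l \<in> B then x ^ k / fact k else if nat \<lfloor>x\<rfloor> = k then 1 else 0)"

lemma borel_measurable_tilt [measurable]: "tilt B l t \<in> borel_measurable borel"
  unfolding tilt_def[abs_def] by measurable

lemma borel_measurable_tilt_coeff [measurable]: "tilt_coeff B l k \<in> borel_measurable borel"
  unfolding tilt_coeff_def[abs_def] by measurable

lemma borel_measurable_base_weight [measurable]: "base_weight B \<in> borel_measurable borel"
  unfolding base_weight_def[abs_def] by measurable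

lemma coord_density_tilt:
  "coord_density B l t x = exp (- log_partition B l t) * tilt B l t x *
     (coord_density B l (if l \<in> B then 0 else 1) x * (if l \<in> B then 1 else exp 1))"
proof (cases "l \<in> B")
  case True
  have "exp (- (x - t)\<^sup>2 / 2) = exp (- (t\<^sup>2 / 2)) * exp (t * x) * exp (- x\<^sup>2 / 2)"
    by (simp add: mult_exp_exp power2_eq_square field_simps)
  then show ?thesis using True
    by (simp add: coord_density_def log_partition_def tilt_def std_normal_density_def)
next
  case False
  then show ?thesis
    by (simp add: coord_density_def log_partition_def tilt_def poisson_density_def mult_exp_exp)
qed

lemma product_density_tilt:
  "product_density B \<theta> x = exp (- (\<Sum>l\<in>UNIV. log_partition B l (\<theta> $ l))) *
     (base_weight B x * (\<Prod>l\<in>UNIV. tilt B l (\<theta> $ l) (x $ l)))"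
  unfolding product_density_eq base_weight_def
  by (subst coord_density_tilt) (simp add: prod.distrib exp_sum sum_negf[symmetric] mult_ac)

lemma base_weight_nonneg: "0 \<le> base_weight B x"
  unfolding base_weight_def by (intro prod_nonneg mult_nonneg_nonneg coord_density_nonneg) auto

lemma tilt_expansion:
  "summable_family (\<lambda>k. t ^ k * tilt_coeff B l k x)"
  "(\<Sum>\<^sub>ak. t ^ k * tilt_coeff B l k x) = tilt B l t x"
proof -
  have "summable_family (\<lambda>k. t ^ k * tilt_coeff B l k x) \<and>
    (\<Sum>\<^sub>ak. t ^ k * tilt_coeff B l k x) = tilt B l t x"
  proof (cases "l \<in> B")
    case True
    have eq: "t ^ k * tilt_coeff B l k x = (t * x) ^ k /\<^sub>R fact k" for k
      using True by (simp add: tilt_coeff_def power_mult_distrib divide_inverse mult_ac)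
    have "summable_family (\<lambda>k. (t * x) ^ k /\<^sub>R fact k)"
      unfolding abs_summable_on_nat_iff' using summable_norm_exp[of "t * x"] by simp
    moreover from this have "(\<Sum>\<^sub>ak. (t * x) ^ k /\<^sub>R fact k) = exp (t * x)"
      by (subst infsetsum_nat') (auto simp: exp_def)
    ultimately show ?thesis using True by (simp add: eq tilt_def)
  next
    case False
    define m where "m = nat \<lfloor>x\<rfloor>"
    have "summable_family (\<lambda>k. t ^ k * tilt_coeff B l k x) \<longleftrightarrow>
        Infinite_Set_Sum.abs_summable_on (\<lambda>k. t ^ k * tilt_coeff B l k x) {m}"
      using False by (intro abs_summable_on_cong_neutral) (auto simp: tilt_coeff_def m_def)
    moreover have "(\<Sum>\<^sub>ak. t ^ k * tilt_coeff B l k x) = (\<Sum>\<^sub>ak\<in>{m}. t ^ k * tilt_coeff B l k x)"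
      using False by (intro infsetsum_cong_neutral) (auto simp: tilt_coeff_def m_def)
    ultimately show ?thesis using False by (simp add: tilt_coeff_def tilt_def m_def)
  qed
  then show "summable_family (\<lambda>k. t ^ k * tilt_coeff B l k x)"
    "(\<Sum>\<^sub>ak. t ^ k * tilt_coeff B l k x) = tilt B l t x" by auto
qed

text \<open>
  A bound for the tilts and for all terms of their expansion. The absolute value is taken in the Gaussian
  case only: for a Poisson coordinate the floor of a negative number is truncated to 0, which
  the absolute value would undo.
\<close>

definition tilt_envelope :: "'d::finite set \<Rightarrow> 'd \<Rightarrow> real \<Rightarrow> real \<Rightarrow> real" where
  "tilt_envelope B l K x = tilt B l K (if l \<in> B then \<bar>x\<bar> else x)"

lemma borel_measurable_tilt_envelope [measurable]: "tilt_envelope B l K \<in> borel_measurable borel"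
  unfolding tilt_envelope_def[abs_def] by measurable

lemma tilt_envelope_nonneg: "0 \<le> K \<Longrightarrow> 0 \<le> tilt_envelope B l K x"
  by (simp add: tilt_envelope_def tilt_def)

lemma tilt_coeff_le_envelope:
  assumes K: "0 \<le> K"
  shows "K ^ k * \<bar>tilt_coeff B l k x\<bar> \<le> tilt_envelope B l K x"
proof (cases "l \<in> B")
  case True
  have "(K * \<bar>x\<bar>) ^ k /\<^sub>R fact k = (\<Sum>n\<in>{k}. (K * \<bar>x\<bar>) ^ n /\<^sub>R fact n)" by simp
  also have "\<dots> \<le> (\<Sum>n. (K * \<bar>x\<bar>) ^ n /\<^sub>R fact n)"
    using K by (intro sum_le_suminf summable_exp_generic) auto
  also have "\<dots> = exp (K * \<bar>x\<bar>)" by (simp add: exp_def)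
  finally show ?thesis using True
    by (simp add: tilt_coeff_def tilt_envelope_def tilt_def power_mult_distrib divide_inverse
        power_abs mult_ac abs_mult)
next
  case False
  then show ?thesis using K by (auto simp: tilt_coeff_def tilt_envelope_def tilt_def)
qed

lemma tilt_le_envelope:
  assumes "\<bar>t\<bar> \<le> K" "l \<in> B \<or> 0 \<le> t"
  shows "0 \<le> tilt B l t x" "tilt B l t x \<le> tilt_envelope B l K x"
proof -
  show "0 \<le> tilt B l t x" using assms by (auto simp: tilt_def)
  have "t * x \<le> \<bar>t\<bar> * \<bar>x\<bar>" by (metis abs_ge_self abs_mult)
  also have "\<dots> \<le> K * \<bar>x\<bar>" using assms(1) by (intro mult_right_mono) auto
  finally show "tilt B l t x \<le> tilt_envelope B l K x"
    using assms by (auto simp: tilt_def tilt_envelope_def intro: power_mono)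
qed

lemma tilt_envelope_exponential:
  assumes "0 \<le> K" shows "\<exists>\<kappa>\<ge>0. \<forall>x. tilt_envelope B l K x \<le> exp (\<kappa> * \<bar>x\<bar>)"
proof (cases "l \<in> B")
  case True
  then show ?thesis using assms by (intro exI[of _ K]) (simp add: tilt_envelope_def tilt_def)
next
  case False
  have "K ^ nat \<lfloor>x\<rfloor> \<le> exp (ln (1 + K) * \<bar>x\<bar>)" for x
    using power_nat_floor_le[of "1 + K" x] power_mono[of K "1 + K" "nat \<lfloor>x\<rfloor>"] assms by linarith
  then show ?thesis using assms False
    by (intro exI[of _ "ln (1 + K)"]) (simp add: tilt_envelope_def tilt_def)
qed

lemma inverse_tilt_exponential:
  assumes "l \<in> B \<or> 0 < t" shows "\<exists>\<kappa>\<ge>0. \<forall>x. inverse (tilt B l t x) \<le> exp (\<kappa> * \<bar>x\<bar>)"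
proof (cases "l \<in> B")
  case True
  have "- (t * x) \<le> \<bar>t\<bar> * \<bar>x\<bar>" for x by (metis abs_ge_minus_self abs_mult)
  then show ?thesis using True
    by (intro exI[of _ "\<bar>t\<bar>"]) (simp add: tilt_def exp_minus[symmetric])
next
  case False
  with assms have t: "0 < t" by simp
  have "inverse t ^ nat \<lfloor>x\<rfloor> \<le> exp (ln (1 + inverse t) * \<bar>x\<bar>)" for x
    using power_nat_floor_le[of "1 + inverse t" x] power_mono[of "inverse t" "1 + inverse t" "nat \<lfloor>x\<rfloor>"] t
    by fastforce
  then show ?thesis using False t
    by (intro exI[of _ "ln (1 + inverse t)"]) (simp add: tilt_def power_inverse)
qed

locale finite_mixture_model =
  fixes B :: "'d::finite set" and \<Theta> S :: "(real ^ 'd) set" and g0 :: "(real ^ 'd) measure" and R :: real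
  assumes domain: "\<Theta> \<subseteq> parameter_domain B"
    and g0: "g0 \<in> mixing_measures \<Theta>"
    and finite_S: "finite S" and S_AE: "AE \<theta> in g0. \<theta> \<in> S"
    and S_pos: "\<And>a. a \<in> S \<Longrightarrow> 0 < measure g0 {a}"
    and S_sub: "S \<subseteq> \<Theta>" and S_nonempty: "S \<noteq> {}"
    and \<Theta>_bound: "\<And>\<theta> l. \<theta> \<in> \<Theta> \<Longrightarrow> \<bar>\<theta> $ l\<bar> \<le> R"
begin

lemma R_nonneg: "0 \<le> R"
  using \<Theta>_bound S_sub S_nonempty by (meson abs_ge_zero equals0I order_trans subsetD)

lemma chart_norm:
  assumes "\<theta> \<in> \<Theta>" "\<eta> \<in> \<Theta>"
  shows "norm (chart \<theta> - chart \<eta>) \<le> CARD('d) * exp R"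
proof -
  have "norm (chart \<theta> - chart \<eta>) \<le> (\<Sum>l\<in>UNIV. \<bar>exp (\<theta> $ l) - exp (\<eta> $ l)\<bar>)"
    using norm_le_l1_cart[of "chart \<theta> - chart \<eta>"] by (simp add: chart_def)
  also have "\<dots> \<le> (\<Sum>l\<in>(UNIV :: 'd set). exp R)"
  proof (intro sum_mono)
    fix l
    have "exp (\<theta> $ l) \<le> exp R" "exp (\<eta> $ l) \<le> exp R"
      using \<Theta>_bound[OF assms(1), of l] \<Theta>_bound[OF assms(2), of l] by auto
    moreover have "0 < exp (\<theta> $ l)" "0 < exp (\<eta> $ l)" by auto
    ultimately show "\<bar>exp (\<theta> $ l) - exp (\<eta> $ l)\<bar> \<le> exp R" by linarith
  qed
  finally show ?thesis by simp
qed

lemma chart_inverse_lipschitz: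
  assumes "\<theta> \<in> \<Theta>" "\<eta> \<in> \<Theta>"
  shows "norm (\<theta> - \<eta>) \<le> (CARD('d) * exp R) * norm (chart \<theta> - chart \<eta>)"
proof -
  have "norm (\<theta> - \<eta>) \<le> (\<Sum>l\<in>UNIV. \<bar>\<theta> $ l - \<eta> $ l\<bar>)"
    using norm_le_l1_cart[of "\<theta> - \<eta>"] by simp
  also have "\<dots> \<le> (\<Sum>l\<in>(UNIV :: 'd set). exp R * norm (chart \<theta> - chart \<eta>))"
  proof (intro sum_mono)
    fix l
    have "\<bar>\<theta> $ l - \<eta> $ l\<bar> \<le> exp R * \<bar>exp (\<theta> $ l) - exp (\<eta> $ l)\<bar>"
      using \<Theta>_bound[OF assms(1), of l] \<Theta>_bound[OF assms(2), of l] by (intro exp_diff_lower) auto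
    also have "\<dots> \<le> exp R * norm (chart \<theta> - chart \<eta>)"
      using component_le_norm_cart[of "chart \<theta> - chart \<eta>" l] by (intro mult_left_mono) (auto simp: chart_def)
    finally show "\<bar>\<theta> $ l - \<eta> $ l\<bar> \<le> exp R * norm (chart \<theta> - chart \<eta>)" .
  qed
  finally show ?thesis by (simp add: mult.assoc)
qed

sublocale embedded_nodes chart \<Theta> S "CARD('d) * exp R" "CARD('d) * exp R"
proof
  show "chart \<in> borel_measurable borel"
    unfolding chart_def
    by (intro borel_measurable_continuous_onI continuous_on_vec_lambda continuous_intros)
  show "inj_on chart S" by (auto simp: inj_on_def chart_def vec_eq_iff)
  show "norm (chart \<theta> - chart a) \<le> CARD('d) * exp R" if "\<theta> \<in> \<Theta>" "a \<in> S" for \<theta> a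
    using chart_norm[OF that(1) subsetD[OF S_sub that(2)]] .
  show "norm (\<theta> - a) \<le> (CARD('d) * exp R) * norm (chart \<theta> - chart a)" if "\<theta> \<in> \<Theta>" "a \<in> S" for \<theta> a
    using chart_inverse_lipschitz[OF that(1) subsetD[OF S_sub that(2)]] .
qed (fact S_sub finite_S S_nonempty)+

lemma polynomials_exponential_sums: "Q \<in> polynomials \<Longrightarrow> Q \<in> exponential_sums"
proof (induction rule: polynomials.induct)
  case (coord e)
  then obtain i where "e = axis i 1" by (auto simp: Basis_vec_def)
  then have "(\<lambda>\<theta>. chart \<theta> \<bullet> e) = (\<lambda>\<theta>. exp (\<theta> $ i))" by (auto simp: inner_axis chart_def)
  then show ?case using exponential_sums_coord[of i] by simp
qed (auto intro: exponential_sums_const exponential_sums.add exponential_sums_mult)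

definition weight :: "real ^ 'd \<Rightarrow> real" where
  "weight a = measure g0 {a}"

definition f0 :: "real ^ 'd \<Rightarrow> real" where
  "f0 = mixture_density B g0"

lemma prob_g0: "prob_space g0" and sets_g0: "sets g0 = sets borel"
  using g0 by (auto simp: mixing_measures_def)

lemma f0_eq: "f0 x = (\<Sum>a\<in>S. weight a * product_density B a x)"
proof -
  interpret prob_space g0 by (rule prob_g0)
  have sing: "{a} \<in> sets g0" for a by (simp add: sets_g0)
  have "(\<integral>\<theta>. product_density B \<theta> x \<partial>g0)
      = (\<integral>\<theta>. (\<Sum>a\<in>S. product_density B a x * indicator {a} \<theta>) \<partial>g0)"
  proof (rule integral_cong_AE)
    show "AE \<theta> in g0. product_density B \<theta> x = (\<Sum>a\<in>S. product_density B a x * indicator {a} \<theta>)"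
      using S_AE
    proof eventually_elim
      case (elim \<theta>)
      have "(\<Sum>a\<in>S. product_density B a x * indicator {a} \<theta>) = (\<Sum>a\<in>S. if a = \<theta> then product_density B a x else 0)"
        by (intro sum.cong) (auto simp: indicator_def)
      then show ?case using elim finite_S by simp
    qed
    show "(\<lambda>\<theta>. product_density B \<theta> x) \<in> borel_measurable g0"
    proof -
      have "(\<lambda>t. coord_density B l t y) \<in> borel_measurable borel" for l y
        unfolding coord_density_def poisson_density_def by measurable
      then have "(\<lambda>\<theta>. product_density B \<theta> x) \<in> borel_measurable borel"
        unfolding product_density_eq by measurable
      then show ?thesis using measurable_cong_sets[OF sets_g0 refl] by blast
    qed
    show "(\<lambda>\<theta>. \<Sum>a\<in>S. product_density B a x * indicator {a} \<theta>) \<in> borel_measurable g0"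
      using sing by measurable
  qed
  also have "\<dots> = (\<Sum>a\<in>S. product_density B a x * measure g0 {a})"
    using sing sets_eq_imp_space_eq[OF sets_g0]
    by (subst Bochner_Integration.integral_sum)
       (auto simp: emeasure_eq_measure intro!: integrable_mult_right integrable_real_indicator)
  finally show ?thesis by (simp add: f0_def mixture_density_def weight_def mult.commute)
qed

lemma weight_pos: "a \<in> S \<Longrightarrow> 0 < weight a"
  using S_pos by (simp add: weight_def)

lemma \<Theta>_domain: "\<theta> \<in> \<Theta> \<Longrightarrow> \<theta> \<in> parameter_domain B"
  using domain by auto

lemma S_domain: "a \<in> S \<Longrightarrow> a \<in> parameter_domain B"
  using S_sub domain by auto

lemma borel_measurable_f0 [measurable]: "f0 \<in> borel_measurable borel"
  unfolding f0_eq[abs_def] by measurable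

lemma f0_nonneg: "0 \<le> f0 x"
  unfolding f0_eq using weight_pos S_domain
  by (intro sum_nonneg mult_nonneg_nonneg product_density_nonneg) (auto intro: less_imp_le)

lemma f0_ge: "a \<in> S \<Longrightarrow> weight a * product_density B a x \<le> f0 x"
  unfolding f0_eq using weight_pos S_domain finite_S
  by (intro member_le_sum[of a S "\<lambda>a. weight a * product_density B a x"] mult_nonneg_nonneg product_density_nonneg)
     (auto intro: less_imp_le)

lemma tilt_pos: "\<theta> \<in> parameter_domain B \<Longrightarrow> 0 < tilt B l (\<theta> $ l) x"
  by (auto simp: parameter_domain_def tilt_def)

lemma product_density_pos_iff:
  assumes "\<theta> \<in> parameter_domain B"
  shows "0 < product_density B \<theta> x \<longleftrightarrow> base_weight B x \<noteq> 0"
proof -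
  have "0 < (\<Prod>l\<in>UNIV. tilt B l (\<theta> $ l) (x $ l))" using tilt_pos[OF assms] by (intro prod_pos) auto
  then show ?thesis using base_weight_nonneg[of B x]
    by (auto simp: product_density_tilt zero_less_mult_iff less_le)
qed

lemma f0_pos_iff: "0 < f0 x \<longleftrightarrow> base_weight B x \<noteq> 0"
proof
  assume "base_weight B x \<noteq> 0"
  obtain a where a: "a \<in> S" using S_nonempty by auto
  have "0 < weight a * product_density B a x"
    using weight_pos[OF a] product_density_pos_iff[OF S_domain[OF a]] \<open>base_weight B x \<noteq> 0\<close> by simp
  then show "0 < f0 x" using f0_ge[OF a, of x] by linarith
next
  assume "0 < f0 x"
  then show "base_weight B x \<noteq> 0"
    by (auto simp: f0_eq product_density_tilt)
qed

definition ratio :: "real ^ 'd \<Rightarrow> real ^ 'd \<Rightarrow> real" where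
  "ratio \<theta> x = product_density B \<theta> x / f0 x"

definition normalizer :: "real ^ 'd \<Rightarrow> real" where
  "normalizer \<theta> = exp (- (\<Sum>l\<in>UNIV. log_partition B l (\<theta> $ l)))"

definition monomial :: "('d \<Rightarrow> nat) \<Rightarrow> real ^ 'd \<Rightarrow> real" where
  "monomial \<alpha> \<theta> = (\<Prod>l\<in>UNIV. (\<theta> $ l) ^ \<alpha> l)"

abbreviation deg :: "('d \<Rightarrow> nat) \<Rightarrow> nat" where
  "deg \<alpha> \<equiv> (\<Sum>l\<in>UNIV. \<alpha> l)"

text \<open>
  The coefficients of \<open>ratio \<theta> x\<close> as a power series in \<open>\<theta>\<close>, up to the factor \<open>normalizer \<theta>\<close>. Where
  \<open>f0\<close> vanishes, so does \<open>base_weight B\<close>, and \<open>kernel\<close> and \<open>ratio\<close> are zero there.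
\<close>

definition kernel :: "('d \<Rightarrow> nat) \<Rightarrow> real ^ 'd \<Rightarrow> real" where
  "kernel \<alpha> x = base_weight B x / f0 x * (\<Prod>l\<in>UNIV. tilt_coeff B l (\<alpha> l) (x $ l))"

definition envelope :: "real \<Rightarrow> real ^ 'd \<Rightarrow> real" where
  "envelope K x = base_weight B x / f0 x * (\<Prod>l\<in>UNIV. tilt_envelope B l K (x $ l))"

lemma borel_measurable_kernel [measurable]: "kernel \<alpha> \<in> borel_measurable borel"
  unfolding kernel_def[abs_def] by measurable

lemma borel_measurable_envelope [measurable]: "envelope K \<in> borel_measurable borel"
  unfolding envelope_def[abs_def] by measurable

lemma borel_measurable_ratio [measurable]: "ratio \<theta> \<in> borel_measurable borel"
  unfolding ratio_def[abs_def] by measurable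

lemma borel_measurable_ratio_parameter [measurable]: "(\<lambda>\<theta>. ratio \<theta> x) \<in> borel_measurable borel"
proof -
  have "(\<lambda>t. coord_density B l t y) \<in> borel_measurable borel" for l y
    unfolding coord_density_def poisson_density_def by measurable
  then show ?thesis unfolding ratio_def product_density_eq by measurable
qed

lemma weight_ratio_nonneg: "0 \<le> base_weight B x / f0 x"
  using base_weight_nonneg f0_nonneg by (intro divide_nonneg_nonneg)

lemma ratio_eq: "ratio \<theta> x = normalizer \<theta> * (base_weight B x / f0 x * (\<Prod>l\<in>UNIV. tilt B l (\<theta> $ l) (x $ l)))"
  by (simp add: ratio_def product_density_tilt normalizer_def)

theorem ratio_expansion:
  shows "summable_family (\<lambda>\<alpha>. monomial \<alpha> \<theta> * kernel \<alpha> x)"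
    and "ratio \<theta> x = normalizer \<theta> * (\<Sum>\<^sub>a\<alpha>. monomial \<alpha> \<theta> * kernel \<alpha> x)"
proof -
  let ?f = "\<lambda>l k. (\<theta> $ l) ^ k * tilt_coeff B l k (x $ l)"
  have eq: "monomial \<alpha> \<theta> * kernel \<alpha> x = base_weight B x / f0 x * (\<Prod>l\<in>UNIV. ?f l (\<alpha> l))" for \<alpha>
    by (simp add: monomial_def kernel_def prod.distrib)
  have P: "PiE (UNIV :: 'd set) (\<lambda>_. UNIV :: nat set) = UNIV" by auto
  have s: "summable_family (\<lambda>\<alpha>. \<Prod>l\<in>UNIV. ?f l (\<alpha> l))"
    using abs_summable_on_prod_PiE[of UNIV "\<lambda>_. UNIV" ?f] tilt_expansion(1) unfolding P by auto
  then show "summable_family (\<lambda>\<alpha>. monomial \<alpha> \<theta> * kernel \<alpha> x)"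
    unfolding eq by (rule abs_summable_on_cmult_right)
  have "(\<Sum>\<^sub>a\<alpha>. \<Prod>l\<in>UNIV. ?f l (\<alpha> l)) = (\<Prod>l\<in>UNIV. tilt B l (\<theta> $ l) (x $ l))"
    using infsetsum_prod_PiE[of UNIV "\<lambda>_. UNIV" ?f, OF finite_class.finite_UNIV countableI_type tilt_expansion(1)]
    unfolding P tilt_expansion(2) .
  then show "ratio \<theta> x = normalizer \<theta> * (\<Sum>\<^sub>a\<alpha>. monomial \<alpha> \<theta> * kernel \<alpha> x)"
    unfolding eq ratio_eq using s by (subst infsetsum_cmult_right) auto
qed

text \<open>
  As \<open>K\<close> is arbitrary, the coefficients decrease faster than any geometric sequence
  in the degree, with an exponentially bounded factor.
\<close>

lemma kernel_le_envelope:
  assumes "0 < K" shows "\<bar>kernel \<alpha> x\<bar> \<le> inverse K ^ deg \<alpha> * envelope K x"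
proof -
  have "K ^ deg \<alpha> * \<bar>kernel \<alpha> x\<bar>
      = base_weight B x / f0 x * (\<Prod>l\<in>UNIV. K ^ \<alpha> l * \<bar>tilt_coeff B l (\<alpha> l) (x $ l)\<bar>)"
    unfolding kernel_def abs_mult[of "base_weight B x / f0 x"] abs_of_nonneg[OF weight_ratio_nonneg]
    by (simp add: abs_prod prod.distrib power_sum mult_ac)
  also have "\<dots> \<le> envelope K x"
    unfolding envelope_def using assms weight_ratio_nonneg
    by (intro mult_left_mono prod_mono conjI tilt_coeff_le_envelope) auto
  finally show ?thesis using assms by (simp add: power_inverse field_simps)
qed

lemma envelope_nonneg: "0 \<le> K \<Longrightarrow> 0 \<le> envelope K x"
  unfolding envelope_def using weight_ratio_nonneg
  by (intro mult_nonneg_nonneg prod_nonneg tilt_envelope_nonneg) auto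

lemma ratio_nonneg: "\<theta> \<in> \<Theta> \<Longrightarrow> 0 \<le> ratio \<theta> x"
  unfolding ratio_def using product_density_nonneg[OF \<Theta>_domain] f0_nonneg
  by (intro divide_nonneg_nonneg)

lemma ratio_le_envelope:
  assumes \<theta>: "\<theta> \<in> \<Theta>" shows "ratio \<theta> x \<le> envelope R x"
proof -
  have dom: "l \<in> B \<or> 0 \<le> \<theta> $ l" for l using \<Theta>_domain[OF \<theta>] by (auto simp: parameter_domain_def less_imp_le)
  have "0 \<le> log_partition B l (\<theta> $ l)" for l using dom[of l] by (auto simp: log_partition_def)
  then have n: "normalizer \<theta> \<le> 1" unfolding normalizer_def by (simp add: sum_nonneg)
  have "(\<Prod>l\<in>UNIV. tilt B l (\<theta> $ l) (x $ l)) \<le> (\<Prod>l\<in>UNIV. tilt_envelope B l R (x $ l))"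
    using tilt_le_envelope[OF \<Theta>_bound[OF \<theta>] dom] by (intro prod_mono) auto
  then have "base_weight B x / f0 x * (\<Prod>l\<in>UNIV. tilt B l (\<theta> $ l) (x $ l)) \<le> envelope R x"
    unfolding envelope_def using weight_ratio_nonneg by (intro mult_left_mono)
  moreover have "normalizer \<theta> * (base_weight B x / f0 x * (\<Prod>l\<in>UNIV. tilt B l (\<theta> $ l) (x $ l)))
      \<le> 1 * (base_weight B x / f0 x * (\<Prod>l\<in>UNIV. tilt B l (\<theta> $ l) (x $ l)))"
    using n weight_ratio_nonneg tilt_le_envelope(1)[OF \<Theta>_bound[OF \<theta>] dom]
    by (intro mult_right_mono mult_nonneg_nonneg prod_nonneg) auto
  ultimately show ?thesis unfolding ratio_eq by linarith
qed

text \<open>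
  One atom of \<open>g0\<close> suffices: \<open>f0\<close> is at least a multiple of the density at that atom, which is
  \<open>base_weight\<close> times a tilt, and the inverse of a tilt is exponentially bounded.
\<close>

lemma exp_bounded_weight_ratio: "exp_bounded (\<lambda>x. base_weight B x / f0 x)"
proof -
  obtain a where a: "a \<in> S" using S_nonempty by auto
  define t where "t x = (\<Prod>l\<in>UNIV. inverse (tilt B l (a $ l) (x $ l)))" for x :: "real ^ 'd"
  have tpos: "0 < inverse (tilt B l (a $ l) y)" for l y using tilt_pos[OF S_domain[OF a]] by simp
  have "exp_bounded (\<lambda>x :: real ^ 'd. inverse (tilt B l (a $ l) (x $ l)))" for l
  proof -
    obtain \<kappa> where \<kappa>: "\<kappa> \<ge> 0" "\<And>x. inverse (tilt B l (a $ l) x) \<le> exp (\<kappa> * \<bar>x\<bar>)"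
      using inverse_tilt_exponential[of l B "a $ l"] S_domain[OF a] by (auto simp: parameter_domain_def)
    have "\<bar>inverse (tilt B l (a $ l) x)\<bar> \<le> 1 * exp (\<kappa> * \<bar>x\<bar>)" for x
      using \<kappa>(2)[of x] tpos[of l x] by simp
    then show ?thesis using \<kappa>(1) by (rule exp_bounded_coord)
  qed
  then have "exp_bounded t" unfolding t_def[abs_def] by (intro exp_bounded_prod) auto
  then have "exp_bounded (\<lambda>x. inverse (weight a * normalizer a) * t x)"
    by (intro exp_bounded_mult exp_bounded_const)
  then show ?thesis
  proof (rule exp_bounded_mono)
    fix x
    define w where "w = weight a * normalizer a"
    define T where "T = (\<Prod>l\<in>UNIV. tilt B l (a $ l) (x $ l))"
    have w: "0 < w" using weight_pos[OF a] by (simp add: w_def normalizer_def)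
    have T: "0 < T" unfolding T_def using tilt_pos[OF S_domain[OF a]] by (intro prod_pos) auto
    have t: "t x = inverse T"
      using prod_inversef[of "\<lambda>l. tilt B l (a $ l) (x $ l)" UNIV] by (simp add: t_def T_def o_def)
    have le: "w * T * base_weight B x \<le> f0 x"
      using f0_ge[OF a, of x] by (simp add: product_density_tilt normalizer_def w_def T_def mult_ac)
    have "base_weight B x / f0 x \<le> inverse w * t x"
    proof (cases "f0 x = 0")
      case True
      then show ?thesis using w T t by simp
    next
      case False
      then have "0 < f0 x" using f0_nonneg[of x] by simp
      then show ?thesis using w T le by (simp add: t field_simps)
    qed
    then have "base_weight B x / f0 x \<le> inverse (weight a * normalizer a) * t x"
      by (simp only: w_def)
    then show "\<bar>base_weight B x / f0 x\<bar> \<le> \<bar>inverse (weight a * normalizer a) * t x\<bar>"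
      using weight_ratio_nonneg[of x] by linarith
  qed
qed

lemma exp_bounded_envelope:
  assumes "0 \<le> K" shows "exp_bounded (envelope K)"
proof -
  have "exp_bounded (\<lambda>x :: real ^ 'd. tilt_envelope B l K (x $ l))" for l
  proof -
    obtain \<kappa> where \<kappa>: "\<kappa> \<ge> 0" "\<And>x. tilt_envelope B l K x \<le> exp (\<kappa> * \<bar>x\<bar>)"
      using tilt_envelope_exponential[OF assms] by blast
    have "\<bar>tilt_envelope B l K x\<bar> \<le> 1 * exp (\<kappa> * \<bar>x\<bar>)" for x
      using \<kappa>(2)[of x] tilt_envelope_nonneg[OF assms, of B l x] by simp
    then show ?thesis using \<kappa>(1) by (rule exp_bounded_coord)
  qed
  then show ?thesis unfolding envelope_def[abs_def]
    by (intro exp_bounded_mult exp_bounded_weight_ratio exp_bounded_prod) auto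
qed

text \<open>
  The parameter itself is the logarithm of a chart coordinate, and the logarithm is smooth on the compact
  interval that the chart coordinates of a bounded parameter set fill.
\<close>

lemma parameter_jet_bounded: "\<exists>U\<ge>1. \<forall>l. jet_bounded U (\<lambda>\<theta>. \<theta> $ l)"
proof -
  have ex: "\<exists>V. jet_bounded V (\<lambda>\<theta>. \<theta> $ l)" for l
  proof -
    have e: "axis l 1 \<in> (Basis :: (real ^ 'd) set)" by simp
    obtain U where U: "jet_bounded U (\<lambda>\<theta>. chart \<theta> \<bullet> axis l 1)"
      using polynomials_jet_bounded[OF polynomials.coord[OF e]] by blast
    define K where "K = max R (max (exp R) (inverse ((exp (- R))\<^sup>2)))"
    have "\<exists>V. jet_bounded V (\<lambda>\<theta>. ln (chart \<theta> \<bullet> axis l 1))"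
    proof (rule jet_bounded_compose[OF U, where T = "{exp (- R)..exp R}" and K = K and f' = inverse])
      show "chart \<theta> \<bullet> axis l 1 \<in> {exp (- R)..exp R}" if "\<theta> \<in> \<Theta>" for \<theta>
        using \<Theta>_bound[OF that, of l] by (auto simp: inner_axis chart_def)
      show "\<bar>ln s\<bar> \<le> K" if "s \<in> {exp (- R)..exp R}" for s
      proof -
        have s: "0 < s" using that by (auto intro: less_le_trans[OF exp_gt_zero])
        have "ln s \<le> R" "- R \<le> ln s" 
          using that s ln_le_cancel_iff[of s "exp R"] ln_le_cancel_iff[of "exp (- R)" s] by auto
        then show ?thesis by (auto simp: K_def)
      qed
      show "\<bar>inverse s\<bar> \<le> K" if "s \<in> {exp (- R)..exp R}" for s
      proof -
        have s: "0 < s" using that by (auto intro: less_le_trans[OF exp_gt_zero])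
        have "inverse s \<le> inverse (exp (- R))" using that by (intro le_imp_inverse_le) auto
        then show ?thesis using s by (simp add: K_def exp_minus)
      qed
      show "\<bar>ln s - ln t - inverse t * (s - t)\<bar> \<le> K * (s - t)\<^sup>2"
        if "s \<in> {exp (- R)..exp R}" "t \<in> {exp (- R)..exp R}" for s t
      proof -
        have "\<bar>ln s - ln t - inverse t * (s - t)\<bar> \<le> inverse ((exp (- R))\<^sup>2) * (s - t)\<^sup>2"
          using that by (intro ln_taylor2) auto
        also have "\<dots> \<le> K * (s - t)\<^sup>2" by (intro mult_right_mono) (auto simp: K_def)
        finally show ?thesis .
      qed
    qed simp
    then show ?thesis by (simp add: inner_axis chart_def)
  qed
  have "\<exists>U\<ge>0. \<forall>l\<in>UNIV. jet_bounded U (\<lambda>\<theta>. \<theta> $ l)"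
    by (rule finite_uniform_bound) (auto intro: ex jet_bounded_mono)
  then obtain U where "U \<ge> 0" "\<And>l. jet_bounded U (\<lambda>\<theta>. \<theta> $ l)" by auto
  then show ?thesis
    using jet_bounded_mono[of U _ "max 1 U"] by (intro exI[of _ "max 1 U"]) simp
qed

lemma jet_bounded_sum:
  "finite F \<Longrightarrow> (\<And>i. i \<in> F \<Longrightarrow> \<exists>U. jet_bounded U (u i)) \<Longrightarrow> \<exists>U. jet_bounded U (\<lambda>\<theta>. \<Sum>i\<in>F. u i \<theta>)"
proof (induction F rule: finite_induct)
  case empty
  show ?case using jet_bounded_const[of 0 0] by auto
next
  case (insert x F)
  then show ?case using jet_bounded_add by simp blast
qed

lemma normalizer_jet_bounded: "\<exists>U. jet_bounded U normalizer"
proof -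
  obtain U where U: "\<And>l. jet_bounded U (\<lambda>\<theta>. \<theta> $ l)" using parameter_jet_bounded by auto
  have "\<exists>U. jet_bounded U (\<lambda>\<theta>. log_partition B l (\<theta> $ l))" for l
  proof (cases "l \<in> B")
    case True
    have "\<exists>U. jet_bounded U (\<lambda>\<theta>. (1 / 2) * (\<theta> $ l * \<theta> $ l))"
      using jet_bounded_mult[OF jet_bounded_const jet_bounded_mult[OF U U]] by blast
    then show ?thesis using True by (simp add: log_partition_def power2_eq_square)
  next
    case False
    then show ?thesis using U by (auto simp: log_partition_def)
  qed
  then obtain V where V: "jet_bounded V (\<lambda>\<theta>. \<Sum>l\<in>UNIV. log_partition B l (\<theta> $ l))"
    using jet_bounded_sum[of UNIV "\<lambda>l \<theta>. log_partition B l (\<theta> $ l)"] by auto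
  obtain V' where V': "jet_bounded V' (\<lambda>\<theta>. (- 1) * (\<Sum>l\<in>UNIV. log_partition B l (\<theta> $ l)))"
    using jet_bounded_mult[OF jet_bounded_const V] by blast
  have "\<exists>W. jet_bounded W (\<lambda>\<theta>. exp ((- 1) * (\<Sum>l\<in>UNIV. log_partition B l (\<theta> $ l))))"
  proof (rule jet_bounded_compose[OF V', where T = "{- V'..V'}" and K = "exp (3 * V')" and f' = exp])
    have "0 \<le> V'" using V' by (rule jet_bounded_nonneg)
    then show "\<bar>exp s\<bar> \<le> exp (3 * V')" "\<bar>exp s\<bar> \<le> exp (3 * V')" if "s \<in> {- V'..V'}" for s
      using that by auto
    show "(- 1) * (\<Sum>l\<in>UNIV. log_partition B l (\<theta> $ l)) \<in> {- V'..V'}" if "\<theta> \<in> \<Theta>" for \<theta>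
    proof -
      have "y \<in> {- V'..V'}" if "\<bar>y\<bar> \<le> V'" for y using that by auto
      then show ?thesis using jet_boundedD(2)[OF V' that] .
    qed
    show "\<bar>exp s - exp t - exp t * (s - t)\<bar> \<le> exp (3 * V') * (s - t)\<^sup>2"
      if "s \<in> {- V'..V'}" "t \<in> {- V'..V'}" for s t
      using that by (intro exp_taylor2) auto
  qed simp
  then show ?thesis by (simp add: normalizer_def[abs_def])
qed

text \<open>
  Every multiplication costs one more constant factor, which is geometric growth in the degree.
\<close>

lemma monomial_jet_bounded:
  "\<exists>C\<ge>0. \<exists>K\<ge>1. \<forall>\<alpha>. jet_bounded (C * K ^ deg \<alpha>) (\<lambda>\<theta>. normalizer \<theta> * monomial \<alpha> \<theta>)"
proof -
  define D where "D = CARD('d) * exp R"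
  have D: "0 \<le> D" by (simp add: D_def)
  obtain U where U: "U \<ge> 1" "\<And>l. jet_bounded U (\<lambda>\<theta>. \<theta> $ l)" using parameter_jet_bounded by auto
  obtain V where V: "jet_bounded V normalizer" using normalizer_jet_bounded by auto
  define K where "K = (3 + D) * U"
  define C where "C = (3 + D) * (V * (3 + D) ^ CARD('d))"
  have "jet_bounded (C * K ^ deg \<alpha>) (\<lambda>\<theta>. normalizer \<theta> * monomial \<alpha> \<theta>)" for \<alpha>
  proof -
    have "jet_bounded (\<Prod>l\<in>UNIV. (3 + D) * K ^ \<alpha> l) (\<lambda>\<theta>. \<Prod>l\<in>UNIV. (\<theta> $ l) ^ \<alpha> l)"
      unfolding D_def K_def
      by (intro jet_bounded_prod finite_class.finite_UNIV jet_bounded_power U)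
    from jet_bounded_mult[OF V this, folded D_def]
    show ?thesis
      by (simp add: monomial_def C_def prod.distrib power_sum mult_ac)
  qed
  moreover have "1 \<le> K" unfolding K_def using mult_mono[of 1 "3 + D" 1 U] U(1) D by simp
  moreover have "0 \<le> C" unfolding C_def using jet_bounded_nonneg[OF V] D by simp
  ultimately show ?thesis by blast
qed

end

section \<open>The empirical process\<close>

lemma geometric_multi_index_summable:
  fixes r :: real
  assumes "0 \<le> r" "r < 1"
  shows "summable_family (\<lambda>\<alpha> :: 'd::finite \<Rightarrow> nat. r ^ (\<Sum>l\<in>UNIV. \<alpha> l))"
proof -
  have "summable_family (\<lambda>k. r ^ k)"
    unfolding abs_summable_on_nat_iff' using assms by (simp add: summable_geometric)
  then have "Infinite_Set_Sum.abs_summable_on (\<lambda>\<alpha> :: 'd \<Rightarrow> nat. \<Prod>l\<in>UNIV. r ^ \<alpha> l) (PiE UNIV (\<lambda>_. UNIV))"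
    by (intro abs_summable_on_prod_PiE) auto
  moreover have "PiE (UNIV :: 'd set) (\<lambda>_. UNIV :: nat set) = UNIV" by auto
  ultimately show ?thesis by (simp add: power_sum)
qed

context finite_mixture_model
begin

definition law :: "(real ^ 'd) measure" where
  "law = density (base_measure B) (\<lambda>x. ennreal (f0 x))"

lemma sets_law [simp, measurable_cong]: "sets law = sets borel"
  by (simp add: law_def)

lemma space_law [simp]: "space law = UNIV"
  by (simp add: law_def)

lemma integrable_law:
  assumes "exp_bounded f" "f \<in> borel_measurable borel"
  shows "integrable law f"
proof -
  have "integrable (base_measure B) (\<lambda>x. \<Sum>a\<in>S. weight a * (f x * product_density B a x))"
    using assms S_domain
    by (intro Bochner_Integration.integrable_sum integrable_mult_right exp_bounded_integrable) auto
  then have "integrable (base_measure B) (\<lambda>x. f0 x *\<^sub>R f x)"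
    by (simp add: f0_eq sum_distrib_right sum_distrib_left mult_ac)
  then show ?thesis
    unfolding law_def using assms(2) f0_nonneg by (subst integrable_density) auto
qed

lemma law_positive: "AE x in law. 0 < f0 x"
  unfolding law_def by (subst AE_density) (auto intro!: always_eventually)

lemma integral_ratio_law:
  assumes "q \<in> borel_measurable borel" "\<theta> \<in> parameter_domain B"
  shows "(\<integral>x. q x * ratio \<theta> x \<partial>law) = (\<integral>x. q x * product_density B \<theta> x \<partial>base_measure B)"
proof -
  have "(\<integral>x. q x * ratio \<theta> x \<partial>law) = (\<integral>x. f0 x *\<^sub>R (q x * ratio \<theta> x) \<partial>base_measure B)"
    unfolding law_def using assms(1) f0_nonneg by (subst integral_density) auto
  moreover have "f0 x *\<^sub>R (q x * ratio \<theta> x) = q x * product_density B \<theta> x" for x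
  proof (cases "f0 x = 0")
    case True
    then have "base_weight B x = 0" using f0_pos_iff[of x] by auto
    then show ?thesis using True by (simp add: product_density_tilt)
  qed (simp add: ratio_def)
  ultimately show ?thesis by (simp only:)
qed

lemma exp_bounded_kernel: "exp_bounded (kernel \<alpha>)"
proof (rule exp_bounded_mono[OF exp_bounded_envelope[of 1]])
  show "\<bar>kernel \<alpha> x\<bar> \<le> \<bar>envelope 1 x\<bar>" for x
    using kernel_le_envelope[of 1 \<alpha> x] by simp
qed simp

lemma abs_monomial_le:
  assumes "\<theta> \<in> \<Theta>" shows "\<bar>monomial \<alpha> \<theta>\<bar> \<le> R ^ deg \<alpha>"
proof -
  have "\<bar>monomial \<alpha> \<theta>\<bar> = (\<Prod>l\<in>UNIV. \<bar>\<theta> $ l\<bar> ^ \<alpha> l)"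
    by (simp add: monomial_def abs_prod power_abs)
  also have "\<dots> \<le> (\<Prod>l\<in>UNIV. R ^ \<alpha> l)"
    using \<Theta>_bound[OF assms] by (intro prod_mono conjI power_mono) auto
  finally show ?thesis by (simp add: power_sum)
qed

text \<open>
  Fubini's theorem; choosing the envelope at more than twice the radius of the parameter set makes the series of
  absolute values converge geometrically.
\<close>

lemma integral_ratio_expansion:
  assumes q: "exp_bounded q" "q \<in> borel_measurable borel" and \<theta>: "\<theta> \<in> \<Theta>" and law: "prob_space law"
  shows "summable_family (\<lambda>\<alpha>. monomial \<alpha> \<theta> * (\<integral>x. q x * kernel \<alpha> x \<partial>law))"
    and "(\<integral>x. q x * ratio \<theta> x \<partial>law)
      = normalizer \<theta> * (\<Sum>\<^sub>a\<alpha>. monomial \<alpha> \<theta> * (\<integral>x. q x * kernel \<alpha> x \<partial>law))"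
proof -
  interpret law: prob_space law by fact
  have "sigma_finite_measure (count_space (UNIV :: ('d \<Rightarrow> nat) set))"
    by (rule sigma_finite_measure_count_space_countable) simp
  then interpret P: pair_sigma_finite "count_space (UNIV :: ('d \<Rightarrow> nat) set)" law
    by (intro pair_sigma_finite.intro law.sigma_finite_measure_axioms)
  note [measurable] = q(2)
  define K where "K = 2 * (R + 1)"
  have K: "0 < K" "R / K \<le> 1 / 2" using R_nonneg by (auto simp: K_def field_simps)
  define A where "A = (\<integral>x. \<bar>q x\<bar> * envelope K x \<partial>law)"
  define F where "F \<alpha> x = monomial \<alpha> \<theta> * (q x * kernel \<alpha> x)" for \<alpha> x
  have intF: "integrable law (F \<alpha>)" for \<alpha>
    unfolding F_def using q by (intro integrable_mult_right integrable_law exp_bounded_mult exp_bounded_kernel) auto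
  have absq: "exp_bounded (\<lambda>x. \<bar>q x\<bar>)" using q(1) by (rule exp_bounded_mono) simp
  have intA: "integrable law (\<lambda>x. \<bar>q x\<bar> * envelope K x)"
    using K by (intro integrable_law exp_bounded_mult absq exp_bounded_envelope) auto
  have A0: "0 \<le> A" unfolding A_def using envelope_nonneg[of K] K by (intro integral_nonneg_AE) auto
  have bound: "(\<integral>x. \<bar>F \<alpha> x\<bar> \<partial>law) \<le> A * (1 / 2) ^ deg \<alpha>" for \<alpha>
  proof -
    let ?k = "\<Sum>l\<in>UNIV. \<alpha> l"
    have "\<bar>F \<alpha> x\<bar> \<le> (R / K) ^ ?k * (\<bar>q x\<bar> * envelope K x)" for x
    proof -
      have "\<bar>F \<alpha> x\<bar> \<le> R ^ ?k * (\<bar>q x\<bar> * (inverse K ^ ?k * envelope K x))"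
        unfolding F_def abs_mult using K R_nonneg
        by (intro mult_mono abs_monomial_le[OF \<theta>] kernel_le_envelope) auto
      also have "\<dots> = (R / K) ^ ?k * (\<bar>q x\<bar> * envelope K x)"
        by (simp add: divide_inverse power_mult_distrib mult_ac)
      finally show ?thesis .
    qed
    then have "(\<integral>x. \<bar>F \<alpha> x\<bar> \<partial>law) \<le> (\<integral>x. (R / K) ^ ?k * (\<bar>q x\<bar> * envelope K x) \<partial>law)"
      using intF intA by (intro integral_mono) auto
    also have "\<dots> = (R / K) ^ ?k * A" by (simp add: A_def)
    also have "\<dots> \<le> (1 / 2) ^ ?k * A"
      using K R_nonneg A0 by (intro mult_right_mono power_mono) auto
    finally show ?thesis by (simp add: mult.commute)
  qed
  have geo: "summable_family (\<lambda>\<alpha> :: 'd \<Rightarrow> nat. A * (1 / 2) ^ deg \<alpha>)"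
    by (intro abs_summable_on_cmult_right geometric_multi_index_summable) auto
  have sum_abs: "summable_family (\<lambda>\<alpha>. \<integral>x. \<bar>F \<alpha> x\<bar> \<partial>law)"
    using geo by (rule abs_summable_on_comparison_test) (use bound A0 in auto)
  have intP: "integrable (count_space UNIV \<Otimes>\<^sub>M law) (case_prod F)"
  proof (rule P.Fubini_integrable)
    show "case_prod F \<in> borel_measurable (count_space UNIV \<Otimes>\<^sub>M law)"
      by (rule measurable_pair_measure_countable1) (auto simp: F_def)
    show "integrable (count_space UNIV) (\<lambda>\<alpha>. \<integral>x. norm (case_prod F (\<alpha>, x)) \<partial>law)"
      using sum_abs by (simp add: abs_summable_on_def)
    show "AE \<alpha> in count_space UNIV. integrable law (\<lambda>x. case_prod F (\<alpha>, x))"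
      using intF by simp
  qed
  have eqF: "(\<integral>x. F \<alpha> x \<partial>law) = monomial \<alpha> \<theta> * (\<integral>x. q x * kernel \<alpha> x \<partial>law)" for \<alpha>
    by (simp add: F_def)
  show "summable_family (\<lambda>\<alpha>. monomial \<alpha> \<theta> * (\<integral>x. q x * kernel \<alpha> x \<partial>law))"
    unfolding eqF[symmetric] using geo
  proof (rule abs_summable_on_comparison_test)
    fix \<alpha> :: "'d \<Rightarrow> nat"
    have "\<bar>\<integral>x. F \<alpha> x \<partial>law\<bar> \<le> A * (1 / 2) ^ deg \<alpha>"
      using bound[of \<alpha>] integral_abs_bound[of law "F \<alpha>"] by linarith
    then show "norm (\<integral>x. F \<alpha> x \<partial>law) \<le> norm (A * (1 / 2) ^ deg \<alpha>)" by simp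
  qed
  have "(\<integral>x. q x * ratio \<theta> x \<partial>law) = (\<integral>x. normalizer \<theta> * (\<Sum>\<^sub>a\<alpha>. F \<alpha> x) \<partial>law)"
  proof (intro Bochner_Integration.integral_cong refl)
    fix x
    have "(\<Sum>\<^sub>a\<alpha>. F \<alpha> x) = (\<Sum>\<^sub>a\<alpha>. q x * (monomial \<alpha> \<theta> * kernel \<alpha> x))"
      by (simp add: F_def mult_ac)
    also have "\<dots> = q x * (\<Sum>\<^sub>a\<alpha>. monomial \<alpha> \<theta> * kernel \<alpha> x)"
      by (rule infsetsum_cmult_right) (rule ratio_expansion)
    finally show "q x * ratio \<theta> x = normalizer \<theta> * (\<Sum>\<^sub>a\<alpha>. F \<alpha> x)"
      by (simp add: ratio_expansion(2))
  qed
  also have "\<dots> = normalizer \<theta> * (\<integral>x. (\<Sum>\<^sub>a\<alpha>. F \<alpha> x) \<partial>law)" by simp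
  also have "(\<integral>x. (\<Sum>\<^sub>a\<alpha>. F \<alpha> x) \<partial>law) = (\<Sum>\<^sub>a\<alpha>. \<integral>x. F \<alpha> x \<partial>law)"
    unfolding infsetsum_def by (rule P.Fubini_integral[OF intP])
  finally show "(\<integral>x. q x * ratio \<theta> x \<partial>law)
      = normalizer \<theta> * (\<Sum>\<^sub>a\<alpha>. monomial \<alpha> \<theta> * (\<integral>x. q x * kernel \<alpha> x \<partial>law))"
    by (simp only: eqF)
qed

end

definition empirical_mean :: "(nat \<Rightarrow> 'x) \<Rightarrow> nat \<Rightarrow> ('x \<Rightarrow> real) \<Rightarrow> real" where
  "empirical_mean x n f = (\<Sum>i<n. f (x i)) / real n"

text \<open>
  Independent centred variables are orthogonal, so the second moment of the deviation is of order \<open>1 / n\<close>.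
\<close>

lemma empirical_mean_deviation:
  fixes M :: "'w measure" and X :: "nat \<Rightarrow> 'w \<Rightarrow> 'x" and f :: "'x \<Rightarrow> real"
  assumes M: "prob_space M" and indep: "prob_space.indep_vars M (\<lambda>_. N) X UNIV"
    and distr: "\<And>i. distr M N (X i) = P"
    and f: "f \<in> borel_measurable N" "integrable P f" "integrable P (\<lambda>x. (f x)\<^sup>2)" and n: "0 < n"
  shows "(\<integral>\<^sup>+\<omega>. ennreal \<bar>empirical_mean (\<lambda>i. X i \<omega>) n f - (\<integral>x. f x \<partial>P)\<bar> \<partial>M)
    \<le> ennreal (sqrt (\<integral>x. (f x)\<^sup>2 \<partial>P) / sqrt n)"
proof -
  interpret prob_space M by fact
  have X[measurable]: "X i \<in> M \<rightarrow>\<^sub>M N" for i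
    using indep unfolding indep_vars_def by auto
  note [measurable] = f(1)
  have P_prob: "prob_space P" using prob_space_distr[OF X[of 0]] by (simp add: distr)
  define m where "m = (\<integral>x. f x \<partial>P)"
  define Y where "Y i \<omega> = f (X i \<omega>) - m" for i \<omega>
  have Y_meas[measurable]: "Y i \<in> borel_measurable M" for i unfolding Y_def by measurable
  have tr: "(\<integral>\<omega>. g (X i \<omega>) \<partial>M) = (\<integral>x. g x \<partial>P)" "integrable M (\<lambda>\<omega>. g (X i \<omega>)) = integrable P g"
    if "g \<in> borel_measurable N" for g :: "'x \<Rightarrow> real" and i
    using that by (simp_all add: distr[of i, symmetric] integral_distr[OF X] integrable_distr_eq[OF X])
  have intY: "integrable M (Y i)" for i
    unfolding Y_def using tr(2)[of f i] f by auto
  have sqY: "(Y i \<omega>)\<^sup>2 = (f (X i \<omega>))\<^sup>2 - 2 * m * f (X i \<omega>) + m\<^sup>2" for i \<omega>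
    by (simp add: Y_def power2_diff)
  have intY2: "integrable M (\<lambda>\<omega>. (Y i \<omega>)\<^sup>2)" for i
    unfolding sqY using tr(2)[of f i] tr(2)[of "\<lambda>x. (f x)\<^sup>2" i] f by auto
  have EY: "expectation (Y i) = 0" for i
    unfolding Y_def using tr[of f i] f by (simp add: m_def prob_space)
  have EY2: "expectation (\<lambda>\<omega>. (Y i \<omega>)\<^sup>2) \<le> (\<integral>x. (f x)\<^sup>2 \<partial>P)" for i
  proof -
    have "expectation (\<lambda>\<omega>. (Y i \<omega>)\<^sup>2) = (\<integral>x. (f x)\<^sup>2 \<partial>P) - m\<^sup>2"
      unfolding sqY using tr[of f i] tr[of "\<lambda>x. (f x)\<^sup>2" i] f
      by (simp add: m_def prob_space power2_eq_square)
    then show ?thesis by simp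
  qed
  have indepY: "indep_vars (\<lambda>_. borel) Y UNIV"
    unfolding Y_def by (rule indep_vars_compose2[OF indep]) measurable
  have cross: "integrable M (\<lambda>\<omega>. Y i \<omega> * Y j \<omega>) \<and>
      expectation (\<lambda>\<omega>. Y i \<omega> * Y j \<omega>) = (if i = j then expectation (\<lambda>\<omega>. (Y i \<omega>)\<^sup>2) else 0)" for i j
  proof (cases "i = j")
    case True
    then show ?thesis using intY2 by (simp add: power2_eq_square)
  next
    case False
    have "indep_vars (\<lambda>_. borel) Y {i, j}" using indepY by (rule indep_vars_subset) auto
    then have "expectation (\<lambda>\<omega>. \<Prod>k\<in>{i, j}. Y k \<omega>) = (\<Prod>k\<in>{i, j}. expectation (Y k))"
      "integrable M (\<lambda>\<omega>. \<Prod>k\<in>{i, j}. Y k \<omega>)"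
      using intY by (auto intro!: indep_vars_lebesgue_integral indep_vars_integrable)
    then show ?thesis using False EY by simp
  qed
  define D where "D \<omega> = empirical_mean (\<lambda>i. X i \<omega>) n f - m" for \<omega>
  have D: "D \<omega> = (\<Sum>i<n. Y i \<omega>) / n" for \<omega>
    using n by (simp add: D_def empirical_mean_def Y_def sum_subtractf field_simps)
  have D2: "(D \<omega>)\<^sup>2 = (\<Sum>i<n. \<Sum>j<n. Y i \<omega> * Y j \<omega>) / (real n)\<^sup>2" for \<omega>
    by (simp add: D power_divide power2_eq_square sum_product)
  have intD: "integrable M D" unfolding D using intY by auto
  have intD2: "integrable M (\<lambda>\<omega>. (D \<omega>)\<^sup>2)" unfolding D2 using cross by auto
  have "expectation (\<lambda>\<omega>. (D \<omega>)\<^sup>2) = (\<Sum>i<n. \<Sum>j<n. expectation (\<lambda>\<omega>. Y i \<omega> * Y j \<omega>)) / (real n)\<^sup>2"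
    unfolding D2 using cross by simp
  also have "(\<Sum>i<n. \<Sum>j<n. expectation (\<lambda>\<omega>. Y i \<omega> * Y j \<omega>)) = (\<Sum>i<n. expectation (\<lambda>\<omega>. (Y i \<omega>)\<^sup>2))"
    using cross by simp
  also have "\<dots> \<le> (\<Sum>i<n. (\<integral>x. (f x)\<^sup>2 \<partial>P))" by (intro sum_mono EY2)
  finally have ED2: "expectation (\<lambda>\<omega>. (D \<omega>)\<^sup>2) \<le> (\<integral>x. (f x)\<^sup>2 \<partial>P) / n"
    using n by (simp add: divide_right_mono power2_eq_square)
  have "(expectation (\<lambda>\<omega>. \<bar>D \<omega>\<bar>))\<^sup>2 \<le> expectation (\<lambda>\<omega>. \<bar>D \<omega>\<bar>\<^sup>2)"
    using intD intD2 by (intro prob_space_integral_square_le M) auto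
  then have "(expectation (\<lambda>\<omega>. \<bar>D \<omega>\<bar>))\<^sup>2 \<le> (\<integral>x. (f x)\<^sup>2 \<partial>P) / n" using ED2 by simp
  then have "expectation (\<lambda>\<omega>. \<bar>D \<omega>\<bar>) \<le> sqrt ((\<integral>x. (f x)\<^sup>2 \<partial>P) / n)" by (rule real_le_rsqrt)
  moreover have "(\<integral>\<^sup>+\<omega>. ennreal \<bar>D \<omega>\<bar> \<partial>M) = ennreal (expectation (\<lambda>\<omega>. \<bar>D \<omega>\<bar>))"
    using intD by (intro nn_integral_eq_integral) auto
  ultimately show ?thesis by (simp add: D_def m_def real_sqrt_divide ennreal_leI)
qed

locale mixture_sample = finite_mixture_model B \<Theta> S g0 R
  for B :: "'d::finite set" and \<Theta> S g0 R +
  fixes M :: "'w measure" and X :: "nat \<Rightarrow> 'w \<Rightarrow> real ^ 'd"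
  assumes prob_M: "prob_space M"
    and indep_X: "prob_space.indep_vars M (\<lambda>_. borel) X UNIV"
    and distributed_X: "\<And>i. distributed M (base_measure B) (X i) (\<lambda>x. ennreal (mixture_density B g0 x))"
begin

lemma X_measurable [measurable]: "X i \<in> borel_measurable M"
  using distributed_measurable[OF distributed_X[of i]] measurable_cong_sets[OF refl sets_base_measure]
  by blast

lemma distr_X: "distr M borel (X i) = law"
proof -
  have "distr M borel (X i) = distr M (base_measure B) (X i)" by (intro distr_cong) auto
  then show ?thesis using distributed_distr_eq_density[OF distributed_X[of i]]
    by (simp add: law_def f0_def)
qed

lemma prob_law: "prob_space law"
  using prob_space.prob_space_distr[OF prob_M X_measurable[of 0]] by (simp add: distr_X)

lemma AE_X_positive: "AE \<omega> in M. \<forall>i. 0 < f0 (X i \<omega>)"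
proof (subst AE_all_countable, intro allI)
  fix i
  have "AE x in distr M borel (X i). 0 < f0 x" unfolding distr_X by (rule law_positive)
  then show "AE \<omega> in M. 0 < f0 (X i \<omega>)" by (subst (asm) AE_distr_iff) auto
qed

abbreviation emp :: "nat \<Rightarrow> 'w \<Rightarrow> (real ^ 'd \<Rightarrow> real) \<Rightarrow> real" where
  "emp n \<omega> f \<equiv> empirical_mean (\<lambda>i. X i \<omega>) n f"

text \<open>
  The difference is \<open>normalizer \<theta>\<close> times the power series with the centred coefficients \<open>Z\<close>. Its jets are
  bounded by \<open>W\<close>, the sum of \<open>\<bar>Z \<alpha>\<bar>\<close> times the jet bound of the monomial. The expectation of \<open>W\<close> can be
  taken term by term; no supremum over \<open>\<theta>\<close> has to be estimated.
\<close>

theorem empirical_process_jet_bounded: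
  assumes q: "exp_bounded q" "q \<in> borel_measurable borel"
    and Q: "Q \<in> borel_measurable borel"
      "\<And>\<theta>. \<theta> \<in> \<Theta> \<Longrightarrow> (\<integral>x. q x * product_density B \<theta> x \<partial>base_measure B) = Q \<theta>"
  shows "\<exists>C\<ge>0. \<forall>n>0. \<exists>W. W \<in> borel_measurable M \<and> (\<integral>\<^sup>+\<omega>. W \<omega> \<partial>M) \<le> ennreal (C / sqrt n) \<and>
    (\<forall>\<omega>\<in>space M. \<forall>w. W \<omega> \<le> ennreal w \<longrightarrow> 0 \<le> w \<longrightarrow>
       jet_bounded w (\<lambda>\<theta>. emp n \<omega> (\<lambda>x. q x * ratio \<theta> x) - Q \<theta>))"
proof -
  interpret M: prob_space M by (rule prob_M)
  have "sigma_finite_measure (count_space (UNIV :: ('d \<Rightarrow> nat) set))"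
    by (rule sigma_finite_measure_count_space_countable) simp
  then interpret P: pair_sigma_finite "count_space (UNIV :: ('d \<Rightarrow> nat) set)" M
    by (intro pair_sigma_finite.intro M.sigma_finite_measure_axioms)
  note [measurable] = q(2) Q(1)
  obtain C0 K where C0: "C0 \<ge> 0" and K: "K \<ge> 1"
    and jb: "\<And>\<alpha>. jet_bounded (C0 * K ^ deg \<alpha>) (\<lambda>\<theta>. normalizer \<theta> * monomial \<alpha> \<theta>)"
    using monomial_jet_bounded by blast
  \<comment> \<open>The envelope at \<open>2 * K\<close> beats the growth \<open>K\<close> of the jets and leaves powers of 1/2.\<close>
  define A where "A = sqrt (\<integral>x. (q x * envelope (2 * K) x)\<^sup>2 \<partial>law)"
  define U where "U \<alpha> = C0 * K ^ deg \<alpha>" for \<alpha> :: "'d \<Rightarrow> nat"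
  have U0: "0 \<le> U \<alpha>" for \<alpha> using C0 K by (simp add: U_def)
  have A0: "0 \<le> A" unfolding A_def by (intro real_sqrt_ge_zero integral_nonneg_AE) auto
  have eb: "exp_bounded (\<lambda>x. q x * kernel \<alpha> x)" "exp_bounded (\<lambda>x. (q x * kernel \<alpha> x)\<^sup>2)"
    "exp_bounded (\<lambda>x. (q x * envelope (2 * K) x)\<^sup>2)" for \<alpha>
    unfolding power2_eq_square using q K by (intro exp_bounded_mult exp_bounded_kernel exp_bounded_envelope; simp)+
  define Z where "Z n \<alpha> \<omega> = emp n \<omega> (\<lambda>x. q x * kernel \<alpha> x) - (\<integral>x. q x * kernel \<alpha> x \<partial>law)" for n \<alpha> \<omega>
  have Z_meas[measurable]: "Z n \<alpha> \<in> borel_measurable M" for n \<alpha>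
    unfolding Z_def empirical_mean_def by measurable
  have EZ: "(\<integral>\<^sup>+\<omega>. ennreal \<bar>Z n \<alpha> \<omega>\<bar> \<partial>M) \<le> ennreal (A / (2 * K) ^ deg \<alpha> / sqrt n)"
    if "0 < n" for n \<alpha>
  proof -
    let ?k = "\<Sum>l\<in>UNIV. \<alpha> l"
    have "(\<integral>x. (q x * kernel \<alpha> x)\<^sup>2 \<partial>law) \<le> (\<integral>x. (inverse (2 * K) ^ ?k)\<^sup>2 * (q x * envelope (2 * K) x)\<^sup>2 \<partial>law)"
    proof (intro integral_mono integrable_mult_right integrable_law eb)
      fix x
      have "\<bar>q x * kernel \<alpha> x\<bar> \<le> \<bar>inverse (2 * K) ^ ?k * (q x * envelope (2 * K) x)\<bar>"
        using mult_left_mono[OF kernel_le_envelope[of "2 * K" \<alpha> x], of "\<bar>q x\<bar>"] K envelope_nonneg[of "2 * K" x]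
        by (simp add: abs_mult mult_ac)
      then show "(q x * kernel \<alpha> x)\<^sup>2 \<le> (inverse (2 * K) ^ ?k)\<^sup>2 * (q x * envelope (2 * K) x)\<^sup>2"
        unfolding power_mult_distrib[symmetric] by (simp only: abs_le_square_iff)
    qed measurable
    then have "sqrt (\<integral>x. (q x * kernel \<alpha> x)\<^sup>2 \<partial>law)
        \<le> sqrt ((inverse (2 * K) ^ ?k)\<^sup>2 * (\<integral>x. (q x * envelope (2 * K) x)\<^sup>2 \<partial>law))"
      by simp
    also have "\<dots> = inverse (2 * K) ^ ?k * A" using K by (simp add: real_sqrt_mult A_def)
    also have "\<dots> = A / (2 * K) ^ ?k" unfolding power_inverse divide_inverse by (rule mult.commute)
    finally have "sqrt (\<integral>x. (q x * kernel \<alpha> x)\<^sup>2 \<partial>law) / sqrt n \<le> A / (2 * K) ^ ?k / sqrt n"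
      by (intro divide_right_mono) auto
    then have "ennreal (sqrt (\<integral>x. (q x * kernel \<alpha> x)\<^sup>2 \<partial>law) / sqrt n)
        \<le> ennreal (A / (2 * K) ^ ?k / sqrt n)" by (rule ennreal_leI)
    moreover have "(\<integral>\<^sup>+\<omega>. ennreal \<bar>Z n \<alpha> \<omega>\<bar> \<partial>M) \<le> ennreal (sqrt (\<integral>x. (q x * kernel \<alpha> x)\<^sup>2 \<partial>law) / sqrt n)"
      unfolding Z_def
      by (rule empirical_mean_deviation[OF prob_M indep_X distr_X])
         (use that in \<open>auto intro!: integrable_law eb\<close>)
    ultimately show ?thesis by (rule order_trans[rotated])
  qed
  define W where "W n \<omega> = (\<integral>\<^sup>+\<alpha>. ennreal (\<bar>Z n \<alpha> \<omega>\<bar> * U \<alpha>) \<partial>count_space UNIV)" for n \<omega>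
  have joint[measurable]: "(\<lambda>(\<alpha>, \<omega>). ennreal (\<bar>Z n \<alpha> \<omega>\<bar> * U \<alpha>)) \<in> borel_measurable (count_space UNIV \<Otimes>\<^sub>M M)" for n
    by (rule measurable_pair_measure_countable1) auto
  have W_meas: "W n \<in> borel_measurable M" for n
  proof -
    have "(\<lambda>(\<omega>, \<alpha>). ennreal (\<bar>Z n \<alpha> \<omega>\<bar> * U \<alpha>)) \<in> borel_measurable (M \<Otimes>\<^sub>M count_space UNIV)"
      using measurable_pair_swap[OF joint[of n]] by (simp add: case_prod_unfold)
    then show ?thesis unfolding W_def by (rule P.M1.borel_measurable_nn_integral)
  qed
  define geo where "geo = (\<Sum>\<^sub>a\<alpha>\<in>(UNIV :: ('d \<Rightarrow> nat) set). A * C0 * (1 / 2) ^ deg \<alpha>)"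
  have geo_s: "summable_family (\<lambda>\<alpha> :: 'd \<Rightarrow> nat. A * C0 * (1 / 2) ^ deg \<alpha>)"
    by (intro abs_summable_on_cmult_right geometric_multi_index_summable) auto
  have EW: "(\<integral>\<^sup>+\<omega>. W n \<omega> \<partial>M) \<le> ennreal (geo / sqrt n)" if n: "0 < n" for n
  proof -
    have "(\<integral>\<^sup>+\<omega>. W n \<omega> \<partial>M) = (\<integral>\<^sup>+\<alpha>. (\<integral>\<^sup>+\<omega>. ennreal (\<bar>Z n \<alpha> \<omega>\<bar> * U \<alpha>) \<partial>M) \<partial>count_space UNIV)"
      unfolding W_def using P.Fubini[OF joint[of n]] by simp
    also have "\<dots> \<le> (\<integral>\<^sup>+\<alpha>. ennreal (A * C0 * (1 / 2) ^ deg \<alpha> / sqrt n) \<partial>count_space (UNIV :: ('d \<Rightarrow> nat) set))"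
    proof (intro nn_integral_mono)
      fix \<alpha> :: "'d \<Rightarrow> nat"
      have "(\<integral>\<^sup>+\<omega>. ennreal (\<bar>Z n \<alpha> \<omega>\<bar> * U \<alpha>) \<partial>M) = (\<integral>\<^sup>+\<omega>. ennreal \<bar>Z n \<alpha> \<omega>\<bar> \<partial>M) * ennreal (U \<alpha>)"
        using U0 by (simp add: ennreal_mult nn_integral_multc)
      also have "\<dots> \<le> ennreal (A / (2 * K) ^ deg \<alpha> / sqrt n) * ennreal (U \<alpha>)"
        by (intro mult_right_mono EZ n) auto
      also have "\<dots> = ennreal (A / (2 * K) ^ deg \<alpha> / sqrt n * U \<alpha>)"
        using U0 A0 K by (subst ennreal_mult) auto
      also have "A / (2 * K) ^ deg \<alpha> / sqrt n * U \<alpha> = A * C0 * (1 / 2) ^ deg \<alpha> / sqrt n"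
        using K by (simp add: U_def power_mult_distrib power_divide)
      finally show "(\<integral>\<^sup>+\<omega>. ennreal (\<bar>Z n \<alpha> \<omega>\<bar> * U \<alpha>) \<partial>M) \<le> ennreal (A * C0 * (1 / 2) ^ deg \<alpha> / sqrt n)" .
    qed
    also have "\<dots> = ennreal (\<Sum>\<^sub>a\<alpha>\<in>(UNIV :: ('d \<Rightarrow> nat) set). A * C0 * (1 / 2) ^ deg \<alpha> / sqrt n)"
      using geo_s A0 C0 unfolding divide_inverse[of _ "sqrt n"]
      by (intro nn_integral_conv_infsetsum abs_summable_on_cmult_left) auto
    also have "(\<Sum>\<^sub>a\<alpha>\<in>(UNIV :: ('d \<Rightarrow> nat) set). A * C0 * (1 / 2) ^ deg \<alpha> / sqrt n) = geo / sqrt n"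
      unfolding geo_def using geo_s unfolding divide_inverse[of _ "sqrt n"] by (intro infsetsum_cmult_left) auto
    finally show ?thesis .
  qed
  have jets: "jet_bounded w (\<lambda>\<theta>. emp n \<omega> (\<lambda>x. q x * ratio \<theta> x) - Q \<theta>)"
    if \<omega>: "\<omega> \<in> space M" and w: "W n \<omega> \<le> ennreal w" "0 \<le> w" for n \<omega> w
  proof -
    have Ws: "summable_family (\<lambda>\<alpha>. \<bar>Z n \<alpha> \<omega>\<bar> * U \<alpha>)"
      unfolding abs_summable_on_def integrable_iff_bounded
      using w U0 by (auto simp: W_def intro: le_less_trans)
    then have "W n \<omega> = ennreal (\<Sum>\<^sub>a\<alpha>. \<bar>Z n \<alpha> \<omega>\<bar> * U \<alpha>)"
      unfolding W_def using U0 by (intro nn_integral_conv_infsetsum) auto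
    then have le: "(\<Sum>\<^sub>a\<alpha>. \<bar>Z n \<alpha> \<omega>\<bar> * U \<alpha>) \<le> w" using w by simp
    have "jet_bounded (\<Sum>\<^sub>a\<alpha>. \<bar>Z n \<alpha> \<omega>\<bar> * U \<alpha>) (\<lambda>\<theta>. emp n \<omega> (\<lambda>x. q x * ratio \<theta> x) - Q \<theta>)"
    proof (rule jet_bounded_infsetsum[OF jb[folded U_def] Ws])
      show "(\<lambda>\<theta>. emp n \<omega> (\<lambda>x. q x * ratio \<theta> x) - Q \<theta>) \<in> borel_measurable borel"
        unfolding empirical_mean_def by measurable
      fix \<theta> assume \<theta>: "\<theta> \<in> \<Theta>"
      define k where "k \<alpha> = (\<integral>x. q x * kernel \<alpha> x \<partial>law)" for \<alpha>
      have Q\<theta>: "Q \<theta> = normalizer \<theta> * (\<Sum>\<^sub>a\<alpha>. monomial \<alpha> \<theta> * k \<alpha>)"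
        using integral_ratio_expansion(2)[OF q \<theta> prob_law] integral_ratio_law[OF q(2) \<Theta>_domain[OF \<theta>]] Q(2)[OF \<theta>]
        by (simp add: k_def)
      have ks: "summable_family (\<lambda>\<alpha>. monomial \<alpha> \<theta> * k \<alpha>)"
        unfolding k_def by (rule integral_ratio_expansion(1)[OF q \<theta> prob_law])
      have xs: "summable_family (\<lambda>\<alpha>. q x * (monomial \<alpha> \<theta> * kernel \<alpha> x))" for x
        by (intro abs_summable_on_cmult_right ratio_expansion)
      have emp_eq: "emp n \<omega> (\<lambda>x. q x * ratio \<theta> x)
          = normalizer \<theta> * (\<Sum>\<^sub>a\<alpha>. monomial \<alpha> \<theta> * emp n \<omega> (\<lambda>x. q x * kernel \<alpha> x))"
      proof -
        have "q x * ratio \<theta> x = normalizer \<theta> * (\<Sum>\<^sub>a\<alpha>. q x * (monomial \<alpha> \<theta> * kernel \<alpha> x))" for x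
          by (subst infsetsum_cmult_right) (auto simp: ratio_expansion)
        then have "emp n \<omega> (\<lambda>x. q x * ratio \<theta> x)
            = normalizer \<theta> * ((\<Sum>i<n. \<Sum>\<^sub>a\<alpha>. q (X i \<omega>) * (monomial \<alpha> \<theta> * kernel \<alpha> (X i \<omega>))) * inverse (real n))"
          by (simp add: empirical_mean_def sum_distrib_left divide_inverse sum_distrib_right mult_ac)
        also have "(\<Sum>i<n. \<Sum>\<^sub>a\<alpha>. q (X i \<omega>) * (monomial \<alpha> \<theta> * kernel \<alpha> (X i \<omega>)))
            = (\<Sum>\<^sub>a\<alpha>. \<Sum>i<n. q (X i \<omega>) * (monomial \<alpha> \<theta> * kernel \<alpha> (X i \<omega>)))"
          by (rule sum_infsetsum) (rule xs)
        also have "\<dots> * inverse (real n)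
            = (\<Sum>\<^sub>a\<alpha>. (\<Sum>i<n. q (X i \<omega>) * (monomial \<alpha> \<theta> * kernel \<alpha> (X i \<omega>))) * inverse (real n))"
          by (rule infsetsum_cmult_left[symmetric]) (intro abs_summable_sum xs)
        finally show ?thesis
          by (simp add: empirical_mean_def divide_inverse sum_distrib_left mult_ac)
      qed
      have es: "summable_family (\<lambda>\<alpha>. monomial \<alpha> \<theta> * emp n \<omega> (\<lambda>x. q x * kernel \<alpha> x))"
      proof -
        have "summable_family (\<lambda>\<alpha>. (\<Sum>i<n. q (X i \<omega>) * (monomial \<alpha> \<theta> * kernel \<alpha> (X i \<omega>))) * inverse (real n))"
          by (intro abs_summable_on_cmult_left abs_summable_sum xs)
        then show ?thesis
          by (simp add: empirical_mean_def divide_inverse sum_distrib_left mult_ac)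
      qed
      have "emp n \<omega> (\<lambda>x. q x * ratio \<theta> x) - Q \<theta>
          = normalizer \<theta> * (\<Sum>\<^sub>a\<alpha>. monomial \<alpha> \<theta> * emp n \<omega> (\<lambda>x. q x * kernel \<alpha> x) - monomial \<alpha> \<theta> * k \<alpha>)"
        unfolding emp_eq Q\<theta> infsetsum_diff[OF es ks] by (simp add: right_diff_distrib)
      also have "\<dots> = (\<Sum>\<^sub>a\<alpha>. normalizer \<theta> * (monomial \<alpha> \<theta> * emp n \<omega> (\<lambda>x. q x * kernel \<alpha> x) - monomial \<alpha> \<theta> * k \<alpha>))"
        by (rule infsetsum_cmult_right[symmetric]) (intro abs_summable_on_diff es ks)
      also have "\<dots> = (\<Sum>\<^sub>a\<alpha>. Z n \<alpha> \<omega> * (normalizer \<theta> * monomial \<alpha> \<theta>))"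
        by (intro infsetsum_cong refl) (simp add: Z_def k_def algebra_simps)
      finally show "emp n \<omega> (\<lambda>x. q x * ratio \<theta> x) - Q \<theta> = (\<Sum>\<^sub>a\<alpha>. Z n \<alpha> \<omega> * (normalizer \<theta> * monomial \<alpha> \<theta>))" .
    qed
    then show ?thesis using le by (rule jet_bounded_mono)
  qed
  have "0 \<le> geo" unfolding geo_def using A0 C0 by (intro infsetsum_nonneg) auto
  then show ?thesis
    using W_meas EW jets by (intro exI[of _ geo] conjI allI impI, simp, intro exI[of _ "W _"]) auto
qed

end

section \<open>Maximum likelihood\<close>

text \<open>
  Writing \<open>1 + s = r\<^sup>2\<close>, the bound follows from \<open>ln r \<le> r - 1\<close>. The quadratic term is what a
  likelihood ratio loses against its linearization.
\<close>

lemma ln_add_one_le_quadratic: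
  fixes s :: real
  assumes "- 1 < s" shows "ln (1 + s) \<le> s - s\<^sup>2 / (2 * (2 + s))"
proof -
  define r where "r = sqrt (1 + s)"
  have r: "0 < r" "r\<^sup>2 = 1 + s" using assms by (auto simp: r_def)
  have s: "s = r\<^sup>2 - 1" using r by simp
  have "ln (1 + s) = 2 * ln r" using r(1) unfolding r(2)[symmetric] by (simp add: ln_realpow)
  also have "\<dots> \<le> 2 * (r - 1)" using ln_le_minus_one[OF r(1)] by simp
  also have "\<dots> = s - (r - 1)\<^sup>2" unfolding s by (simp add: power2_eq_square algebra_simps)
  also have "\<dots> \<le> s - s\<^sup>2 / (2 * (2 + s))"
  proof -
    have "s\<^sup>2 = (r - 1)\<^sup>2 * (r + 1)\<^sup>2" unfolding s by (simp add: power2_eq_square algebra_simps)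
    also have "\<dots> \<le> (r - 1)\<^sup>2 * (2 * (2 + s))"
    proof (rule mult_left_mono)
      have "0 \<le> (r - 1)\<^sup>2" by simp
      then show "(r + 1)\<^sup>2 \<le> 2 * (2 + s)" unfolding s by (simp add: power2_eq_square algebra_simps)
    qed simp
    finally have "s\<^sup>2 / (2 * (2 + s)) \<le> (r - 1)\<^sup>2" using assms by (simp add: divide_le_eq mult.commute)
    then show ?thesis by simp
  qed
  finally show ?thesis .
qed

lemma empirical_mean_mono: "(\<And>y. f y \<le> g y) \<Longrightarrow> empirical_mean x n f \<le> empirical_mean x n g"
  by (simp add: empirical_mean_def sum_mono divide_right_mono)

context finite_mixture_model
begin

lemma integrable_ratio:
  assumes "h \<in> mixing_measures \<Theta>" shows "integrable h (\<lambda>\<theta>. ratio \<theta> x)"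
proof -
  interpret prob_space h using assms by (simp add: mixing_measures_def)
  have sets: "sets h = sets borel" and AE: "AE \<theta> in h. \<theta> \<in> \<Theta>"
    using assms by (auto simp: mixing_measures_def)
  show ?thesis
  proof (rule integrable_const_bound[of _ "envelope R x"])
    show "AE \<theta> in h. norm (ratio \<theta> x) \<le> envelope R x"
      using AE by eventually_elim (simp add: ratio_nonneg ratio_le_envelope)
    show "(\<lambda>\<theta>. ratio \<theta> x) \<in> borel_measurable h"
      using measurable_cong_sets[OF sets refl] borel_measurable_ratio_parameter by blast
  qed
qed

lemma integral_ratio: "(\<integral>\<theta>. ratio \<theta> x \<partial>h) = mixture_density B h x / f0 x"
  by (simp add: ratio_def mixture_density_def)

lemma integral_empirical_ratio:
  assumes "h \<in> mixing_measures \<Theta>"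
  shows "(\<integral>\<theta>. empirical_mean x n (\<lambda>y. q y * ratio \<theta> y) \<partial>h)
    = empirical_mean x n (\<lambda>y. q y * (mixture_density B h y / f0 y))"
  using integrable_ratio[OF assms] by (simp add: empirical_mean_def integral_ratio)

lemma mixture_density_pos:
  assumes h: "h \<in> mixing_measures \<Theta>" and pos: "0 < f0 x"
  shows "0 < mixture_density B h x"
proof -
  interpret prob_space h using h by (simp add: mixing_measures_def)
  have AE: "AE \<theta> in h. \<theta> \<in> \<Theta>" using h by (auto simp: mixing_measures_def)
  have nonneg: "AE \<theta> in h. 0 \<le> ratio \<theta> x" using AE by eventually_elim (rule ratio_nonneg)
  have "(\<integral>\<theta>. ratio \<theta> x \<partial>h) \<noteq> 0"
  proof
    assume "(\<integral>\<theta>. ratio \<theta> x \<partial>h) = 0"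
    then have "AE \<theta> in h. ratio \<theta> x = 0"
      using integral_nonneg_eq_0_iff_AE[OF integrable_ratio[OF h] nonneg] by simp
    then have "AE \<theta> in h. False"
      using AE
    proof eventually_elim
      case (elim \<theta>)
      have "0 < product_density B \<theta> x"
        using pos f0_pos_iff product_density_pos_iff[OF \<Theta>_domain[OF elim(2)]] by blast
      then show ?case using elim(1) pos by (simp add: ratio_def)
    qed
    then show False by simp
  qed
  moreover have "0 \<le> (\<integral>\<theta>. ratio \<theta> x \<partial>h)" by (rule integral_nonneg_AE[OF nonneg])
  ultimately have "0 < (\<integral>\<theta>. ratio \<theta> x \<partial>h)" by linarith
  then show ?thesis using pos by (simp add: integral_ratio zero_less_divide_iff)
qed

text \<open>
  With \<open>s = f\<^sub>g / f\<^sub>0 - 1\<close>, maximality of the likelihood bounds the empirical quadratic form of \<open>s\<close> by the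
  empirical mean of \<open>s\<close>, which is a pure fluctuation and hence at most of order \<open>w\<close> times the
  discrepancy. The Cauchy--Schwarz inequality turns this into a bound for every mean \<open>q s\<close> and
  therefore for the discrepancy itself, which appears under a square root on the right.
\<close>

lemma npmle_discrepancy_bound:
  fixes CI w V :: real
  assumes g: "g \<in> NPMLE B \<Theta> n x" and n: "0 < n" and pos: "\<And>i. i < n \<Longrightarrow> 0 < f0 (x i)"
    and CI: "0 \<le> CI" "\<And>U u. jet_bounded U u \<Longrightarrow> \<bar>(\<integral>\<theta>. u \<theta> \<partial>g) - (\<integral>\<theta>. u \<theta> \<partial>g0)\<bar> \<le> CI * U * discrepancy g g0"
    and jets1: "jet_bounded w (\<lambda>\<theta>. empirical_mean x n (\<lambda>y. 1 * ratio \<theta> y) - 1)"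
    and jets: "\<And>Q. Q \<in> node_functions \<Longrightarrow> jet_bounded w (\<lambda>\<theta>. empirical_mean x n (\<lambda>y. q Q y * ratio \<theta> y) - Q \<theta>)"
    and V: "\<And>Q. Q \<in> node_functions \<Longrightarrow> empirical_mean x n (\<lambda>y. (q Q y)\<^sup>2 * (1 + envelope R y)) \<le> V"
    and small: "card node_functions * (CI * w) \<le> 1 / 2"
  shows "discrepancy g g0 \<le> 8 * (real (card node_functions))\<^sup>2 * CI * w * V"
proof -
  define N where "N = real (card node_functions)"
  define \<Delta> where "\<Delta> = discrepancy g g0"
  have \<Delta>: "0 \<le> \<Delta>" unfolding \<Delta>_def by (rule discrepancy_nonneg)
  have w: "0 \<le> w" using jets1 by (rule jet_bounded_nonneg)
  have gm: "g \<in> mixing_measures \<Theta>" using g by (simp add: NPMLE_def)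
  have gp: "prob_space g" "sets g = sets borel" "AE \<theta> in g. \<theta> \<in> \<Theta>" using gm by (auto simp: mixing_measures_def)
  have g0p: "prob_space g0" "sets g0 = sets borel" "AE \<theta> in g0. \<theta> \<in> \<Theta>" using g0 by (auto simp: mixing_measures_def)
  interpret pg: prob_space g by (rule gp(1))
  interpret pg0: prob_space g0 by (rule g0p(1))
  define G where "G i = mixture_density B g (x i) / f0 (x i)" for i
  define s where "s i = G i - 1" for i
  have G: "0 < G i" if "i < n" for i
    using mixture_density_pos[OF gm pos[OF that]] pos[OF that] by (simp add: G_def)
  have mean_s: "(\<Sum>i<n. p (x i) * s i) / n
      = (\<integral>\<theta>. empirical_mean x n (\<lambda>y. p y * ratio \<theta> y) \<partial>g) - (\<integral>\<theta>. empirical_mean x n (\<lambda>y. p y * ratio \<theta> y) \<partial>g0)" for p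
  proof -
    have "empirical_mean x n (\<lambda>y. p y * (mixture_density B g0 y / f0 y)) = (\<Sum>i<n. p (x i)) / n"
      unfolding empirical_mean_def
      using pos by (intro arg_cong[of _ _ "\<lambda>z. z / real n"] sum.cong) (auto simp: f0_def[symmetric] less_le)
    moreover have "empirical_mean x n (\<lambda>y. p y * (mixture_density B g y / f0 y)) = (\<Sum>i<n. p (x i) * G i) / n"
      by (simp add: empirical_mean_def G_def)
    ultimately show ?thesis
      unfolding integral_empirical_ratio[OF gm] integral_empirical_ratio[OF g0]
      by (simp add: s_def right_diff_distrib sum_subtractf diff_divide_distrib)
  qed
  have int_L: "integrable h (\<lambda>\<theta>. empirical_mean x n (\<lambda>y. p y * ratio \<theta> y))" if "h \<in> mixing_measures \<Theta>" for h p
    unfolding empirical_mean_def using integrable_ratio[OF that] by auto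
  have mean_le: "(\<Sum>i<n. s i) / n \<le> CI * w * \<Delta>"
  proof -
    have "(\<Sum>i<n. s i) / n
        = (\<integral>\<theta>. empirical_mean x n (\<lambda>y. 1 * ratio \<theta> y) - 1 \<partial>g) - (\<integral>\<theta>. empirical_mean x n (\<lambda>y. 1 * ratio \<theta> y) - 1 \<partial>g0)"
      using mean_s[of "\<lambda>_. 1"] int_L[OF gm, of "\<lambda>_. 1"] int_L[OF g0, of "\<lambda>_. 1"]
      by (simp add: pg.prob_space pg0.prob_space)
    then show ?thesis using CI(2)[OF jets1] by (simp add: \<Delta>_def)
  qed
  have quad: "(\<Sum>i<n. (s i)\<^sup>2 / (2 + s i)) / n \<le> 2 * (CI * w * \<Delta>)"
  proof -
    have "0 \<le> log_likelihood B n x g - log_likelihood B n x g0"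
      using g g0 by (simp add: NPMLE_def)
    also have "\<dots> = (\<Sum>i<n. ln (1 + s i))"
      unfolding log_likelihood_def sum_subtractf[symmetric]
    proof (intro sum.cong refl)
      fix i assume "i \<in> {..<n}"
      then have "0 < mixture_density B g (x i)" "0 < f0 (x i)"
        using mixture_density_pos[OF gm pos] pos by auto
      then show "ln (mixture_density B g (x i)) - ln (mixture_density B g0 (x i)) = ln (1 + s i)"
        by (simp add: s_def G_def ln_div f0_def[symmetric])
    qed
    also have "\<dots> \<le> (\<Sum>i<n. s i - (s i)\<^sup>2 / (2 * (2 + s i)))"
      using G by (intro sum_mono ln_add_one_le_quadratic) (auto simp: s_def)
    also have "\<dots> = (\<Sum>i<n. s i) - (\<Sum>i<n. (s i)\<^sup>2 / (2 + s i)) / 2"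
      by (simp only: sum_subtractf sum_divide_distrib divide_divide_eq_left mult.commute[of 2])
    finally have "(\<Sum>i<n. (s i)\<^sup>2 / (2 + s i)) \<le> 2 * (\<Sum>i<n. s i)" by simp
    then have "(\<Sum>i<n. (s i)\<^sup>2 / (2 + s i)) / n \<le> 2 * ((\<Sum>i<n. s i) / n)"
      using n by (simp add: divide_right_mono)
    then show ?thesis using mean_le by linarith
  qed
  have each: "\<bar>(\<integral>\<theta>. Q \<theta> \<partial>g) - (\<integral>\<theta>. Q \<theta> \<partial>g0)\<bar> \<le> sqrt (2 * (CI * w * \<Delta>) * V) + CI * w * \<Delta>"
    if Q: "Q \<in> node_functions" for Q
  proof -
    have Qint: "integrable g Q" "integrable g0 Q"
      using Q node_functions_poly polynomials_jet_bounded integrable_jet_bounded gp g0p by (metis subsetD)+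
    let ?L = "\<lambda>\<theta>. empirical_mean x n (\<lambda>y. q Q y * ratio \<theta> y)"
    have "(\<integral>\<theta>. ?L \<theta> - Q \<theta> \<partial>g) - (\<integral>\<theta>. ?L \<theta> - Q \<theta> \<partial>g0)
        = (\<Sum>i<n. q Q (x i) * s i) / n - ((\<integral>\<theta>. Q \<theta> \<partial>g) - (\<integral>\<theta>. Q \<theta> \<partial>g0))"
      using mean_s[of "q Q"] int_L[OF gm] int_L[OF g0] Qint by simp
    then have 1: "\<bar>(\<integral>\<theta>. Q \<theta> \<partial>g) - (\<integral>\<theta>. Q \<theta> \<partial>g0)\<bar> \<le> \<bar>(\<Sum>i<n. q Q (x i) * s i) / n\<bar> + CI * w * \<Delta>"
      using CI(2)[OF jets[OF Q]] unfolding \<Delta>_def by linarith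
    define a where "a i = s i / sqrt (2 + s i)" for i
    define b where "b i = q Q (x i) * sqrt (2 + s i)" for i
    have s2: "0 < 2 + s i" if "i < n" for i using G[OF that] by (simp add: s_def)
    have "(\<Sum>i<n. q Q (x i) * s i) = (\<Sum>i<n. a i * b i)"
    proof (intro sum.cong refl)
      fix i assume "i \<in> {..<n}"
      then have "sqrt (2 + s i) \<noteq> 0" using s2[of i] by (metis lessThan_iff less_irrefl real_sqrt_eq_0_iff)
      then have "a i * b i = q Q (x i) * s i" unfolding a_def b_def by (metis mult.commute mult.left_commute nonzero_eq_divide_eq)
      then show "q Q (x i) * s i = a i * b i" ..
    qed
    then have "((\<Sum>i<n. q Q (x i) * s i) / n)\<^sup>2 \<le> ((\<Sum>i<n. (a i)\<^sup>2) * (\<Sum>i<n. (b i)\<^sup>2)) / (real n)\<^sup>2"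
      using Cauchy_Schwarz_ineq_sum[of a b "{..<n}"] by (simp add: power_divide divide_right_mono)
    also have "\<dots> = ((\<Sum>i<n. (a i)\<^sup>2) / n) * ((\<Sum>i<n. (b i)\<^sup>2) / n)"
      by (simp add: power2_eq_square)
    also have "\<dots> \<le> (2 * (CI * w * \<Delta>)) * V"
    proof (intro mult_mono)
      have "(\<Sum>i<n. (a i)\<^sup>2) = (\<Sum>i<n. (s i)\<^sup>2 / (2 + s i))"
        using s2[THEN less_imp_le] by (intro sum.cong) (auto simp: a_def power_divide)
      then show "(\<Sum>i<n. (a i)\<^sup>2) / n \<le> 2 * (CI * w * \<Delta>)" using quad by simp
      have "(\<Sum>i<n. (b i)\<^sup>2) \<le> (\<Sum>i<n. (q Q (x i))\<^sup>2 * (1 + envelope R (x i)))"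
      proof (intro sum_mono)
        fix i assume i: "i \<in> {..<n}"
        have "G i = (\<integral>\<theta>. ratio \<theta> (x i) \<partial>g)" by (simp add: G_def integral_ratio)
        also have "\<dots> \<le> (\<integral>\<theta>. envelope R (x i) \<partial>g)"
          using gp(3) ratio_le_envelope integrable_ratio[OF gm]
          by (intro integral_mono_AE) (auto elim!: eventually_mono)
        also have "\<dots> = envelope R (x i)" by (simp add: pg.prob_space)
        finally have "2 + s i \<le> 1 + envelope R (x i)" by (simp add: s_def)
        then show "(b i)\<^sup>2 \<le> (q Q (x i))\<^sup>2 * (1 + envelope R (x i))"
          using s2[of i, THEN less_imp_le] i by (auto simp: b_def power_mult_distrib intro!: mult_left_mono)
      qed
      then have "(\<Sum>i<n. (b i)\<^sup>2) / n \<le> empirical_mean x n (\<lambda>y. (q Q y)\<^sup>2 * (1 + envelope R y))"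
        unfolding empirical_mean_def by (intro divide_right_mono) auto
      then show "(\<Sum>i<n. (b i)\<^sup>2) / n \<le> V" using V[OF Q] by linarith
      show "0 \<le> 2 * (CI * w * \<Delta>)" using CI(1) w \<Delta> by simp
      show "0 \<le> (\<Sum>i<n. (b i)\<^sup>2) / n" by (intro divide_nonneg_nonneg sum_nonneg) auto
    qed
    finally have "\<bar>(\<Sum>i<n. q Q (x i) * s i) / n\<bar> \<le> sqrt ((2 * (CI * w * \<Delta>)) * V)"
      by (rule real_le_rsqrt[of "\<bar>_\<bar>", unfolded power2_abs])
    with 1 show ?thesis by linarith
  qed
  obtain Q0 where Q0: "Q0 \<in> node_functions" unfolding node_functions_def by auto
  have V0: "0 \<le> V"
  proof -
    have "0 \<le> empirical_mean x n (\<lambda>y. (q Q0 y)\<^sup>2 * (1 + envelope R y))"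
      unfolding empirical_mean_def using envelope_nonneg[OF R_nonneg]
      by (intro divide_nonneg_nonneg sum_nonneg mult_nonneg_nonneg) auto
    then show ?thesis using V[OF Q0] by linarith
  qed
  have "\<Delta> \<le> (\<Sum>Q\<in>node_functions. sqrt (2 * (CI * w * \<Delta>) * V) + CI * w * \<Delta>)"
    unfolding \<Delta>_def discrepancy_def by (intro sum_mono each[unfolded \<Delta>_def discrepancy_def])
  also have "\<dots> = N * sqrt (2 * (CI * w * \<Delta>) * V) + N * (CI * w) * \<Delta>"
    by (simp add: N_def distrib_left mult.assoc)
  also have "N * (CI * w) * \<Delta> \<le> 1 / 2 * \<Delta>"
    using small \<Delta> by (intro mult_right_mono) (auto simp: N_def)
  finally have "\<Delta> \<le> 2 * N * sqrt (2 * (CI * w * \<Delta>) * V)" by simp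
  then have "\<Delta>\<^sup>2 \<le> (2 * N * sqrt (2 * (CI * w * \<Delta>) * V))\<^sup>2" using \<Delta> by (intro power_mono) auto
  also have "\<dots> = (2 * N)\<^sup>2 * (2 * (CI * w * \<Delta>) * V)"
    using CI(1) w \<Delta> V0 by (simp add: power_mult_distrib)
  finally have "\<Delta> * \<Delta> \<le> (8 * N\<^sup>2 * CI * w * V) * \<Delta>" by (simp add: power2_eq_square mult_ac)
  then have "\<Delta> \<le> 8 * N\<^sup>2 * CI * w * V"
  proof (cases "\<Delta> = 0")
    case True
    then show ?thesis using CI(1) w V0 by (simp add: N_def)
  next
    case False
    then show ?thesis using \<Delta> \<open>\<Delta> * \<Delta> \<le> _\<close> by (simp add: mult_le_cancel_right)
  qed
  then show ?thesis by (simp add: \<Delta>_def N_def)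
qed

lemma integral_product_density:
  assumes "\<theta> \<in> parameter_domain B"
  shows "(\<integral>x. product_density B \<theta> x \<partial>base_measure B) = 1"
proof -
  have *: "l \<in> B \<or> 0 \<le> \<theta> $ l" for l using assms by (auto simp: parameter_domain_def less_imp_le)
  have one: "coord_estimator B l 0 x = 1" for l x by (simp add: coord_estimator_def)
  have "integrable (coord_measure B l) (coord_density B l (\<theta> $ l))"
    "(\<integral>x. coord_density B l (\<theta> $ l) x \<partial>coord_measure B l) = 1" for l
    using coord_estimator_unbiased[OF *, of l 0] unfolding one by simp_all
  then show ?thesis
    unfolding product_density_eq by (subst base_measure_integral_prod(2)) auto
qed

end

lemma markov_outside:
  fixes W :: "'w \<Rightarrow> ennreal"
  assumes M: "prob_space M" and W: "W \<in> borel_measurable M" "(\<integral>\<^sup>+\<omega>. W \<omega> \<partial>M) \<le> ennreal b" and t: "0 < t" "0 \<le> b"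
  shows "{\<omega> \<in> space M. \<not> W \<omega> \<le> ennreal t} \<in> sets M"
    and "measure M {\<omega> \<in> space M. \<not> W \<omega> \<le> ennreal t} \<le> b / t"
proof -
  interpret prob_space M by fact
  note [measurable] = W(1)
  show meas: "{\<omega> \<in> space M. \<not> W \<omega> \<le> ennreal t} \<in> sets M" by measurable
  have "emeasure M {\<omega> \<in> space M. \<not> W \<omega> \<le> ennreal t} \<le> emeasure M {\<omega> \<in> space M. 1 \<le> ennreal (1 / t) * W \<omega>}"
  proof (rule emeasure_mono)
    show "{\<omega> \<in> space M. \<not> W \<omega> \<le> ennreal t} \<subseteq> {\<omega> \<in> space M. 1 \<le> ennreal (1 / t) * W \<omega>}"
    proof safe
      fix \<omega> assume "\<not> W \<omega> \<le> ennreal t"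
      then have "ennreal (1 / t) * ennreal t \<le> ennreal (1 / t) * W \<omega>" by (intro mult_left_mono) auto
      then show "1 \<le> ennreal (1 / t) * W \<omega>" using t by (simp add: ennreal_mult[symmetric])
    qed
  qed measurable
  also have "\<dots> \<le> ennreal (1 / t) * (\<integral>\<^sup>+\<omega>. W \<omega> * indicator (space M) \<omega> \<partial>M)"
    by (rule nn_integral_Markov_inequality) auto
  also have "(\<integral>\<^sup>+\<omega>. W \<omega> * indicator (space M) \<omega> \<partial>M) = (\<integral>\<^sup>+\<omega>. W \<omega> \<partial>M)"
    by (intro nn_integral_cong) auto
  also have "ennreal (1 / t) * \<dots> \<le> ennreal (1 / t) * ennreal b" using W(2) by (intro mult_left_mono) auto
  also have "\<dots> = ennreal (b / t)" using t by (simp add: ennreal_mult[symmetric])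
  finally show "measure M {\<omega> \<in> space M. \<not> W \<omega> \<le> ennreal t} \<le> b / t"
    using t by (simp add: emeasure_eq_measure)
qed

context mixture_sample
begin

text \<open>
  Outside an event of small probability, the jets of the finitely many processes are bounded by
  \<open>K / sqrt n\<close> and the weighted second moments of the estimators by \<open>K\<close>. There the deterministic bound applies to
  every maximizer, in whatever way it depends on the sample.
\<close>

theorem npmle_rate:
  assumes ghat: "\<And>n \<omega>. \<omega> \<in> NPMLE_exists M B \<Theta> X n \<Longrightarrow> ghat n \<omega> \<in> NPMLE B \<Theta> n (\<lambda>i. X i \<omega>)"
  shows "bigO_P M (NPMLE_exists M B \<Theta> X) (\<lambda>n \<omega>. wasserstein1 (ghat n \<omega>) g0)
           (\<lambda>n \<omega>. 1 / ennreal (real n powr (1/4)))"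
proof -
  interpret M: prob_space M by (rule prob_M)
  obtain CW where CW: "CW \<ge> 0" "\<And>g. prob_space g \<Longrightarrow> sets g = sets borel \<Longrightarrow> (AE \<theta> in g. \<theta> \<in> \<Theta>) \<Longrightarrow>
    wasserstein1 g g0 \<le> ennreal (CW * (sqrt (discrepancy g g0) + discrepancy g g0))"
    using wasserstein1_le_discrepancy[OF prob_g0 sets_g0 S_AE S_pos] by blast
  obtain CI where CI: "CI \<ge> 0" "\<And>U u g. jet_bounded U u \<Longrightarrow> prob_space g \<Longrightarrow> sets g = sets borel \<Longrightarrow>
      (AE \<theta> in g. \<theta> \<in> \<Theta>) \<Longrightarrow> \<bar>(\<integral>\<theta>. u \<theta> \<partial>g) - (\<integral>\<theta>. u \<theta> \<partial>g0)\<bar> \<le> CI * U * discrepancy g g0"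
    using jet_bounded_integral_diff prob_g0 sets_g0 S_AE by meson
  have "\<exists>q. Q \<in> node_functions \<longrightarrow> q \<in> borel_measurable borel \<and> exp_bounded q \<and>
    (\<forall>\<theta>\<in>parameter_domain B. (\<integral>x. q x * product_density B \<theta> x \<partial>base_measure B) = Q \<theta>)" for Q
    using unbiased_estimator_exists[of Q B] polynomials_exponential_sums node_functions_poly by blast
  then obtain q where q: "\<And>Q. Q \<in> node_functions \<Longrightarrow> q Q \<in> borel_measurable borel"
    "\<And>Q. Q \<in> node_functions \<Longrightarrow> exp_bounded (q Q)"
    "\<And>Q \<theta>. Q \<in> node_functions \<Longrightarrow> \<theta> \<in> parameter_domain B \<Longrightarrow>
       (\<integral>x. q Q x * product_density B \<theta> x \<partial>base_measure B) = Q \<theta>"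
    by metis
  \<comment> \<open>Pairs of an estimator and its expectation. The pair of constants is for the mean of \<open>s\<close> itself.\<close>
  define J where "J = insert (\<lambda>_. 1, \<lambda>_. 1) ((\<lambda>Q. (q Q, Q)) ` node_functions)"
  have J_fin: "finite J" unfolding J_def using finite_node_functions by simp
  have J: "exp_bounded (fst p)" "fst p \<in> borel_measurable borel" "snd p \<in> borel_measurable borel"
    "\<And>\<theta>. \<theta> \<in> \<Theta> \<Longrightarrow> (\<integral>x. fst p x * product_density B \<theta> x \<partial>base_measure B) = snd p \<theta>" if "p \<in> J" for p
  proof -
    have nf: "Q \<in> borel_measurable borel" if "Q \<in> node_functions" for Q
      using that node_functions_poly polynomials_jet_bounded jet_boundedD(1) by blast
    show "exp_bounded (fst p)" "fst p \<in> borel_measurable borel" "snd p \<in> borel_measurable borel"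
      using that q nf by (auto simp: J_def exp_bounded_const)
    show "(\<integral>x. fst p x * product_density B \<theta> x \<partial>base_measure B) = snd p \<theta>" if "\<theta> \<in> \<Theta>" for \<theta>
      using \<open>p \<in> J\<close> q(3) integral_product_density \<Theta>_domain[OF that] by (auto simp: J_def)
  qed
  define good where "good p n C W0 \<longleftrightarrow> W0 \<in> borel_measurable M \<and> (\<integral>\<^sup>+\<omega>. W0 \<omega> \<partial>M) \<le> ennreal (C / sqrt n) \<and>
    (\<forall>\<omega>\<in>space M. \<forall>w. W0 \<omega> \<le> ennreal w \<longrightarrow> 0 \<le> w \<longrightarrow>
       jet_bounded w (\<lambda>\<theta>. emp n \<omega> (\<lambda>x. fst p x * ratio \<theta> x) - snd p \<theta>))"
    for p :: "(real ^ 'd \<Rightarrow> real) \<times> (real ^ 'd \<Rightarrow> real)" and n :: nat and C :: real and W0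
  have "\<forall>p\<in>J. \<exists>C\<ge>0. \<forall>n>0. \<exists>W0. good p n C W0"
    unfolding good_def by (intro ballI empirical_process_jet_bounded J)
  then obtain Cf where Cf: "\<And>p. p \<in> J \<Longrightarrow> Cf p \<ge> 0" "\<And>p n. p \<in> J \<Longrightarrow> 0 < n \<Longrightarrow> \<exists>W0. good p n (Cf p) W0"
    by metis
  then obtain W where good: "\<And>p n. p \<in> J \<Longrightarrow> 0 < n \<Longrightarrow> good p n (Cf p) (W p n)"
    by metis
  note W = good[unfolded good_def, THEN conjunct1]
    good[unfolded good_def, THEN conjunct2, THEN conjunct1]
    good[unfolded good_def, THEN conjunct2, THEN conjunct2, rule_format]
  define Ct where "Ct = (\<Sum>p\<in>J. Cf p)"
  have Ct: "0 \<le> Ct" unfolding Ct_def using Cf(1) by (intro sum_nonneg)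
  define v where "v y = (\<Sum>p\<in>J. (fst p y)\<^sup>2 * (1 + envelope R y))" for y
  have env1: "0 \<le> 1 + envelope R y" for y using envelope_nonneg[OF R_nonneg, of y] by simp
  have v0: "0 \<le> v y" for y unfolding v_def using env1 by (intro sum_nonneg) auto
  have [measurable]: "v \<in> borel_measurable borel"
    unfolding v_def using J by measurable
  have v_eb: "exp_bounded v"
    unfolding v_def[abs_def] power2_eq_square using J J_fin R_nonneg
    by (intro exp_bounded_sum exp_bounded_mult exp_bounded_add exp_bounded_const exp_bounded_envelope) auto
  define v1 where "v1 = (\<integral>y. v y \<partial>law)"
  have v1: "0 \<le> v1" unfolding v1_def using v0 by simp
  have int_vX: "integrable M (\<lambda>\<omega>. v (X i \<omega>))" "(\<integral>\<omega>. v (X i \<omega>) \<partial>M) = v1" for i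
  proof -
    have "integrable (distr M borel (X i)) v" unfolding distr_X by (rule integrable_law[OF v_eb]) measurable
    then show "integrable M (\<lambda>\<omega>. v (X i \<omega>))" by (subst (asm) integrable_distr_eq) auto
    have "(\<integral>y. v y \<partial>distr M borel (X i)) = (\<integral>\<omega>. v (X i \<omega>) \<partial>M)" by (rule integral_distr) auto
    then show "(\<integral>\<omega>. v (X i \<omega>) \<partial>M) = v1" by (simp add: distr_X v1_def)
  qed
  have Ev: "(\<integral>\<^sup>+\<omega>. ennreal (emp n \<omega> v) \<partial>M) \<le> ennreal v1" for n
  proof -
    have "(\<integral>\<^sup>+\<omega>. ennreal (emp n \<omega> v) \<partial>M) = ennreal (\<integral>\<omega>. emp n \<omega> v \<partial>M)"
      unfolding empirical_mean_def using int_vX v0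
      by (intro nn_integral_eq_integral) (auto intro!: divide_nonneg_nonneg sum_nonneg)
    also have "(\<integral>\<omega>. emp n \<omega> v \<partial>M) \<le> v1"
      unfolding empirical_mean_def using int_vX v1 by simp
    finally show ?thesis by (simp add: ennreal_leI)
  qed
  define N where "N = real (card node_functions)"
  show ?thesis
    unfolding bigO_P_def
  proof (intro allI impI)
    fix \<epsilon> :: real assume \<epsilon>: "0 < \<epsilon>"
    \<comment> \<open>Markov's inequality gives the probabilities \<open>Ct / K\<close> and \<open>v1 / K\<close>.\<close>
    define K where "K = (Ct + v1 + 1) / \<epsilon>"
    have K: "0 < K" using Ct v1 \<epsilon> by (simp add: K_def)
    have Ke: "Ct / K + v1 / K \<le> \<epsilon>"
    proof -
      have "(Ct + v1) / K \<le> \<epsilon>" using Ct v1 \<epsilon> K by (simp add: K_def divide_le_eq)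
      then show ?thesis by (simp add: add_divide_distrib)
    qed
    define c where "c = 8 * N\<^sup>2 * CI * K * K"
    have c: "0 \<le> c" unfolding c_def using CI K by (simp add: N_def)
    define C where "C = CW * (sqrt c + c) + 1"
    have C: "0 < C" unfolding C_def using CW c by (intro add_nonneg_pos mult_nonneg_nonneg) auto
    have "\<forall>\<^sub>F n in sequentially. \<exists>E\<in>sets M. measure M E \<le> \<epsilon> \<and>
      {\<omega> \<in> NPMLE_exists M B \<Theta> X n. \<not> wasserstein1 (ghat n \<omega>) g0 \<le> ennreal C * (1 / ennreal (real n powr (1/4)))} \<subseteq> E"
      \<comment> \<open>From this index on, the linear term \<open>N * CI * w * \<Delta>\<close> is at most half of \<open>\<Delta>\<close>.\<close>
      using eventually_ge_at_top[of "nat \<lceil>(2 * N * CI * K)\<^sup>2\<rceil> + 1"]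
    proof eventually_elim
      case (elim n)
      have n: "0 < n" using elim by simp
      have "(2 * N * CI * K)\<^sup>2 \<le> real n" using elim by linarith
      then have sqn: "2 * N * CI * K \<le> sqrt n" by (rule real_le_rsqrt)
      define w where "w = K / sqrt n"
      have w: "0 < w" using K n by (simp add: w_def)
      have small: "N * (CI * w) \<le> 1 / 2" using sqn n by (simp add: w_def field_simps)
      define Ws where "Ws \<omega> = (\<Sum>p\<in>J. W p n \<omega>)" for \<omega>
      have Ws_meas: "Ws \<in> borel_measurable M" unfolding Ws_def using W(1) n by measurable
      have EWs: "(\<integral>\<^sup>+\<omega>. Ws \<omega> \<partial>M) \<le> ennreal (Ct / sqrt n)"
      proof -
        have "(\<integral>\<^sup>+\<omega>. Ws \<omega> \<partial>M) = (\<Sum>p\<in>J. \<integral>\<^sup>+\<omega>. W p n \<omega> \<partial>M)"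
          unfolding Ws_def using W(1) n by (intro nn_integral_sum) auto
        also have "\<dots> \<le> (\<Sum>p\<in>J. ennreal (Cf p / sqrt n))" using W(2) n by (intro sum_mono) auto
        also have "\<dots> = ennreal (Ct / sqrt n)"
          unfolding Ct_def sum_divide_distrib using Cf(1) by (intro sum_ennreal) auto
        finally show ?thesis .
      qed
      define E1 where "E1 = {\<omega> \<in> space M. \<not> Ws \<omega> \<le> ennreal w}"
      define E2 where "E2 = {\<omega> \<in> space M. \<not> ennreal (emp n \<omega> v) \<le> ennreal K}"
      define E3 where "E3 = {\<omega> \<in> space M. \<not> (\<forall>i. 0 < f0 (X i \<omega>))}"
      have emp_meas: "(\<lambda>\<omega>. ennreal (emp n \<omega> v)) \<in> borel_measurable M" unfolding empirical_mean_def by measurable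
      have E1: "E1 \<in> sets M" "measure M E1 \<le> Ct / K"
        using markov_outside[OF prob_M Ws_meas EWs w] Ct n K unfolding E1_def by (simp_all add: w_def)
      have E2: "E2 \<in> sets M" "measure M E2 \<le> v1 / K"
        using markov_outside[OF prob_M emp_meas Ev K v1] unfolding E2_def by simp_all
      have E3: "E3 \<in> sets M" "measure M E3 = 0"
      proof -
        show "E3 \<in> sets M" unfolding E3_def by measurable
        then show "measure M E3 = 0"
          using AE_X_positive AE_iff_measurable[of E3 M "\<lambda>\<omega>. \<forall>i. 0 < f0 (X i \<omega>)"]
          by (simp add: E3_def measure_def)
      qed
      define E where "E = E1 \<union> E2 \<union> E3"
      have "measure M E \<le> measure M E1 + measure M E2 + measure M E3"
        unfolding E_def using measure_Un_le[of "E1 \<union> E2" M E3] measure_Un_le[of E1 M E2] E1(1) E2(1) E3(1)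
        by simp
      then have "measure M E \<le> \<epsilon>" using E1 E2 E3 Ke by linarith
      moreover have "E \<in> sets M" unfolding E_def using E1 E2 E3 by auto
      moreover have "wasserstein1 (ghat n \<omega>) g0 \<le> ennreal C * (1 / ennreal (real n powr (1/4)))"
        if \<omega>: "\<omega> \<in> NPMLE_exists M B \<Theta> X n" "\<omega> \<notin> E" for \<omega>
      proof -
        have sp: "\<omega> \<in> space M" using \<omega>(1) by (simp add: NPMLE_exists_def)
        have Ws: "Ws \<omega> \<le> ennreal w" and emp: "emp n \<omega> v \<le> K" and pos: "\<And>i. 0 < f0 (X i \<omega>)"
          using \<omega>(2) sp K by (auto simp: E_def E1_def E2_def E3_def ennreal_le_iff)
        have gN: "ghat n \<omega> \<in> NPMLE B \<Theta> n (\<lambda>i. X i \<omega>)" by (rule ghat[OF \<omega>(1)])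
        then have gp: "prob_space (ghat n \<omega>)" "sets (ghat n \<omega>) = sets borel" "AE \<theta> in ghat n \<omega>. \<theta> \<in> \<Theta>"
          by (auto simp: NPMLE_def mixing_measures_def)
        have jets: "jet_bounded w (\<lambda>\<theta>. emp n \<omega> (\<lambda>x. fst p x * ratio \<theta> x) - snd p \<theta>)" if "p \<in> J" for p
        proof (rule W(3)[OF that n sp])
          have "W p n \<omega> \<le> Ws \<omega>" unfolding Ws_def using that J_fin by (intro member_le_sum) auto
          then show "W p n \<omega> \<le> ennreal w" using Ws by (rule order_trans)
        qed (use w in simp)
        have jets1: "jet_bounded w (\<lambda>\<theta>. emp n \<omega> (\<lambda>x. 1 * ratio \<theta> x) - 1)"
          using jets[of "(\<lambda>_. 1, \<lambda>_. 1)"] by (simp add: J_def)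
        have jetsQ: "jet_bounded w (\<lambda>\<theta>. emp n \<omega> (\<lambda>x. q Q x * ratio \<theta> x) - Q \<theta>)" if "Q \<in> node_functions" for Q
          using jets[of "(q Q, Q)"] that by (simp add: J_def)
        have Vq: "emp n \<omega> (\<lambda>y. (q Q y)\<^sup>2 * (1 + envelope R y)) \<le> K" if "Q \<in> node_functions" for Q
        proof -
          have "emp n \<omega> (\<lambda>y. (q Q y)\<^sup>2 * (1 + envelope R y)) \<le> emp n \<omega> v"
          proof (rule empirical_mean_mono)
            fix y
            have "(fst (q Q, Q) y)\<^sup>2 * (1 + envelope R y) \<le> v y"
              unfolding v_def using that J_fin env1
              by (intro member_le_sum[of "(q Q, Q)" J "\<lambda>p. (fst p y)\<^sup>2 * (1 + envelope R y)"]) (auto simp: J_def)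
            then show "(q Q y)\<^sup>2 * (1 + envelope R y) \<le> v y" by simp
          qed
          then show ?thesis using emp by linarith
        qed
        define \<Delta> where "\<Delta> = discrepancy (ghat n \<omega>) g0"
        have "\<Delta> \<le> 8 * N\<^sup>2 * CI * w * K"
          unfolding \<Delta>_def N_def
          by (rule npmle_discrepancy_bound[OF gN n pos CI(1) CI(2)[OF _ gp] jets1 jetsQ Vq small[unfolded N_def]])
        also have "\<dots> = c / sqrt n" by (simp add: c_def w_def)
        finally have \<Delta>c: "\<Delta> \<le> c / sqrt n" .
        define r where "r = real n powr (1/4)"
        have r: "1 \<le> r" using n by (simp add: r_def ge_one_powr_ge_zero)
        have r2: "sqrt n = r * r"
          using n by (simp add: r_def powr_half_sqrt[symmetric] powr_add[symmetric])
        have sq: "sqrt \<Delta> \<le> sqrt c / r"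
        proof -
          have "sqrt \<Delta> \<le> sqrt (c / (r * r))" using \<Delta>c by (simp add: r2)
          also have "\<dots> = sqrt c / r" using r by (simp add: real_sqrt_divide)
          finally show ?thesis .
        qed
        have lin: "\<Delta> \<le> c / r"
        proof -
          have "c / (r * r) \<le> c / r"
            using c r by (intro divide_left_mono) (auto simp: mult_le_cancel_left1)
          then show ?thesis using \<Delta>c by (simp add: r2)
        qed
        have "CW * (sqrt \<Delta> + \<Delta>) \<le> CW * (sqrt c / r + c / r)"
          using CW(1) sq lin by (intro mult_left_mono add_mono)
        also have "\<dots> \<le> C / r"
          using r by (simp add: C_def add_divide_distrib distrib_left)
        finally have le: "CW * (sqrt \<Delta> + \<Delta>) \<le> C / r" .
        have "wasserstein1 (ghat n \<omega>) g0 \<le> ennreal (CW * (sqrt \<Delta> + \<Delta>))"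
          unfolding \<Delta>_def by (rule CW(2)[OF gp])
        also have "\<dots> \<le> ennreal (C / r)" using le by (rule ennreal_leI)
        also have "\<dots> = ennreal C * (1 / ennreal r)"
          using r C by (simp add: divide_ennreal[symmetric] ennreal_times_divide)
        finally show ?thesis by (simp add: r_def)
      qed
      then have "{\<omega> \<in> NPMLE_exists M B \<Theta> X n. \<not> wasserstein1 (ghat n \<omega>) g0 \<le> ennreal C * (1 / ennreal (real n powr (1/4)))} \<subseteq> E"
        by blast
      ultimately show ?case by blast
    qed
    with C show "\<exists>C::real. 0 < C \<and> (\<forall>\<^sub>F n in sequentially. \<exists>E\<in>sets M. measure M E \<le> \<epsilon> \<and>
      {\<omega> \<in> NPMLE_exists M B \<Theta> X n. \<not> wasserstein1 (ghat n \<omega>) g0 \<le> ennreal C * (1 / ennreal (real n powr (1/4)))} \<subseteq> E)"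
      by blast
  qed
qed

end

section \<open>Support sizes, atoms and the rate\<close>

text \<open>
  Otherwise countably many open null sets would cover the space.
\<close>

lemma support_nonempty:
  fixes g :: "'a::second_countable_topology measure"
  assumes "prob_space g" "sets g = sets borel"
  shows "support g \<noteq> {}"
proof
  interpret prob_space g by fact
  assume "support g = {}"
  then have "\<forall>\<theta>. \<exists>U. open U \<and> \<theta> \<in> U \<and> emeasure g U = 0"
    by (auto simp: support_def)
  then obtain U where U: "\<And>\<theta>. open (U \<theta>)" "\<And>\<theta>. \<theta> \<in> U \<theta>" "\<And>\<theta>. emeasure g (U \<theta>) = 0" by metis
  obtain F where F: "F \<subseteq> range U" "countable F" "\<Union> F = \<Union> (range U)"
    using Lindelof[of "range U"] U(1) by blast
  have "emeasure g (\<Union> F) = 0"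
  proof -
    have "\<And>A. A \<in> F \<Longrightarrow> A \<in> null_sets g"
      using F(1) U(1,3) assms(2) by (auto simp: null_sets_def)
    then have "(\<Union>A\<in>F. A) \<in> null_sets g" by (rule null_sets_UN'[OF F(2)])
    then show ?thesis by auto
  qed
  moreover have "\<Union> F = UNIV" unfolding F(3) using U(2) by auto
  moreover have "space g = UNIV" using sets_eq_imp_space_eq[OF assms(2)] by simp
  ultimately show False using emeasure_space_1 by simp
qed

lemma support_size_ge_1:
  fixes g :: "'a::second_countable_topology measure"
  assumes "prob_space g" "sets g = sets borel"
  shows "1 \<le> support_size g"
proof -
  obtain \<theta> where "\<theta> \<in> support g" using support_nonempty[OF assms] by auto
  then have "emeasure (count_space UNIV) {\<theta>} \<le> support_size g"
    unfolding support_size_def by (intro emeasure_mono) auto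
  then show ?thesis by simp
qed

lemma bigO_P_mono_rate:
  assumes "bigO_P M A Y r" "\<And>n \<omega>. \<omega> \<in> A n \<Longrightarrow> r n \<omega> \<le> r' n \<omega>"
  shows "bigO_P M A Y r'"
  unfolding bigO_P_def
proof (intro allI impI)
  fix \<epsilon> :: real assume "0 < \<epsilon>"
  then obtain C where C: "0 < C" "\<forall>\<^sub>F n in sequentially.
      \<exists>E\<in>sets M. measure M E \<le> \<epsilon> \<and> {\<omega> \<in> A n. \<not> Y n \<omega> \<le> ennreal C * r n \<omega>} \<subseteq> E"
    using assms(1) unfolding bigO_P_def by blast
  have "ennreal C * r n \<omega> \<le> ennreal C * r' n \<omega>" if "\<omega> \<in> A n" for n \<omega>
    using assms(2)[OF that] by (intro mult_left_mono) auto
  then have "{\<omega> \<in> A n. \<not> Y n \<omega> \<le> ennreal C * r' n \<omega>} \<subseteq> {\<omega> \<in> A n. \<not> Y n \<omega> \<le> ennreal C * r n \<omega>}" for n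
    by (blast intro: order_trans)
  then have "\<forall>\<^sub>F n in sequentially.
      \<exists>E\<in>sets M. measure M E \<le> \<epsilon> \<and> {\<omega> \<in> A n. \<not> Y n \<omega> \<le> ennreal C * r' n \<omega>} \<subseteq> E"
    using C(2) by (elim eventually_mono) (meson order_trans)
  with C(1) show "\<exists>C::real. 0 < C \<and> (\<forall>\<^sub>F n in sequentially.
      \<exists>E\<in>sets M. measure M E \<le> \<epsilon> \<and> {\<omega> \<in> A n. \<not> Y n \<omega> \<le> ennreal C * r' n \<omega>} \<subseteq> E)"
    by blast
qed

lemma atoms_of_finitely_discrete:
  fixes g :: "'a::t1_space measure"
  assumes g: "prob_space g" "sets g = sets borel" "AE \<theta> in g. \<theta> \<in> \<Theta>" and fd: "finitely_discrete g"
  obtains S where "finite S" "AE \<theta> in g. \<theta> \<in> S" "\<And>a. a \<in> S \<Longrightarrow> 0 < measure g {a}" "S \<subseteq> \<Theta>" "S \<noteq> {}"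
proof -
  interpret prob_space g by fact
  have sing: "{a} \<in> sets g" for a by (simp add: g(2))
  have space: "space g = UNIV" using sets_eq_imp_space_eq[OF g(2)] by simp
  obtain S0 where S0: "finite S0" "AE \<theta> in g. \<theta> \<in> S0" using fd by (auto simp: finitely_discrete_def)
  define S where "S = {a \<in> S0. 0 < measure g {a}}"
  have null: "AE \<theta> in g. \<theta> \<noteq> a" if "\<not> 0 < measure g {a}" for a
  proof -
    have "measure g {a} = 0" using that measure_nonneg[of g "{a}"] by linarith
    then have "{a} \<in> null_sets g" using sing by (simp add: null_sets_def emeasure_eq_measure)
    from AE_not_in[OF this] show ?thesis by simp
  qed
  have "AE \<theta> in g. \<forall>a\<in>S0 - S. \<theta> \<noteq> a"
    using S0(1) null by (intro AE_finite_allI) (auto simp: S_def)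
  with S0(2) have AE_S: "AE \<theta> in g. \<theta> \<in> S" by eventually_elim blast
  have "S \<subseteq> \<Theta>"
  proof
    fix a assume a: "a \<in> S"
    show "a \<in> \<Theta>"
    proof (rule ccontr)
      assume "a \<notin> \<Theta>"
      then have "AE \<theta> in g. \<theta> \<notin> {a}" using g(3) by (auto elim!: eventually_mono)
      then have "emeasure g {a} = 0" using AE_iff_measurable[OF sing[of a], of "\<lambda>\<theta>. \<theta> \<notin> {a}"] space by auto
      then show False using a by (simp add: S_def measure_def)
    qed
  qed
  moreover have "S \<noteq> {}" using AE_S by auto
  moreover have "finite S" "\<And>a. a \<in> S \<Longrightarrow> 0 < measure g {a}" using S0(1) by (auto simp: S_def)
  ultimately show ?thesis using AE_S that by blast
qed

theorem corollary2p3: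
  fixes B :: "'d::finite set"
    and \<Theta> :: "(real ^ 'd) set"
    and g0 :: "(real ^ 'd) measure"
    and M :: "'w measure"
    and X :: "nat \<Rightarrow> 'w \<Rightarrow> real ^ 'd"
    and ghat :: "nat \<Rightarrow> 'w \<Rightarrow> (real ^ 'd) measure"
  assumes "\<Theta> \<subseteq> parameter_domain B"
    and "bounded \<Theta>"
    and "g0 \<in> mixing_measures \<Theta>"
    and "finitely_discrete g0"
    and "prob_space M"
    and "prob_space.indep_vars M (\<lambda>_. borel) X UNIV"
    and "\<And>i. distributed M (base_measure B) (X i) (\<lambda>x. ennreal (mixture_density B g0 x))"
    and "\<And>n \<omega>. \<omega> \<in> NPMLE_exists M B \<Theta> X n \<Longrightarrow> ghat n \<omega> \<in> NPMLE B \<Theta> n (\<lambda>i. X i \<omega>)"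
  shows "bigO_P M (NPMLE_exists M B \<Theta> X)
           (\<lambda>n \<omega>. wasserstein1 (ghat n \<omega>) g0)
           (\<lambda>n \<omega>. support_size (ghat n \<omega>) / ennreal (real n powr (1/4)))
       \<and> (CARD('d) = 1 \<longrightarrow>
           bigO_P M (NPMLE_exists M B \<Theta> X)
             (\<lambda>n \<omega>. wasserstein1 (ghat n \<omega>) g0)
             (\<lambda>n \<omega>. 1 / ennreal (real n powr (1/4))))"
proof -
  have g0: "prob_space g0" "sets g0 = sets borel" "AE \<theta> in g0. \<theta> \<in> \<Theta>"
    using assms(3) by (auto simp: mixing_measures_def)
  obtain S where S: "finite S" "AE \<theta> in g0. \<theta> \<in> S" "\<And>a. a \<in> S \<Longrightarrow> 0 < measure g0 {a}" "S \<subseteq> \<Theta>" "S \<noteq> {}"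
    using atoms_of_finitely_discrete[OF g0 assms(4)] by blast
  obtain R where R: "\<And>\<theta>. \<theta> \<in> \<Theta> \<Longrightarrow> norm \<theta> \<le> R" using assms(2) by (auto simp: bounded_iff)
  interpret mixture_sample B \<Theta> S g0 R M X
  proof (intro mixture_sample.intro finite_mixture_model.intro mixture_sample_axioms.intro)
    show "\<bar>\<theta> $ l\<bar> \<le> R" if "\<theta> \<in> \<Theta>" for \<theta> l
      using component_le_norm_cart[of \<theta> l] R[OF that] by linarith
  qed (fact assms S)+
  have rate: "bigO_P M (NPMLE_exists M B \<Theta> X) (\<lambda>n \<omega>. wasserstein1 (ghat n \<omega>) g0)
      (\<lambda>n \<omega>. 1 / ennreal (real n powr (1/4)))"
    using assms(8) by (rule npmle_rate)
  have "1 / ennreal (real n powr (1/4)) \<le> support_size (ghat n \<omega>) / ennreal (real n powr (1/4))"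
    if "\<omega> \<in> NPMLE_exists M B \<Theta> X n" for n \<omega>
  proof (rule divide_right_mono_ennreal)
    show "1 \<le> support_size (ghat n \<omega>)"
      using assms(8)[OF that] by (intro support_size_ge_1) (auto simp: NPMLE_def mixing_measures_def)
  qed
  with rate have "bigO_P M (NPMLE_exists M B \<Theta> X) (\<lambda>n \<omega>. wasserstein1 (ghat n \<omega>) g0)
      (\<lambda>n \<omega>. support_size (ghat n \<omega>) / ennreal (real n powr (1/4)))"
    by (rule bigO_P_mono_rate)
  with rate show ?thesis by blast
qed

end
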